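(* Let $P(z,\bar z)$, $z=(z_1,z_2)\in\mathbb C^2$, be a real-valued homogeneous polynomial of degree $d>2$ without pluriharmonic terms, such that the hypersurface $M_H=\{(z,w)\in\mathbb C^2\times\mathbb C : \operatorname{Im} w=P(z,\bar z)\}$ is holomorphically nondegenerate. Let $\mathfrak g_{1-1/d}$ be the component of weighted degree $1-\frac1d$ of $\mathfrak g=\mathrm{aut}(M_H,0)$. If $\dim\mathfrak g_{1-1/d}>0$, then $M_H$ is biholomorphically equivalent to the hypersurface $$\operatorname{Im} w=\operatorname{Re}\, z_1\bar z_2^{\,l}$$ for some positive integer $l$.
   Context: $\mathrm{aut}(M_H,0)$ is the real Lie algebra of germs at $0$ of infinitesimal CR automorphisms of $M_H$, i.e. germs at $0$ of holomorphic vector fields $X=f^1(z,w)\partial_{z_1}+f^2(z,w)\partial_{z_2}+g(z,w)\partial_w$ on $\mathbb C^3$ such that $\operatorname{Re}X$ is tangent to $M_H$. Grading: $z_1,z_2$ have weight $\frac1d$, $w$ has weight $1$, $\partial_{z_j}$ has weight $-\frac1d$ and $\partial_w$ has weight $-1$. With respect to the induced weighted degree of vector fields, $\mathfrak g=\mathrm{aut}(M_H,0)$ decomposes as $\mathfrak g=\mathfrak g_{-1}\oplus\mathfrak g_{-1/d}\oplus\mathfrak g_0\oplus\mathfrak g_{\tau/d}\oplus\mathfrak g_{1-1/d}\oplus\mathfrak g_1$ for some integer $\tau$ with $1\le\tau\le d-2$, where the index denotes the weighted degree. $M_H$ is holomorphically nondegenerate (at $0$) if there is no nonzero germ at $0$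 of a holomorphic vector field $X$ on $\mathbb C^3$ (with holomorphic coefficients) which is tangent to $M_H$ as a complex vector field. Biholomorphic equivalence is equivalence of germs at $0$ under local biholomorphisms of $\mathbb C^3$ fixing $0$. *)

theory Defs
  imports "HOL-Analysis.Analysis"
begin

text \<open>
  Points of \<open>\<complex>\<^sup>3\<close> are vectors \<open>p :: complex ^ 3\<close> with \<open>p $ 1 = z\<^sub>1\<close>, \<open>p $ 2 = z\<^sub>2\<close>, \<open>p $ 3 = w\<close>.
\<close>

definition holomorphic_map_on :: "(complex ^ 'n \<Rightarrow> complex ^ 'm) \<Rightarrow> (complex ^ 'n) set \<Rightarrow> bool" where
  "holomorphic_map_on f S \<longleftrightarrow>
     (\<forall>p\<in>S. \<exists>D. (f has_derivative D) (at p) \<and> (\<forall>c v. D (c *s v) = c *s D v))"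

definition holomorphic_near_0 :: "(complex ^ 'n \<Rightarrow> complex ^ 'm) \<Rightarrow> bool" where
  "holomorphic_near_0 f \<longleftrightarrow> (\<exists>U. open U \<and> 0 \<in> U \<and> holomorphic_map_on f U)"


subsection \<open>Germs at 0\<close>

definition germ_rel :: "('a::{topological_space,zero} \<Rightarrow> 'b) \<Rightarrow> ('a \<Rightarrow> 'b) \<Rightarrow> bool" where
  "germ_rel f g \<longleftrightarrow> (\<forall>\<^sub>F p in nhds 0. f p = g p)"

lemma equivp_germ_rel: "equivp germ_rel"
proof (rule equivpI)
  show "reflp germ_rel"
    by (simp add: reflp_def germ_rel_def)
  show "symp germ_rel"
    by (simp add: symp_def germ_rel_def eq_commute)
  show "transp germ_rel"
    unfolding transp_def germ_rel_def
    by (auto elim: eventually_elim2)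
qed

quotient_type (overloaded) ('a, 'b) germ = "'a::{topological_space,zero} \<Rightarrow> 'b" / germ_rel
  morphisms rep_germ germ_of
  by (rule equivp_germ_rel)

instantiation germ :: ("{topological_space,zero}", real_vector) real_vector
begin

lift_definition zero_germ :: "('a, 'b) germ" is "\<lambda>_. 0" .

lift_definition plus_germ :: "('a, 'b) germ \<Rightarrow> ('a, 'b) germ \<Rightarrow> ('a, 'b) germ"
  is "\<lambda>f g p. f p + g p"
  unfolding germ_rel_def by (auto elim: eventually_elim2)

lift_definition minus_germ :: "('a, 'b) germ \<Rightarrow> ('a, 'b) germ \<Rightarrow> ('a, 'b) germ"
  is "\<lambda>f g p. f p - g p"
  unfolding germ_rel_def by (auto elim: eventually_elim2)

lift_definition uminus_germ :: "('a, 'b) germ \<Rightarrow> ('a, 'b) germ"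
  is "\<lambda>f p. - f p"
  unfolding germ_rel_def by (auto elim: eventually_mono)

lift_definition scaleR_germ :: "real \<Rightarrow> ('a, 'b) germ \<Rightarrow> ('a, 'b) germ"
  is "\<lambda>r f p. r *\<^sub>R f p"
  unfolding germ_rel_def by (auto elim: eventually_mono)

instance
  by standard (transfer; simp add: germ_rel_def algebra_simps)+

end


subsection \<open>Tangency of holomorphic vector fields\<close>

text \<open>
  A vector field \<open>X = f\<^sup>1 \<partial>\<^sub>z\<^sub>1 + f\<^sup>2 \<partial>\<^sub>z\<^sub>2 + g \<partial>\<^sub>w\<close> is represented by the map
  \<open>p \<mapsto> (f\<^sup>1 p, f\<^sup>2 p, g p)\<close>.  The Wirtinger derivative is
  \<open>\<partial>/\<partial>\<zeta>\<^sub>j = (\<partial>/\<partial>x\<^sub>j - \<i> \<partial>/\<partial>y\<^sub>j) / 2\<close> for \<open>\<zeta>\<^sub>j = x\<^sub>j + \<i> y\<^sub>j\<close>.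
\<close>

definition wirtinger :: "(complex ^ 'n \<Rightarrow> real) \<Rightarrow> 'n \<Rightarrow> complex ^ 'n \<Rightarrow> complex" where
  "wirtinger \<rho> j p =
     (complex_of_real (frechet_derivative \<rho> (at p) (axis j 1))
      - \<i> * complex_of_real (frechet_derivative \<rho> (at p) (axis j \<i>))) / 2"

definition vf_apply :: "(complex ^ 'n \<Rightarrow> complex ^ 'n) \<Rightarrow> (complex ^ 'n \<Rightarrow> real) \<Rightarrow> complex ^ 'n \<Rightarrow> complex" where
  "vf_apply X \<rho> p = (\<Sum>j\<in>UNIV. X p $ j * wirtinger \<rho> j p)"

definition hypersurface :: "(complex \<Rightarrow> complex \<Rightarrow> real) \<Rightarrow> (complex ^ 3) set" where
  "hypersurface P = {p. Im (p $ 3) = P (p $ 1) (p $ 2)}"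

definition defining_fun :: "(complex \<Rightarrow> complex \<Rightarrow> real) \<Rightarrow> complex ^ 3 \<Rightarrow> real" where
  "defining_fun P p = Im (p $ 3) - P (p $ 1) (p $ 2)"

definition tangent_near_0 :: "(complex \<Rightarrow> complex \<Rightarrow> real) \<Rightarrow> (complex ^ 3 \<Rightarrow> complex ^ 3) \<Rightarrow> bool" where
  "tangent_near_0 P X \<longleftrightarrow>
     (\<forall>\<^sub>F p in nhds 0. p \<in> hypersurface P \<longrightarrow> vf_apply X (defining_fun P) p = 0)"

text \<open>
  \<open>Re X = (X + cnj X) / 2\<close> as a derivation, so \<open>(Re X) \<rho> = Re (X \<rho>)\<close> for real-valued \<open>\<rho>\<close>.
\<close>

definition Re_tangent_near_0 :: "(complex \<Rightarrow> complex \<Rightarrow> real) \<Rightarrow> (complex ^ 3 \<Rightarrow> complex ^ 3) \<Rightarrow> bool" where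
  "Re_tangent_near_0 P X \<longleftrightarrow>
     (\<forall>\<^sub>F p in nhds 0. p \<in> hypersurface P \<longrightarrow> Re (vf_apply X (defining_fun P) p) = 0)"

definition holomorphically_nondegenerate :: "(complex \<Rightarrow> complex \<Rightarrow> real) \<Rightarrow> bool" where
  "holomorphically_nondegenerate P \<longleftrightarrow>
     \<not> (\<exists>X. holomorphic_near_0 X \<and> tangent_near_0 P X \<and> germ_of X \<noteq> 0)"

definition aut_germs :: "(complex \<Rightarrow> complex \<Rightarrow> real) \<Rightarrow> (complex ^ 3, complex ^ 3) germ set" where
  "aut_germs P = {germ_of X | X. holomorphic_near_0 X \<and> Re_tangent_near_0 P X}"


subsection \<open>Weighted degree: \<open>z\<^sub>1, z\<^sub>2\<close> have weight \<open>1/d\<close> and \<open>w\<close> has weight 1\<close>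

text \<open>For \<open>d > 0\<close> only finitely many monomials have a given weight.\<close>

definition weighted_homogeneous :: "nat \<Rightarrow> real \<Rightarrow> (complex ^ 3 \<Rightarrow> complex) \<Rightarrow> bool" where
  "weighted_homogeneous d \<nu> f \<longleftrightarrow>
     (\<exists>c :: nat \<Rightarrow> nat \<Rightarrow> nat \<Rightarrow> complex. \<forall>p.
        f p = (\<Sum>(a, b, k) \<in> {(a, b, k). (real a + real b) / real d + real k = \<nu>}.
                 c a b k * (p $ 1) ^ a * (p $ 2) ^ b * (p $ 3) ^ k))"

text \<open>The fields \<open>\<partial>\<^sub>z\<^sub>j\<close> and \<open>\<partial>\<^sub>w\<close> have weights \<open>-1/d\<close> and \<open>-1\<close>, hence the shifts.\<close>

definition vf_weighted_homogeneous :: "nat \<Rightarrow> real \<Rightarrow> (complex ^ 3 \<Rightarrow> complex ^ 3) \<Rightarrow> bool" where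
  "vf_weighted_homogeneous d \<mu> X \<longleftrightarrow>
     weighted_homogeneous d (\<mu> + 1 / real d) (\<lambda>p. X p $ 1) \<and>
     weighted_homogeneous d (\<mu> + 1 / real d) (\<lambda>p. X p $ 2) \<and>
     weighted_homogeneous d (\<mu> + 1) (\<lambda>p. X p $ 3)"

definition aut_component ::
    "(complex \<Rightarrow> complex \<Rightarrow> real) \<Rightarrow> nat \<Rightarrow> real \<Rightarrow> (complex ^ 3, complex ^ 3) germ set" where
  "aut_component P d \<mu> = aut_germs P \<inter> {germ_of X | X. vf_weighted_homogeneous d \<mu> X}"


subsection \<open>Real-valued homogeneous polynomials in \<open>z\<close> and its conjugate\<close>

text \<open>
  \<open>c a\<^sub>1 a\<^sub>2 b\<^sub>1 b\<^sub>2\<close> is the coefficient of \<open>z\<^sub>1^a\<^sub>1 z\<^sub>2^a\<^sub>2 (cnj z\<^sub>1)^b\<^sub>1 (cnj z\<^sub>2)^b\<^sub>2\<close>; only its values with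
  \<open>a\<^sub>1 + a\<^sub>2 + b\<^sub>1 + b\<^sub>2 = d\<close> matter.  That the sum is real is part of the equation.
\<close>

definition homogeneous_poly_with_coeffs ::
    "nat \<Rightarrow> (nat \<Rightarrow> nat \<Rightarrow> nat \<Rightarrow> nat \<Rightarrow> complex) \<Rightarrow> (complex \<Rightarrow> complex \<Rightarrow> real) \<Rightarrow> bool" where
  "homogeneous_poly_with_coeffs d c P \<longleftrightarrow>
     (\<forall>z1 z2. complex_of_real (P z1 z2) =
        (\<Sum>(a1, a2, b1, b2) \<in> {(a1, a2, b1, b2). a1 + a2 + b1 + b2 = d}.
           c a1 a2 b1 b2 * z1 ^ a1 * z2 ^ a2 * cnj z1 ^ b1 * cnj z2 ^ b2))"

definition no_pluriharmonic_terms :: "nat \<Rightarrow> (nat \<Rightarrow> nat \<Rightarrow> nat \<Rightarrow> nat \<Rightarrow> complex) \<Rightarrow> bool" where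
  "no_pluriharmonic_terms d c \<longleftrightarrow>
     (\<forall>i j. i + j = d \<longrightarrow> c i j 0 0 = 0 \<and> c 0 0 i j = 0)"


subsection \<open>Local biholomorphic equivalence\<close>

definition biholomorphically_equivalent_at_0 :: "(complex ^ 'n) set \<Rightarrow> (complex ^ 'n) set \<Rightarrow> bool" where
  "biholomorphically_equivalent_at_0 M N \<longleftrightarrow>
     (\<exists>U V \<Phi> \<Psi>. open U \<and> open V \<and> 0 \<in> U \<and> 0 \<in> V \<and>
        homeomorphism U V \<Phi> \<Psi> \<and> holomorphic_map_on \<Phi> U \<and> holomorphic_map_on \<Psi> V \<and>
        \<Phi> 0 = 0 \<and> \<Phi> ` (M \<inter> U) = N \<inter> V)"

end

theory Submission
  imports Defs "HOL-Computational_Algebra.Polynomial"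
begin

text \<open>
  A field of weight \<open>1 - 1/d\<close> is \<open>w a + q(z)\<close> in the \<open>z\<close>-directions and \<open>w G(z) + h(z)\<close> in the
  \<open>w\<close>-direction, with a constant vector \<open>a\<close>.  If \<open>a = 0\<close>, comparing bidegrees shows that the field is tangent
  even as a complex field, against nondegeneracy.  If \<open>a \<noteq> 0\<close>, the part of the tangency equation linear in
  \<open>Re w\<close> says that the derivative of \<open>P\<close> along \<open>a\<close> is \<open>Im G\<close>.  Hence, in linear coordinates \<open>(\<zeta>, z)\<close> in which
  \<open>a\<close> is the \<open>\<zeta>\<close>-direction and after subtracting a pluriharmonic function, \<open>P\<close> becomes a polynomial \<open>Q(y, z)\<close>
  in \<open>y = Im \<zeta>\<close> and \<open>z\<close>, and the rest of the equation reads
  \<open>Q Q\<^sub>y + Im(q\<^sub>1) Q\<^sub>y + 2 Re(q\<^sub>2 Q\<^sub>z) = Im h\<close> with holomorphic \<open>q\<^sub>1, q\<^sub>2, h\<close>.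
  Comparing leading parts in \<open>\<zeta>\<close>, and using that the square of a nonzero real form in \<open>z\<close> contains a
  positive multiple of a power of \<open>|z|\<^sup>2\<close>, one finds first that \<open>Q\<close> is linear in \<open>y\<close> and then that
  \<open>Q = 2 y Re(\<mu> z\<^sup>l) + 2 Re(b z cnj z\<^sup>l)\<close> up to pluriharmonic terms, with \<open>l = d - 1\<close>.  Modulo pluriharmonic
  terms this is \<open>Re((\<mu>' \<zeta> + 2 b z) cnj z\<^sup>l)\<close> with \<open>\<mu>' \<noteq> 0\<close>.
\<close>

section \<open>Polynomial identities on the unit circle\<close>

text \<open>The identities mix holomorphic powers with conjugates and with powers of imaginary
  parts. On the unit circle \<open>cnj z\<close> is \<open>1 / z\<close>, so multiplication by a
  suitable power turns each of them into an identity of polynomials in one complex variable. The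
  circle is used twice: in \<zeta> for fixed \<open>z\<close>, and then in \<open>z\<close> for the
  resulting relations between coefficient functions. The obstacle is that \<open>q\<^sub>1\<close>
  and \<open>q\<^sub>2\<close> may have high degree in \<zeta> and so hide the leading part of
  \<open>Q\<close>. Their coefficients are removed from the top downwards. If \<open>m\<close> is
  the degree of \<open>Q\<close> in \<open>y\<close>, the square of its top form enters exactly when
  the remaining degree of \<open>q\<^sub>2\<close> is \<open>m - 1\<close>, and there no term of
  \<open>q\<^sub>2\<close> can balance it. The exponent \<open>l = d - 1\<close> is a resonance: for
  \<open>Q\<close> linear in \<open>y\<close>, with top coefficient \<mu>, one gets
  \<open>\<beta>\<^sub>0 = - \<mu> / l\<close> and
  \<open>(\<mu> + k \<beta>\<^sub>0) c\<^sub>0\<^sub>k = 0\<close> for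
  \<open>2 \<le> k \<le> d - 2\<close>, where the factor is not zero.\<close>

lemma poly_eq_0_if_zero_on_circle:
  fixes p :: "complex poly"
  assumes "\<And>z. norm z = 1 \<Longrightarrow> z \<noteq> 1 \<Longrightarrow> poly p z = 0"
  shows "p = 0"
proof (rule ccontr)
  assume "p \<noteq> 0"
  then have fin: "finite {z. poly p z = 0}"
    by (rule poly_roots_finite)
  \<comment> \<open>Omitting 1 from the \<open>n\<close>-th roots of unity leaves
    \<open>n - 1\<close> points, one more than \<open>p\<close> has roots.\<close>
  define n where "n = card {z. poly p z = 0} + 2"
  have "n > 0" by (simp add: n_def)
  have "{z::complex. z ^ n = 1} - {1} \<subseteq> {z. poly p z = 0}"
  proof
    fix z :: complex
    assume z: "z \<in> {z. z ^ n = 1} - {1}"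
    then have "norm z ^ n = 1"
      by (metis (mono_tags, lifting) DiffD1 mem_Collect_eq norm_one norm_power)
    then have "norm z = 1"
      using \<open>n > 0\<close> by (metis norm_ge_zero power_eq_1_iff less_numeral_extra(3) zero_le_one power_eq_imp_eq_base power_one)
    with z show "z \<in> {z. poly p z = 0}" using assms by auto
  qed
  then have "card ({z::complex. z ^ n = 1} - {1}) \<le> card {z. poly p z = 0}"
    using fin by (intro card_mono)
  moreover have "card ({z::complex. z ^ n = 1} - {1}) = n - 1"
    using card_roots_unity_eq[OF \<open>n > 0\<close>] by (simp add: card_Diff_singleton)
  ultimately show False by (simp add: n_def)
qed

text \<open>On the circle \<open>z ^ n * cnj (poly p z)\<close> is the polynomial with reversed
  conjugate coefficients. It has degree at most \<open>n\<close>, so above degree \<open>n\<close>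
  it cannot cancel \<open>z ^ n * poly p z\<close>. At degree \<open>n\<close> the constant
  coefficient of \<open>p\<close> meets its own conjugate, and \<open>c0\<close> is what excludes an
  imaginary constant.\<close>

lemma poly_eq_0_if_Re_zero_on_circle:
  fixes p :: "complex poly"
  assumes re: "\<And>z. norm z = 1 \<Longrightarrow> Re (poly p z) = 0" and c0: "coeff p 0 = 0"
  shows "p = 0"
proof -
  define n where "n = degree p"
  define q where "q = (\<Sum>i\<le>n. monom (cnj (coeff p i)) (n - i))"
  have "monom 1 n * p + q = 0"
  proof (rule poly_eq_0_if_zero_on_circle)
    fix z :: complex assume z: "norm z = 1"
    then have zz: "z * cnj z = 1" by (simp add: complex_norm_square[symmetric])
    have "poly q z = (\<Sum>i\<le>n. cnj (coeff p i) * z ^ (n - i))"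
      by (simp add: q_def poly_sum poly_monom)
    also have "\<dots> = (\<Sum>i\<le>n. z ^ n * cnj (coeff p i * z ^ i))"
    proof (rule sum.cong[OF refl])
      fix i assume "i \<in> {..n}"
      then have "z ^ n = z ^ (n - i) * z ^ i" by (simp add: power_add[symmetric])
      then have "z ^ n * cnj z ^ i = z ^ (n - i) * (z * cnj z) ^ i"
        by (simp add: power_mult_distrib)
      with zz show "cnj (coeff p i) * z ^ (n - i) = z ^ n * cnj (coeff p i * z ^ i)"
        by simp
    qed
    also have "\<dots> = z ^ n * cnj (poly p z)"
      by (simp add: poly_altdef n_def sum_distrib_left)
    finally have "poly (monom 1 n * p + q) z = z ^ n * (poly p z + cnj (poly p z))"
      by (simp add: poly_monom algebra_simps)
    then show "poly (monom 1 n * p + q) z = 0"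
      using re[OF z] by (simp add: complex_add_cnj)
  qed
  then have e: "coeff (monom 1 n * p + q) (n + j) = 0" for j by simp
  have q0: "coeff q (n + j) = 0" if "j > 0" for j
    using that by (auto simp: q_def coeff_sum intro!: sum.neutral)
  show ?thesis
  proof (rule poly_eqI)
    fix j show "coeff p j = coeff 0 j"
      using e[of j] q0[of j] c0 by (cases "j = 0") (auto simp: coeff_monom_mult)
  qed
qed

lemma circle_square_root:
  fixes s :: complex
  assumes "norm s = 1"
  obtains t where "norm t = 1" "t ^ 2 = s" "t * cnj t = 1"
proof
  show n: "norm (csqrt s) = 1" using assms by simp
  show "(csqrt s) ^ 2 = s" by simp
  show "csqrt s * cnj (csqrt s) = 1" using n by (simp add: complex_norm_square[symmetric])
qed

text \<open>With \<open>\<zeta> = t\<close> on the unit circle and \<open>s = t\<^sup>2\<close>, multiplication by \<open>t ^ (N + m)\<close> turns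
  \<open>Im t\<close> into \<open>(s - 1) / (2 * \<i>)\<close>, so that the identity becomes polynomial in \<open>s\<close>.\<close>

lemma form_identity_circle:
  fixes S :: real and A B H :: complex
  assumes m: "m \<ge> 1"
    and id: "\<And>t. norm t = 1 \<Longrightarrow> S * Im t ^ (N + m) + Im (A * t ^ (N + 1)) * Im t ^ (m - 1)
        + 2 * Re (B * t ^ N) * Im t ^ m = Im (H * t ^ (N + m))"
  shows "of_real S * ((s - 1) / (2 * \<i>)) ^ (N + m)
      + (A * s ^ (N + 1) - cnj A) / (2 * \<i>) * ((s - 1) / (2 * \<i>)) ^ (m - 1)
      + (B * s ^ N + cnj B) * ((s - 1) / (2 * \<i>)) ^ m
      = (H * s ^ (N + m) - cnj H) / (2 * \<i>)"
proof -
  define k where "k = 1 / (2 * \<i>)"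
  define L where "L = [:- k, k:]"
  define p where "p = smult (of_real S) (L ^ (N + m))
    + smult k ((monom A (N + 1) - [:cnj A:]) * L ^ (m - 1))
    + (monom B N + [:cnj B:]) * L ^ m - smult k (monom H (N + m) - [:cnj H:])"
  have L: "poly L s = (s - 1) / (2 * \<i>)" for s
    by (simp add: L_def k_def field_simps)
  have P: "poly p s = of_real S * ((s - 1) / (2 * \<i>)) ^ (N + m)
      + (A * s ^ (N + 1) - cnj A) / (2 * \<i>) * ((s - 1) / (2 * \<i>)) ^ (m - 1)
      + (B * s ^ N + cnj B) * ((s - 1) / (2 * \<i>)) ^ m
      - (H * s ^ (N + m) - cnj H) / (2 * \<i>)" for s
    unfolding p_def by (simp add: poly_monom L poly_power k_def)
  have "p = 0"
  proof (rule poly_eq_0_if_zero_on_circle)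
    fix s :: complex assume "norm s = 1"
    then obtain t where t: "norm t = 1" "t ^ 2 = s" "t * cnj t = 1"
      by (rule circle_square_root)
    have tp: "t ^ n * cnj t ^ n = 1" for n
      by (metis power_mult_distrib power_one t(3))
    have sp: "s ^ n = t ^ n * t ^ n" for n
      by (simp add: t(2)[symmetric] power_mult[symmetric] power_add[symmetric] mult_2)
    have ImC: "of_real (Im x) = (x - cnj x) / (2 * \<i>)" for x
      by (simp add: complex_eq_iff)
    have ReC: "of_real (2 * Re x) = x + cnj x" for x
      by (simp add: complex_add_cnj)
    have y: "t * of_real (Im t) = (s - 1) / (2 * \<i>)" (is "_ = ?\<sigma>")
      using t by (simp add: ImC power2_eq_square algebra_simps)
    have yp: "of_real (Im t) ^ n * t ^ n = ?\<sigma> ^ n" for n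
      by (metis y power_mult_distrib mult.commute)
    have "of_real (S * Im t ^ (N + m)) * t ^ (N + m) = of_real S * ?\<sigma> ^ (N + m)"
      using yp[of "N + m"] by (simp add: algebra_simps)
    moreover have "of_real (Im (A * t ^ (N + 1)) * Im t ^ (m - 1)) * t ^ (N + m)
        = (A * s ^ (N + 1) - cnj A) / (2 * \<i>) * ?\<sigma> ^ (m - 1)"
    proof -
      have "t ^ (N + m) = t ^ (N + 1) * t ^ (m - 1)"
        using m by (simp flip: power_add power_Suc)
      then have "of_real (Im (A * t ^ (N + 1)) * Im t ^ (m - 1)) * t ^ (N + m)
        = ((A * t ^ (N + 1) - cnj A * cnj t ^ (N + 1)) / (2 * \<i>) * t ^ (N + 1)) * (of_real (Im t) ^ (m - 1) * t ^ (m - 1))"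
        using ImC[of "A * t ^ (N + 1)"] by (simp add: mult_ac)
      also have "(A * t ^ (N + 1) - cnj A * cnj t ^ (N + 1)) / (2 * \<i>) * t ^ (N + 1)
         = (A * (t ^ (N + 1) * t ^ (N + 1)) - cnj A * (t ^ (N + 1) * cnj t ^ (N + 1))) / (2 * \<i>)"
        by (simp add: algebra_simps)
      finally show ?thesis unfolding yp tp sp[symmetric] by simp
    qed
    moreover have "of_real (2 * Re (B * t ^ N) * Im t ^ m) * t ^ (N + m)
        = (B * s ^ N + cnj B) * ?\<sigma> ^ m"
    proof -
      have "of_real (2 * Re (B * t ^ N) * Im t ^ m) * t ^ (N + m)
        = ((B * t ^ N + cnj B * cnj t ^ N) * t ^ N) * (of_real (Im t) ^ m * t ^ m)"
        using ReC[of "B * t ^ N"] by (simp add: power_add mult_ac)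
      also have "(B * t ^ N + cnj B * cnj t ^ N) * t ^ N
         = B * (t ^ N * t ^ N) + cnj B * (t ^ N * cnj t ^ N)"
        by (simp add: algebra_simps)
      finally show ?thesis unfolding yp tp sp[symmetric] by simp
    qed
    moreover have "of_real (Im (H * t ^ (N + m))) * t ^ (N + m) = (H * s ^ (N + m) - cnj H) / (2 * \<i>)"
    proof -
      have "of_real (Im (H * t ^ (N + m))) * t ^ (N + m)
         = (H * (t ^ (N + m) * t ^ (N + m)) - cnj H * (t ^ (N + m) * cnj t ^ (N + m))) / (2 * \<i>)"
        unfolding ImC by (simp add: algebra_simps)
      then show ?thesis unfolding tp sp[symmetric] by simp
    qed
    moreover have "of_real (S * Im t ^ (N + m)) * t ^ (N + m)
        + of_real (Im (A * t ^ (N + 1)) * Im t ^ (m - 1)) * t ^ (N + m)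
        + of_real (2 * Re (B * t ^ N) * Im t ^ m) * t ^ (N + m)
        = of_real (Im (H * t ^ (N + m))) * t ^ (N + m)"
      unfolding id[OF t(1), symmetric] by (simp only: of_real_add distrib_right)
    ultimately show "poly p s = 0" unfolding P by (simp only: diff_self)
  qed
  then show ?thesis using P[of s] by (metis eq_iff_diff_eq_0 poly_0)
qed

text \<open>In the circle identity the terms on the left vanish to order at least 2 at
  \<open>s = 1\<close>, while the \<open>H\<close>-term has derivative
  \<open>(N + m) * H / (2 * \<i>)\<close> there. The one exception is \<open>m = 2\<close>, where
  the \<open>A\<close>-term carries only a single factor \<open>s - 1\<close>; that case is covered
  by \<open>m2\<close>.\<close>

lemma form_identity_H_eq_0:
  fixes S :: real and A B H :: complex
  assumes m: "m \<ge> 2" and m2: "m = 2 \<Longrightarrow> H = 0 \<or> A = 0" and N: "N \<ge> 1"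
    and id: "\<And>t. S * Im t ^ (N + m) + Im (A * t ^ (N + 1)) * Im t ^ (m - 1)
        + 2 * Re (B * t ^ N) * Im t ^ m = Im (H * t ^ (N + m))"
  shows "H = 0"
proof (rule ccontr)
  assume H0: "H \<noteq> 0"
  define F where "F s = of_real S * ((s - 1) / (2 * \<i>)) ^ (N + m)
      + (A * s ^ (N + 1) - cnj A) / (2 * \<i>) * ((s - 1) / (2 * \<i>)) ^ (m - 1)
      + (B * s ^ N + cnj B) * ((s - 1) / (2 * \<i>)) ^ m
      - (H * s ^ (N + m) - cnj H) / (2 * \<i>)" for s
  have F0: "F = (\<lambda>_. 0)"
    unfolding F_def using form_identity_circle[of m S N A B H] m id by (simp add: fun_eq_iff)
  have "Im H = 0" using id[of 1] m N by (simp add: power_0_left)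
  have A: "A / (2 * \<i>) * 0 ^ (m - 2) = cnj A / (2 * \<i>) * 0 ^ (m - 2)"
    using m2 H0 m by (cases "m = 2") (auto simp: power_0_left)
  have "(F has_field_derivative - (of_nat (N + m) * H / (2 * \<i>))) (at 1)"
    unfolding F_def using m N A
    by (auto intro!: derivative_eq_intros simp: power_0_left field_simps)
  moreover have "(F has_field_derivative 0) (at 1)" unfolding F0 by simp
  ultimately have "of_nat (N + m) * H / (2 * \<i>) = 0"
    using DERIV_unique by fastforce
  then have "of_nat (N + m) = (0::complex)" using H0 by (simp del: of_nat_add)
  with N show False by (simp del: of_nat_add)
qed

text \<open>For \<open>m > 1\<close> the \<open>H\<close>-term is already gone, and for
  \<open>m = 1\<close> it merges with the \<open>A\<close>-term. Division by the power
  \<open>m - 1\<close> of \<open>(s - 1) / (2 * \<i>)\<close> leaves \<open>G = 0\<close> off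
  \<open>s = 1\<close>. The derivative of \<open>G\<close> at 0 does not see \<open>A'\<close>,
  because \<open>N + 1 \<ge> 2\<close>, and so links \<open>B\<close> to \<open>S\<close>; for
  \<open>N = 1\<close> the summand \<open>B * s ^ N\<close> contributes as well, hence the separate
  case. The value of \<open>G\<close> at 0 then determines \<open>A'\<close>.\<close>

lemma form_identity:
  fixes S :: real and A B H :: complex
  assumes m: "m \<ge> 1" and N: "N \<ge> 1" and m2: "m = 2 \<Longrightarrow> H = 0 \<or> A = 0"
    and id: "\<And>t. S * Im t ^ (N + m) + Im (A * t ^ (N + 1)) * Im t ^ (m - 1)
        + 2 * Re (B * t ^ N) * Im t ^ m = Im (H * t ^ (N + m))"
  shows "N \<ge> 2 \<Longrightarrow> cnj B = of_nat (N + 1) * (- 1 / (2 * \<i>)) ^ N * of_real S * - 1"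
    and "N = 1 \<Longrightarrow> 2 * Im B = S"
    and "S = 0 \<Longrightarrow> B = 0 \<Longrightarrow> A = (if m = 1 then H else 0)"
proof -
  define A' where "A' = A - (if m = 1 then H else 0)"
  have H0: "H = 0" if "m > 1"
    using form_identity_H_eq_0[of m H A N S B] that m2 N id by simp
  define G where "G s = of_real S * ((s - 1) / (2 * \<i>)) ^ (N + 1)
      + (A' * s ^ (N + 1) - cnj A') / (2 * \<i>)
      + (B * s ^ N + cnj B) * ((s - 1) / (2 * \<i>))" for s
  have G0: "G s = 0" if "s \<noteq> 1" for s
  proof -
    define \<sigma> where "\<sigma> = (s - 1) / (2 * \<i>)"
    have \<sigma>: "\<sigma> \<noteq> 0" using that by (simp add: \<sigma>_def)
    have "N + m = (N + 1) + (m - 1)" "m = 1 + (m - 1)" using m by auto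
    then have p: "\<sigma> ^ (N + m) = \<sigma> ^ (N + 1) * \<sigma> ^ (m - 1)" "\<sigma> ^ m = \<sigma> * \<sigma> ^ (m - 1)"
      by (metis power_add, metis power_add power_one_right)
    have "of_real S * \<sigma> ^ (N + m)
      + (A * s ^ (N + 1) - cnj A) / (2 * \<i>) * \<sigma> ^ (m - 1)
      + (B * s ^ N + cnj B) * \<sigma> ^ m
      = (H * s ^ (N + m) - cnj H) / (2 * \<i>)"
      unfolding \<sigma>_def using form_identity_circle[of m S N A B H s] m id by simp
    then have "G s * \<sigma> ^ (m - 1) = 0"
      unfolding p G_def \<sigma>_def[symmetric] A'_def using H0 m
      by (cases "m = 1") (simp_all add: field_simps)
    then show ?thesis using \<sigma> by simp
  qed
  have dz: "(G has_field_derivative 0) (at 0)"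
  proof (rule has_field_derivative_transform_within_open)
    show "((\<lambda>_. 0::complex) has_field_derivative 0) (at 0)" by simp
    show "open (- {1::complex})" by (intro open_Compl) simp
  qed (use G0 in auto)
  define k where "k = 1 / (2 * \<i>)"
  have Gk: "G = (\<lambda>s. of_real S * (k * (s - 1)) ^ (N + 1)
      + (A' * s ^ (N + 1) - cnj A') * k + (B * s ^ N + cnj B) * (k * (s - 1)))"
    by (simp add: fun_eq_iff G_def k_def)
  have 1: "((\<lambda>s. (k * (s - 1)) ^ (N + 1)) has_field_derivative of_nat (N + 1) * (- k) ^ N * k) (at 0)"
    using DERIV_power[of "\<lambda>s. k * (s - 1)" k 0 UNIV "N + 1"]
    by (force intro!: derivative_eq_intros simp: mult_ac)
  have "(G has_field_derivative
      of_real S * (of_nat (N + 1) * (- k) ^ N * k)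
      + (B * 0 ^ N + cnj B) * k + B * (of_nat N * 0 ^ (N - 1)) * (- k)) (at 0)"
  proof -
    have "((\<lambda>s. (A' * s ^ (N + 1) - cnj A') * k + (B * s ^ N + cnj B) * (k * (s - 1)))
      has_field_derivative
      (B * 0 ^ N + cnj B) * k + B * (of_nat N * 0 ^ (N - 1)) * (- k)) (at 0)"
      using N by (auto intro!: derivative_eq_intros simp: power_0_left)
    from DERIV_add[OF DERIV_cmult[OF 1, of "of_real S"] this] show ?thesis
      unfolding Gk by (simp only: add.assoc)
  qed
  then have dG: "(G has_field_derivative
      of_real S * (of_nat (N + 1) * (- 1 / (2 * \<i>)) ^ N / (2 * \<i>))
      + (B * 0 ^ N + cnj B) / (2 * \<i>) + B * (of_nat N * 0 ^ (N - 1)) * (- 1 / (2 * \<i>))) (at 0)"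
    by (simp add: k_def mult_ac)
  have e: "of_real S * (of_nat (N + 1) * (- 1 / (2 * \<i>)) ^ N / (2 * \<i>))
      + (B * 0 ^ N + cnj B) / (2 * \<i>) + B * (of_nat N * 0 ^ (N - 1)) * (- 1 / (2 * \<i>)) = 0"
    using DERIV_unique[OF dG dz] .
  { assume "N \<ge> 2"
    then show "cnj B = of_nat (N + 1) * (- 1 / (2 * \<i>)) ^ N * of_real S * - 1"
      using e by (simp add: power_0_left field_simps eq_neg_iff_add_eq_0 add.commute) }
  { assume "N = 1"
    then show "2 * Im B = S"
      using e by (simp add: complex_eq_iff field_simps) }
  { assume "S = 0" "B = 0"
    then have "cnj A' = 0" using G0[of 0] by (simp add: G_def)
    then show "A = (if m = 1 then H else 0)" by (simp add: A'_def) }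
qed

section \<open>Leading coefficients of polynomial identities\<close>

lemma coeff_mult_top:
  assumes "\<And>i. i > a \<Longrightarrow> coeff p i = 0" "\<And>i. i > b \<Longrightarrow> coeff q i = 0"
  shows "coeff (p * q) (a + b) = coeff p a * coeff q b"
proof -
  have "coeff (p * q) (a + b) = (\<Sum>i\<in>{a}. coeff p i * coeff q (a + b - i))"
    unfolding coeff_mult
  proof (rule sum.mono_neutral_right)
    show "\<forall>i\<in>{..a + b} - {a}. coeff p i * coeff q (a + b - i) = 0"
    proof
      fix i assume "i \<in> {..a + b} - {a}"
      then have "i > a \<or> a + b - i > b" by auto
      then show "coeff p i * coeff q (a + b - i) = 0" using assms by auto
    qed
  qed auto
  then show ?thesis by simp
qed

definition seq_poly :: "(nat \<Rightarrow> 'a::comm_ring_1) \<Rightarrow> nat \<Rightarrow> 'a poly" where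
  "seq_poly f n = (\<Sum>k\<le>n. monom (f k) k)"

lemma coeff_seq_poly: "coeff (seq_poly f n) k = (if k \<le> n then f k else 0)"
  by (simp add: seq_poly_def coeff_sum)

lemma poly_seq_poly: "poly (seq_poly f n) x = (\<Sum>k\<le>n. f k * x ^ k)"
  by (simp add: seq_poly_def poly_sum poly_monom)

text \<open>The indices \<open>i\<close>, \<open>j\<close>, \<open>i'\<close>, \<open>j'\<close>
  bound the degrees of the factors, so only the products of top coefficients reach
  \<open>t ^ (i + j)\<close>. Since \<open>t\<close> is real, the real part of the complex product
  splits into two products of real polynomials.\<close>

lemma top_coefficient:
  fixes u v a e :: "nat \<Rightarrow> real" and b w :: "nat \<Rightarrow> complex"
  assumes id: "\<And>t::real. (\<Sum>k\<le>d. u k * t ^ k) * (\<Sum>k\<le>d. v k * t ^ k)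
      + (\<Sum>j\<le>d. a j * t ^ j) * (\<Sum>k\<le>d. v k * t ^ k)
      + 2 * Re ((\<Sum>j\<le>d. b j * of_real t ^ j) * (\<Sum>k\<le>d. w k * of_real t ^ k))
      = (\<Sum>j\<le>D. e j * t ^ j)"
    and supp: "\<And>k. k > d \<Longrightarrow> u k = 0" "\<And>k. k > d \<Longrightarrow> v k = 0" "\<And>k. k > d \<Longrightarrow> a k = 0"
      "\<And>k. k > d \<Longrightarrow> b k = 0" "\<And>k. k > d \<Longrightarrow> w k = 0" "\<And>k. k > D \<Longrightarrow> e k = 0"
    and top: "\<And>k. k > i \<Longrightarrow> u k = 0" "\<And>k. k > i \<Longrightarrow> a k = 0" "\<And>k. k > j \<Longrightarrow> v k = 0"
      "\<And>k. k > i' \<Longrightarrow> b k = 0" "\<And>k. k > j' \<Longrightarrow> w k = 0"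
    and n: "i + j = i' + j'"
  shows "(u i + a i) * v j + 2 * Re (b i' * w j') = e (i + j)"
proof -
  define p where "p = (seq_poly u d + seq_poly a d) * seq_poly v d
    + smult 2 (seq_poly (\<lambda>k. Re (b k)) d * seq_poly (\<lambda>k. Re (w k)) d
             - seq_poly (\<lambda>k. Im (b k)) d * seq_poly (\<lambda>k. Im (w k)) d) - seq_poly e D"
  have "poly p t = 0" for t
    using id[of t]
    by (simp add: p_def poly_seq_poly algebra_simps flip: of_real_power)
  then have "p = 0" using poly_all_0_iff_0 by blast
  moreover have "coeff ((seq_poly u d + seq_poly a d) * seq_poly v d) (i + j)
      = coeff (seq_poly u d + seq_poly a d) i * coeff (seq_poly v d) j"
    by (rule coeff_mult_top) (auto simp: coeff_seq_poly top)
  moreover have "coeff (seq_poly (\<lambda>k. Re (b k)) d * seq_poly (\<lambda>k. Re (w k)) d) (i' + j')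
      = coeff (seq_poly (\<lambda>k. Re (b k)) d) i' * coeff (seq_poly (\<lambda>k. Re (w k)) d) j'"
    by (rule coeff_mult_top) (auto simp: coeff_seq_poly top)
  moreover have "coeff (seq_poly (\<lambda>k. Im (b k)) d * seq_poly (\<lambda>k. Im (w k)) d) (i' + j')
      = coeff (seq_poly (\<lambda>k. Im (b k)) d) i' * coeff (seq_poly (\<lambda>k. Im (w k)) d) j'"
    by (rule coeff_mult_top) (auto simp: coeff_seq_poly top)
  moreover have c: "coeff (seq_poly f m) k = f k" if "\<And>k. k > m \<Longrightarrow> f k = 0" for f :: "nat \<Rightarrow> real" and k m
    using that by (auto simp: coeff_seq_poly)
  moreover have "coeff p (i + j) = coeff ((seq_poly u d + seq_poly a d) * seq_poly v d) (i + j)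
      + 2 * (coeff (seq_poly (\<lambda>k. Re (b k)) d * seq_poly (\<lambda>k. Re (w k)) d) (i' + j')
           - coeff (seq_poly (\<lambda>k. Im (b k)) d * seq_poly (\<lambda>k. Im (w k)) d) (i' + j'))
      - coeff (seq_poly e D) (i + j)"
    unfolding p_def n by simp
  ultimately show ?thesis
    using supp by (simp add: c)
qed

section \<open>Forms in one complex variable and its conjugate\<close>

definition zform :: "(nat \<Rightarrow> complex) \<Rightarrow> nat \<Rightarrow> complex \<Rightarrow> complex" where
  "zform a n z = (\<Sum>j\<le>n. a j * z ^ j * cnj z ^ (n - j))"

text \<open>The Wirtinger derivative of \<open>zform a n\<close> in \<open>z\<close>. At
  \<open>j = 0\<close> the truncated exponent does no harm, as the factor \<open>of_nat j\<close>
  vanishes.\<close>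

definition zform_deriv :: "(nat \<Rightarrow> complex) \<Rightarrow> nat \<Rightarrow> complex \<Rightarrow> complex" where
  "zform_deriv a n z = (\<Sum>j\<le>n. of_nat j * a j * z ^ (j - 1) * cnj z ^ (n - j))"

lemma circle_pow:
  fixes z :: complex
  assumes "norm z = 1" "j \<le> n"
  shows "z ^ n * cnj z ^ (n - j) = z ^ j"
proof -
  have zz: "z * cnj z = 1" using assms by (simp add: complex_norm_square[symmetric])
  have "z ^ n = z ^ j * z ^ (n - j)" using assms by (simp flip: power_add)
  then have "z ^ n * cnj z ^ (n - j) = z ^ j * (z * cnj z) ^ (n - j)" by (simp add: power_mult_distrib)
  with zz show ?thesis by simp
qed

text \<open>On the circle the \<open>j\<close>-th monomial has frequency \<open>2 * j - n\<close>.
  Multiplication by \<open>z ^ n\<close> makes all frequencies even and nonnegative, so a form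
  becomes the polynomial in \<open>s = z\<^sup>2\<close> with the same coefficients.\<close>

lemma zform_circle:
  assumes "norm z = 1"
  shows "z ^ n * zform a n z = poly (seq_poly a n) (z\<^sup>2)"
proof -
  have "z ^ n * zform a n z = (\<Sum>j\<le>n. a j * z ^ j * (z ^ n * cnj z ^ (n - j)))"
    by (simp add: zform_def sum_distrib_left mult_ac)
  also have "\<dots> = (\<Sum>j\<le>n. a j * (z\<^sup>2) ^ j)"
    by (intro sum.cong refl) (simp add: circle_pow[OF assms] power2_eq_square power_mult_distrib)
  finally show ?thesis by (simp add: poly_seq_poly)
qed

lemma pderiv_seq_poly:
  fixes a :: "nat \<Rightarrow> complex"
  shows "pderiv (seq_poly a n) = (\<Sum>j\<le>n. monom (of_nat j * a j) (j - 1))"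
  unfolding seq_poly_def by (induction n) (simp_all add: pderiv_add pderiv_monom)

lemma pderiv_seq_poly_mult:
  fixes a :: "nat \<Rightarrow> complex"
  shows "s * poly (pderiv (seq_poly a n)) s = (\<Sum>j\<le>n. of_nat j * a j * s ^ j)"
proof -
  have "s * (of_nat j * a j * s ^ (j - 1)) = of_nat j * a j * s ^ j" for j
    by (cases j) (auto simp: algebra_simps)
  then show ?thesis
    by (simp only: pderiv_seq_poly poly_sum poly_monom sum_distrib_left)
qed

lemma zform_deriv_circle:
  assumes "norm z = 1"
  shows "z ^ (n + 1) * zform_deriv a n z = z\<^sup>2 * poly (pderiv (seq_poly a n)) (z\<^sup>2)"
proof -
  have "z ^ (n + 1) * zform_deriv a n z
     = (\<Sum>j\<le>n. of_nat j * a j * (z ^ (j - 1) * z) * (z ^ n * cnj z ^ (n - j)))"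
    by (simp add: zform_deriv_def sum_distrib_left mult_ac)
  also have "\<dots> = (\<Sum>j\<le>n. of_nat j * a j * (z\<^sup>2) ^ j)"
  proof (intro sum.cong refl)
    fix j assume "j \<in> {..n}"
    then show "of_nat j * a j * (z ^ (j - 1) * z) * (z ^ n * cnj z ^ (n - j)) = of_nat j * a j * (z\<^sup>2) ^ j"
      using circle_pow[OF assms, of j n]
      by (cases j) (auto simp: power2_eq_square power_mult_distrib)
  qed
  finally show ?thesis by (simp add: pderiv_seq_poly_mult)
qed

text \<open>Conjugation on the circle reverses the order of the coefficients. The entry at index
  \<open>n\<close> acquires the factor \<open>n - n = 0\<close>, so conjugated derivatives never
  contribute to the balanced coefficient.\<close>

lemma cnj_zform_deriv_circle:
  assumes "norm s = 1"
  shows "s ^ n * cnj (s * poly (pderiv (seq_poly a n)) s)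
    = poly (seq_poly (\<lambda>i. of_nat (n - i) * cnj (a (n - i))) n) s"
proof -
  have "s ^ n * cnj (s * poly (pderiv (seq_poly a n)) s)
    = (\<Sum>j\<le>n. of_nat j * cnj (a j) * (s ^ n * cnj s ^ j))"
    unfolding pderiv_seq_poly_mult by (simp add: sum_distrib_left mult_ac)
  also have "\<dots> = (\<Sum>j\<le>n. of_nat j * cnj (a j) * s ^ (n - j))"
    using circle_pow[OF assms, of "n - j" n for j] by (intro sum.cong refl) (metis atMost_iff diff_diff_cancel diff_le_self)
  also have "\<dots> = (\<Sum>i\<le>n. of_nat (n - i) * cnj (a (n - i)) * s ^ i)"
    by (rule sum.reindex_bij_witness[of _ "\<lambda>i. n - i" "\<lambda>i. n - i"]) auto
  finally show ?thesis by (simp add: poly_seq_poly)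
qed

lemma zform_real:
  assumes "\<And>j. j \<le> n \<Longrightarrow> a (n - j) = cnj (a j)"
  shows "of_real (Re (zform a n z)) = zform a n z"
proof -
  have "cnj (zform a n z) = (\<Sum>j\<le>n. cnj (a j) * cnj z ^ j * z ^ (n - j))"
    by (simp add: zform_def)
  also have "\<dots> = (\<Sum>j\<le>n. cnj (a (n - j)) * cnj z ^ (n - j) * z ^ j)"
    by (rule sum.reindex_bij_witness[of _ "\<lambda>i. n - i" "\<lambda>i. n - i"]) auto
  also have "\<dots> = zform a n z"
    unfolding zform_def using assms by (intro sum.cong refl) (simp add: mult_ac)
  finally have "Im (zform a n z) = 0"
    by (metis cnj.simps(2) equal_neg_zero)
  then show ?thesis by (simp add: complex_eq_iff)
qed

text \<open>By the reality condition the convolution at index \<open>n\<close> pairs each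
  coefficient with its own conjugate. This index belongs to the balanced monomial
  \<open>(z * cnj z) ^ n\<close> of the square.\<close>

lemma coeff_square_middle:
  assumes sym: "\<And>j. j \<le> n \<Longrightarrow> a (n - j) = cnj (a j)"
  shows "coeff (seq_poly a n * seq_poly a n) n = of_real (\<Sum>j\<le>n. (norm (a j))\<^sup>2)"
proof -
  have "coeff (seq_poly a n * seq_poly a n) n = (\<Sum>j\<le>n. a j * a (n - j))"
    by (simp add: coeff_mult coeff_seq_poly)
  also have "\<dots> = (\<Sum>j\<le>n. of_real ((norm (a j))\<^sup>2))"
    using sym by (intro sum.cong refl) (simp only: complex_norm_square atMost_iff)
  finally show ?thesis by simp
qed

lemma coeff_square_middle_nonzero:
  assumes sym: "\<And>j. j \<le> n \<Longrightarrow> a (n - j) = cnj (a j)" and nz: "j \<le> n" "a j \<noteq> 0"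
  shows "coeff (seq_poly a n * seq_poly a n) n \<noteq> 0"
proof -
  have "(\<Sum>j\<le>n. (norm (a j))\<^sup>2) > 0"
    by (rule sum_pos2[of _ j]) (use nz in auto)
  then show ?thesis using coeff_square_middle[of n a, OF sym] by (simp del: of_real_sum)
qed

text \<open>The form \<open>z\<^bsup>n+1\<^esup> a\<^sub>z\<close> contains no multiple of \<open>(z * cnj z)\<^sup>n\<close>, whereas the square of a nonzero real form does.\<close>

lemma zform_square_not_balanced:
  assumes sym: "\<And>j. j \<le> n \<Longrightarrow> a (n - j) = cnj (a j)" and nz: "j \<le> n" "a j \<noteq> 0"
    and eq: "\<And>z. norm z = 1 \<Longrightarrow>
      (zform a n z)\<^sup>2 = x * (z ^ (n + 1) * zform_deriv a n z) + y * cnj (z ^ (n + 1) * zform_deriv a n z)"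
  shows False
proof -
  define p where "p = seq_poly a n"
  define r where "r = seq_poly (\<lambda>i. of_nat (n - i) * cnj (a (n - i))) n"
  define w where "w = p * p - monom x (n + 1) * pderiv p - smult y r"
  have "w = 0"
  proof (rule poly_eq_0_if_zero_on_circle)
    fix s :: complex assume s: "norm s = 1"
    then obtain z where z: "norm z = 1" "z ^ 2 = s" by (rule circle_square_root)
    have sn: "s ^ n = z ^ n * z ^ n" using z by (simp flip: power_mult_distrib add: power2_eq_square)
    have "(poly p s)\<^sup>2 = s ^ n * (zform a n z)\<^sup>2"
      using zform_circle[OF z(1), of n a] z by (simp add: p_def sn power2_eq_square mult_ac)
    also have "\<dots> = s ^ n * (x * (s * poly (pderiv p) s) + y * cnj (s * poly (pderiv p) s))"
      unfolding eq[OF z(1)] zform_deriv_circle[OF z(1)] z(2) p_def ..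
    also have "\<dots> = x * s ^ (n + 1) * poly (pderiv p) s + y * poly r s"
      unfolding r_def p_def cnj_zform_deriv_circle[OF s, symmetric] by (simp add: algebra_simps)
    finally show "poly w s = 0"
      by (simp add: w_def poly_monom power2_eq_square)
  qed
  then have "coeff w n = 0" by simp
  \<comment> \<open>The shift by \<open>n + 1\<close> moves all of \<open>pderiv p\<close> beyond
    index \<open>n\<close>, and entry \<open>n\<close> of \<open>r\<close> contains the factor
    \<open>n - n\<close>.\<close>
  moreover have "coeff w n = coeff (p * p) n"
    by (simp add: w_def coeff_monom_mult r_def coeff_seq_poly)
  ultimately show False using coeff_square_middle_nonzero[OF sym nz] by (simp add: p_def)
qed

section \<open>Symmetries of tubular models\<close>

lemma Re_of_real_mult: "Re (of_real r * w) = r * Re w" and Im_of_real_mult: "Im (of_real r * w) = r * Im w"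
  by simp_all

text \<open>\<open>c k j\<close> is the coefficient of \<open>y\<^sup>k z^j (cnj z)^(d - k - j)\<close> in \<open>Q(y, z)\<close>, and \<open>\<alpha>, \<beta>, \<eta>\<close> are the
  coefficients of \<open>q\<^sub>1, q\<^sub>2, h\<close>.\<close>

locale tube_symmetry =
  fixes d :: nat and c :: "nat \<Rightarrow> nat \<Rightarrow> complex" and \<alpha> \<beta> \<eta> :: "nat \<Rightarrow> complex"
  assumes d: "d \<ge> 3"
    and c_supp: "\<And>k j. k + j > d \<Longrightarrow> c k j = 0"
    and c_sym: "\<And>k j. k + j \<le> d \<Longrightarrow> c k (d - k - j) = cnj (c k j)"
    and \<alpha>_supp: "\<And>j. j > d \<Longrightarrow> \<alpha> j = 0"
    and \<beta>_supp: "\<And>j. j > d \<Longrightarrow> \<beta> j = 0"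
    and \<eta>_supp: "\<And>j. j > 2 * d - 1 \<Longrightarrow> \<eta> j = 0"
    and symmetry: "\<And>\<zeta> z.
      (\<Sum>k\<le>d. Im \<zeta> ^ k * Re (zform (c k) (d - k) z))
        * (\<Sum>k\<le>d. real (Suc k) * Im \<zeta> ^ k * Re (zform (c (Suc k)) (d - Suc k) z))
      + Im (\<Sum>j\<le>d. \<alpha> j * \<zeta> ^ j * z ^ (d - j))
        * (\<Sum>k\<le>d. real (Suc k) * Im \<zeta> ^ k * Re (zform (c (Suc k)) (d - Suc k) z))
      + 2 * Re ((\<Sum>j\<le>d. \<beta> j * \<zeta> ^ j * z ^ (d - j))
        * (\<Sum>k\<le>d. of_real (Im \<zeta> ^ k) * zform_deriv (c k) (d - k) z))
      = Im (\<Sum>j\<le>2 * d - 1. \<eta> j * \<zeta> ^ j * z ^ (2 * d - 1 - j))"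
begin

definition Q :: "nat \<Rightarrow> complex \<Rightarrow> real" where "Q k z = Re (zform (c k) (d - k) z)"
definition Qz :: "nat \<Rightarrow> complex \<Rightarrow> complex" where "Qz k z = zform_deriv (c k) (d - k) z"

lemma c_sym': "k \<le> d \<Longrightarrow> j \<le> d - k \<Longrightarrow> c k (d - k - j) = cnj (c k j)"
  using c_sym[of k j] by simp

lemma of_real_Q: "k \<le> d \<Longrightarrow> of_real (Q k z) = zform (c k) (d - k) z"
  unfolding Q_def by (rule zform_real) (rule c_sym')

lemma Q_eq_0: "(\<And>j. c k j = 0) \<Longrightarrow> Q k z = 0"
  by (simp add: Q_def zform_def)

lemma Qz_eq_0: "(\<And>j. c k j = 0) \<Longrightarrow> Qz k z = 0"
  by (simp add: Qz_def zform_deriv_def)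

lemma Q_beyond: "k > d \<Longrightarrow> Q k z = 0" and Qz_beyond: "k > d \<Longrightarrow> Qz k z = 0"
  by (intro Q_eq_0 Qz_eq_0 c_supp; simp)+

lemma Q_circle: "k \<le> d \<Longrightarrow> norm z = 1 \<Longrightarrow> z ^ (d - k) * of_real (Q k z) = poly (seq_poly (c k) (d - k)) (z\<^sup>2)"
  by (simp add: of_real_Q zform_circle)

lemma Qz_circle: "norm z = 1 \<Longrightarrow>
    z ^ (d - k + 1) * Qz k z = z\<^sup>2 * poly (pderiv (seq_poly (c k) (d - k))) (z\<^sup>2)"
  by (simp add: Qz_def flip: zform_deriv_circle)

text \<open>Replacing \<zeta> by \<open>t * \<zeta>\<close> with real \<open>t\<close> multiplies
  \<open>Im \<zeta>\<close> by \<open>t\<close> as well, so powers of \<open>y\<close> and of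
  \<zeta> have a common degree in \<open>t\<close>, and the coefficients of
  \<open>t ^ (i + j)\<close> can be compared. The bound on \<open>Q\<close> by \<open>Suc j\<close>
  reflects that the derivative in \<open>y\<close> lowers the degree by one.\<close>

lemma leading_part:
  assumes n: "i + j = i' + r"
    and i: "\<And>k z. k > i \<Longrightarrow> Q k z = 0" "\<And>k. k > i \<Longrightarrow> \<alpha> k = 0"
    and j: "\<And>k z. k > Suc j \<Longrightarrow> Q k z = 0"
    and i': "\<And>k. k > i' \<Longrightarrow> \<beta> k = 0" and r: "\<And>k z. k > r \<Longrightarrow> Qz k z = 0"
  shows "(Im \<zeta> ^ i * Q i z + Im (\<alpha> i * \<zeta> ^ i * z ^ (d - i))) * (real (Suc j) * Im \<zeta> ^ j * Q (Suc j) z)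
    + 2 * Re (\<beta> i' * \<zeta> ^ i' * z ^ (d - i') * (of_real (Im \<zeta> ^ r) * Qz r z))
    = Im (\<eta> (i + j) * \<zeta> ^ (i + j) * z ^ (2 * d - 1 - (i + j)))"
proof (rule top_coefficient[where d = d and D = "2 * d - 1"
      and u = "\<lambda>k. Im \<zeta> ^ k * Q k z" and a = "\<lambda>j. Im (\<alpha> j * \<zeta> ^ j * z ^ (d - j))"
      and v = "\<lambda>k. real (Suc k) * Im \<zeta> ^ k * Q (Suc k) z"
      and b = "\<lambda>j. \<beta> j * \<zeta> ^ j * z ^ (d - j)" and w = "\<lambda>k. of_real (Im \<zeta> ^ k) * Qz k z"
      and e = "\<lambda>j. Im (\<eta> j * \<zeta> ^ j * z ^ (2 * d - 1 - j))"])
  fix t :: real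
  have im: "Im (\<Sum>j\<le>n. f j * (of_real t * \<zeta>) ^ j * z ^ (n - j)) = (\<Sum>j\<le>n. Im (f j * \<zeta> ^ j * z ^ (n - j)) * t ^ j)"
    for f :: "nat \<Rightarrow> complex" and n
  proof -
    have "Im (f j * (of_real t * \<zeta>) ^ j * z ^ (n - j)) = Im (of_real (t ^ j) * (f j * \<zeta> ^ j * z ^ (n - j)))" for j
      by (simp only: power_mult_distrib of_real_power mult_ac)
    then show ?thesis by (simp only: Im_sum Im_of_real_mult mult.commute)
  qed
  have q: "(\<Sum>k\<le>d. f k * Im (of_real t * \<zeta>) ^ k * g k) = (\<Sum>k\<le>d. f k * Im \<zeta> ^ k * g k * t ^ k)" for f g :: "nat \<Rightarrow> real"
    by (simp add: power_mult_distrib mult_ac)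
  have q1: "(\<Sum>k\<le>d. Im (of_real t * \<zeta>) ^ k * g k) = (\<Sum>k\<le>d. Im \<zeta> ^ k * g k * t ^ k)" for g :: "nat \<Rightarrow> real"
    by (simp add: power_mult_distrib mult_ac)
  have b: "(\<Sum>j\<le>d. \<beta> j * (of_real t * \<zeta>) ^ j * z ^ (d - j)) = (\<Sum>j\<le>d. \<beta> j * \<zeta> ^ j * z ^ (d - j) * of_real t ^ j)"
    by (simp add: power_mult_distrib mult_ac)
  have w: "(\<Sum>k\<le>d. of_real (Im (of_real t * \<zeta>) ^ k) * Qz k z) = (\<Sum>k\<le>d. of_real (Im \<zeta> ^ k) * Qz k z * of_real t ^ k)"
    by (simp add: power_mult_distrib mult_ac)
  show "(\<Sum>k\<le>d. Im \<zeta> ^ k * Q k z * t ^ k) * (\<Sum>k\<le>d. real (Suc k) * Im \<zeta> ^ k * Q (Suc k) z * t ^ k)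
    + (\<Sum>j\<le>d. Im (\<alpha> j * \<zeta> ^ j * z ^ (d - j)) * t ^ j) * (\<Sum>k\<le>d. real (Suc k) * Im \<zeta> ^ k * Q (Suc k) z * t ^ k)
    + 2 * Re ((\<Sum>j\<le>d. \<beta> j * \<zeta> ^ j * z ^ (d - j) * of_real t ^ j)
       * (\<Sum>k\<le>d. of_real (Im \<zeta> ^ k) * Qz k z * of_real t ^ k))
    = (\<Sum>j\<le>2 * d - 1. Im (\<eta> j * \<zeta> ^ j * z ^ (2 * d - 1 - j)) * t ^ j)"
    using symmetry[of "of_real t * \<zeta>" z, folded Q_def Qz_def]
    unfolding im b w q q1 .
qed (use n i j i' r in \<open>auto simp: Q_beyond Qz_beyond \<alpha>_supp \<beta>_supp \<eta>_supp\<close>)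

text \<open>A form without derivative in \<open>z\<close> is a multiple of a power of
  \<open>cnj z\<close>. By reality it is then also a multiple of a power of \<open>z\<close>, which
  is impossible for a nonzero form of positive degree \<open>d - k\<close>.\<close>

lemma pderiv_seq_poly_nonzero:
  assumes "k < d" "c k j \<noteq> 0"
  shows "pderiv (seq_poly (c k) (d - k)) \<noteq> 0"
proof
  assume "pderiv (seq_poly (c k) (d - k)) = 0"
  then have "degree (seq_poly (c k) (d - k)) = 0" by (simp add: pderiv_eq_0_iff)
  then have *: "coeff (seq_poly (c k) (d - k)) i = 0" if "i > 0" for i
    using that by (simp add: coeff_eq_0)
  have "c k i = 0" if "i > 0" for i
    using *[OF that] c_supp[of k i] by (cases "i \<le> d - k") (auto simp: coeff_seq_poly split: if_splits)
  moreover from this have "c k 0 = 0"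
    using c_sym[of k "d - k"] assms(1) by simp
  ultimately show False using assms(2) by (cases "j = 0") auto
qed

text \<open>If \<open>Q\<close> had degree \<open>d\<close> in \<open>y\<close>, its top coefficient
  would be a real constant \<open>C\<close>. At \<open>z = 1\<close> the leading part then has the
  shape of \<open>form_identity\<close> with \<open>S = d * C\<^sup>2\<close> and
  \<open>B = 0\<close>, and the relation between \<open>S\<close> and \<open>B\<close> forces
  \<open>C = 0\<close>.\<close>

lemma degree_lt:
  assumes "c m j \<noteq> 0" and top: "\<And>k j. k > m \<Longrightarrow> c k j = 0"
  shows "m < d"
proof (rule ccontr)
  assume "\<not> m < d"
  moreover have "m + j \<le> d" using c_supp[of m j] assms(1) by force
  ultimately have m: "m = d" "j = 0" by auto
  define C where "C = Q d 1"
  have Qd: "Q d z = C" for z unfolding C_def by (simp add: Q_def zform_def)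
  have "of_real C = c d 0" unfolding C_def by (subst of_real_Q) (simp_all add: zform_def)
  then have C0: "C \<noteq> 0" using assms(1) m by auto
  have Qzd: "Qz d z = 0" for z by (simp add: Qz_def zform_deriv_def)
  have lp: "(Im \<zeta> ^ d * Q d 1 + Im (\<alpha> d * \<zeta> ^ d * 1 ^ (d - d))) * (real (Suc (d - 1)) * Im \<zeta> ^ (d - 1) * Q (Suc (d - 1)) 1)
    + 2 * Re (\<beta> d * \<zeta> ^ d * 1 ^ (d - d) * (of_real (Im \<zeta> ^ (d - 1)) * Qz (d - 1) 1))
    = Im (\<eta> (d + (d - 1)) * \<zeta> ^ (d + (d - 1)) * 1 ^ (2 * d - 1 - (d + (d - 1))))" for \<zeta>
  proof (rule leading_part)
    show "Qz k z = 0" if "k > d - 1" for k z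
      using that Qzd[of z] Qz_beyond[of k z] by (cases "k = d") auto
  qed (auto simp: Q_beyond \<alpha>_supp \<beta>_supp)
  \<comment> \<open>As \<open>Qz d\<close> vanishes, the \<beta>-term carries the same power
    \<open>Im t ^ (d - 1)\<close> as the \<alpha>-term, and
    \<open>2 * Re w = Im (2 * \<i> * w)\<close> lets the two be merged.\<close>
  define A where "A = of_real (real d * C) * \<alpha> d + 2 * \<i> * \<beta> d * Qz (d - 1) 1"
  have "(real d * C\<^sup>2) * Im t ^ (d - 1 + d) + Im (A * t ^ (d - 1 + 1)) * Im t ^ (d - 1)
      + 2 * Re (0 * t ^ (d - 1)) * Im t ^ d = Im (\<eta> (2 * d - 1) * t ^ (d - 1 + d))" for t
  proof -
    have n: "d + (d - 1) = 2 * d - 1" "d - 1 + d = 2 * d - 1" "Suc (d - 1) = d" "d - 1 + 1 = d" using d by auto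
    have A: "Im (A * t ^ d) = real d * C * Im (\<alpha> d * t ^ d) + 2 * Re (\<beta> d * t ^ d * Qz (d - 1) 1)"
      by (simp add: A_def algebra_simps)
    have Y: "Im t ^ (2 * d - 1) = Im t ^ d * Im t ^ (d - 1)"
      using d by (simp flip: power_add add: mult_2)
    have B: "\<beta> d * t ^ d * (of_real (Im t ^ (d - 1)) * Qz (d - 1) 1)
        = of_real (Im t ^ (d - 1)) * (\<beta> d * t ^ d * Qz (d - 1) 1)" by (simp only: power_one mult_1_right mult_1_left mult_ac)
    show ?thesis using lp[of t]
      unfolding power_one mult_1_right unfolding B Re_of_real_mult n Qd A Y
      by (simp only: power2_eq_square algebra_simps mult_zero_left zero_complex.sel mult_zero_right add_0_right)
  qed
  from form_identity(1)[of d "d - 1" "\<eta> (2 * d - 1)" A "real d * C\<^sup>2" 0, OF _ _ _ this]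
  have "real d * C\<^sup>2 = 0" using d by auto
  then show False using C0 d by simp
qed


text \<open>The bounds \<open>m\<close> for \<open>Q\<close>, \<open>N\<close> for
  \<open>q\<^sub>2\<close> and \<open>N + 1\<close> for \<open>q\<^sub>1\<close> are matched so that
  all products reach degree \<open>N + m\<close> in \<zeta>. For fixed \<open>z\<close> this is the
  identity treated by \<open>form_identity\<close>. As \<open>N + 1 \<ge> m\<close>, the factor
  \<open>Q (N + 1)\<close> is the top coefficient if \<open>N + 1 = m\<close> and zero
  otherwise.\<close>

lemma leading_form:
  assumes top: "\<And>k j. k > m \<Longrightarrow> c k j = 0" and m: "m \<ge> 1" and N: "N + 1 \<ge> m"
    and \<beta>: "\<And>j. j > N \<Longrightarrow> \<beta> j = 0" and \<alpha>: "\<And>j. j > N + 1 \<Longrightarrow> \<alpha> j = 0"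
  shows "(real m * Q (N + 1) z * Q m z) * Im \<zeta> ^ (N + m)
      + Im ((of_real (real m * Q m z) * \<alpha> (N + 1) * z ^ (d - (N + 1))) * \<zeta> ^ (N + 1)) * Im \<zeta> ^ (m - 1)
      + 2 * Re ((\<beta> N * z ^ (d - N) * Qz m z) * \<zeta> ^ N) * Im \<zeta> ^ m
      = Im ((\<eta> (N + m) * z ^ (2 * d - 1 - (N + m))) * \<zeta> ^ (N + m))"
proof -
  have sm: "Suc (m - 1) = m" and nm: "N + 1 + (m - 1) = N + m" using m by auto
  have L: "(Im \<zeta> ^ (N + 1) * Q (N + 1) z + Im (\<alpha> (N + 1) * \<zeta> ^ (N + 1) * z ^ (d - (N + 1))))
      * (real (Suc (m - 1)) * Im \<zeta> ^ (m - 1) * Q (Suc (m - 1)) z)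
    + 2 * Re (\<beta> N * \<zeta> ^ N * z ^ (d - N) * (of_real (Im \<zeta> ^ m) * Qz m z))
    = Im (\<eta> (N + 1 + (m - 1)) * \<zeta> ^ (N + 1 + (m - 1)) * z ^ (2 * d - 1 - (N + 1 + (m - 1))))"
  proof (rule leading_part)
    show "Q k z = 0" if "k > N + 1" for k z using that N by (intro Q_eq_0 top) auto
    show "Q k z = 0" if "k > Suc (m - 1)" for k z using that m by (intro Q_eq_0 top) auto
    show "Qz k z = 0" if "k > m" for k z using that by (intro Qz_eq_0 top) auto
  qed (use m \<alpha> \<beta> in auto)
  have B: "\<beta> N * \<zeta> ^ N * z ^ (d - N) * (of_real (Im \<zeta> ^ m) * Qz m z)
      = of_real (Im \<zeta> ^ m) * ((\<beta> N * z ^ (d - N) * Qz m z) * \<zeta> ^ N)"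
    by (simp only: mult_ac)
  have A: "Im ((of_real (real m * Q m z) * \<alpha> (N + 1) * z ^ (d - (N + 1))) * \<zeta> ^ (N + 1))
      = (real m * Q m z) * Im (\<alpha> (N + 1) * \<zeta> ^ (N + 1) * z ^ (d - (N + 1)))"
    by (simp only: Im_of_real_mult[symmetric] mult_ac)
  have Y: "Im \<zeta> ^ (N + m) = Im \<zeta> ^ (N + 1) * Im \<zeta> ^ (m - 1)"
    by (metis nm power_add)
  have E: "\<eta> (N + m) * \<zeta> ^ (N + m) * z ^ (2 * d - 1 - (N + m)) = (\<eta> (N + m) * z ^ (2 * d - 1 - (N + m))) * \<zeta> ^ (N + m)"
    by (simp only: mult_ac)
  show ?thesis using L
    unfolding sm nm B Re_of_real_mult A Y E by (simp only: algebra_simps)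
qed

text \<open>On the circle the right-hand side \<open>\<eta> z\<^sup>k\<close> is real only if \<open>k = 0\<close> or \<open>\<eta> = 0\<close>.\<close>

lemma leading_form_quadratic:
  assumes top: "\<And>k j. k > m \<Longrightarrow> c k j = 0" and m: "m = 2" and N: "N + 1 \<ge> m"
    and \<beta>: "\<And>j. j > N \<Longrightarrow> \<beta> j = 0" and \<alpha>: "\<And>j. j > N + 1 \<Longrightarrow> \<alpha> j = 0"
  shows "\<eta> (N + m) = 0 \<or> \<alpha> (N + 1) = 0"
proof (cases "2 * d - 1 > N + m")
  case True
  have "smult (- \<i>) (monom (\<eta> (N + m)) (2 * d - 1 - (N + m))) = 0"
  proof (rule poly_eq_0_if_Re_zero_on_circle)
    fix z :: complex
    \<comment> \<open>At \<open>\<zeta> = 1\<close> every term on the left contains a positive power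
      of \<open>Im \<zeta> = 0\<close>.\<close>
    have "Im (\<eta> (N + m) * z ^ (2 * d - 1 - (N + m))) = 0"
      using leading_form[OF top _ N \<beta> \<alpha>, of z 1] m by simp
    then show "Re (poly (smult (- \<i>) (monom (\<eta> (N + m)) (2 * d - 1 - (N + m)))) z) = 0"
      by (simp add: poly_monom)
  qed (use True in auto)
  then show ?thesis by simp
next
  case False
  then have "N + 1 > d" using d m by linarith
  then show ?thesis using \<alpha>_supp by simp
qed

text \<open>If \<open>N + 1 = m\<close>, then \<open>S\<close> is a positive multiple of the square
  of the top form, and \<open>form_identity\<close> expresses it through \<open>B\<close> and
  \<open>cnj B\<close>, against \<open>zform_square_not_balanced\<close>. If
  \<open>N + 1 > m\<close>, then \<open>Q (N + 1)\<close> and with it \<open>S\<close> vanish. Now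
  \<open>B\<close> is zero, or merely real for \<open>N = 1\<close>, which removes
  \<open>\<beta> N\<close>; what remains relates \<open>A\<close> to \<open>H\<close> and removes
  \<open>\<alpha> (N + 1)\<close>.\<close>

lemma
  assumes top: "\<And>k j. k > m \<Longrightarrow> c k j = 0" and m: "m \<ge> 1" and cm: "c m i \<noteq> 0"
    and N: "N \<ge> 1" "N + 1 \<ge> m"
    and \<beta>: "\<And>j. j > N \<Longrightarrow> \<beta> j = 0" and \<alpha>: "\<And>j. j > N + 1 \<Longrightarrow> \<alpha> j = 0"
  shows leading_step_square: "N + 1 \<noteq> m"
    and leading_step: "\<beta> N = 0 \<and> \<alpha> (N + 1) = 0"
proof -
  define e where "e = d - m"
  have md: "m < d" by (rule degree_lt[OF cm top])
  have e1: "e \<ge> 1" and me: "d - m = e" using md by (auto simp: e_def)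
  have i: "i \<le> e" using c_supp[of m i] cm md by (fastforce simp: e_def)
  define S A B H where "S z = real m * Q (N + 1) z * Q m z"
    and "A z = of_real (real m * Q m z) * \<alpha> (N + 1) * z ^ (d - (N + 1))"
    and "B z = \<beta> N * z ^ (d - N) * Qz m z"
    and "H z = \<eta> (N + m) * z ^ (2 * d - 1 - (N + m))" for z
  note lf = leading_form[OF top m N(2) \<beta> \<alpha>, folded S_def A_def B_def H_def]
  have m2: "H z = 0 \<or> A z = 0" if "m = 2" for z
    using leading_form_quadratic[OF top that N(2) \<beta> \<alpha>] by (auto simp: H_def A_def)
  have fi: "N \<ge> 2 \<Longrightarrow> cnj (B z) = of_nat (N + 1) * (- 1 / (2 * \<i>)) ^ N * of_real (S z) * - 1"
    "N = 1 \<Longrightarrow> 2 * Im (B z) = S z"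
    "S z = 0 \<Longrightarrow> B z = 0 \<Longrightarrow> A z = (if m = 1 then H z else 0)" for z
    using form_identity[OF m N(1), of "H z" "A z" "S z" "B z", OF m2 lf] by blast+
  show Nm: "N + 1 \<noteq> m"
  proof
    assume Nm: "N + 1 = m"
    then have S: "of_real (S z) = of_nat m * (zform (c m) e z)\<^sup>2" for z
      using md by (simp add: S_def e_def power2_eq_square mult_ac flip: of_real_Q)
    have B: "B z = \<beta> N * (z ^ (e + 1) * zform_deriv (c m) e z)" for z
    proof -
      have "d - N = e + 1" using Nm md by (simp add: e_def)
      then show ?thesis by (simp only: B_def Qz_def me mult.assoc)
    qed
    have sym: "c m (e - j) = cnj (c m j)" if "j \<le> e" for j
      using c_sym'[of m j] md that by (simp add: e_def)
    show False
    proof (cases "N = 1")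
      case True
      show False
      proof (rule zform_square_not_balanced[of e "c m", OF sym i cm])
        fix z :: complex
        have "of_real (S z) = - \<i> * (B z - cnj (B z))"
          using fi(2)[of z, OF True] by (simp add: complex_eq_iff)
        then have "(zform (c m) e z)\<^sup>2 = - \<i> / of_nat m * (B z - cnj (B z))"
          using m unfolding S by (simp add: field_simps)
        then show "(zform (c m) e z)\<^sup>2 = (- \<i> / of_nat m * \<beta> N) * (z ^ (e + 1) * zform_deriv (c m) e z)
            + (\<i> / of_nat m * cnj (\<beta> N)) * cnj (z ^ (e + 1) * zform_deriv (c m) e z)"
          unfolding B by (simp add: algebra_simps)
      qed
    next
      case False
      define K where "K = - (of_nat (N + 1) * (- 1 / (2 * \<i>)) ^ N * of_nat m)"
      have K: "K \<noteq> 0" using m unfolding K_def by (simp del: of_nat_add of_nat_Suc add: of_nat_eq_0_iff)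
      show False
      proof (rule zform_square_not_balanced[of e "c m", OF sym i cm])
        fix z :: complex
        have "cnj (B z) = K * (zform (c m) e z)\<^sup>2"
          using fi(1)[of z] False N unfolding S K_def by (simp add: mult_ac)
        then have "(zform (c m) e z)\<^sup>2 = cnj (B z) / K"
          using K by simp
        then show "(zform (c m) e z)\<^sup>2 = 0 * (z ^ (e + 1) * zform_deriv (c m) e z)
            + (cnj (\<beta> N) / K) * cnj (z ^ (e + 1) * zform_deriv (c m) e z)"
          unfolding B by simp
      qed
    qed
  qed
  then have S0: "S z = 0" for z
    using N by (simp add: S_def Q_eq_0 top)
  define p where "p = seq_poly (c m) e"
  have p': "pderiv p \<noteq> 0" unfolding p_def e_def by (rule pderiv_seq_poly_nonzero[OF md cm])
  have Qzc: "z ^ (e + 1) * Qz m z = z\<^sup>2 * poly (pderiv p) (z\<^sup>2)" if "norm z = 1" for z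
    unfolding p_def e_def by (rule Qz_circle[OF that])
  have \<beta>0: "\<beta> N = 0"
  proof (cases "N = 1")
    case True
    then have m1: "m = 1" and e: "e + 1 = d" using Nm N(2) m d by (auto simp: e_def)
    \<comment> \<open>For \<open>N = 1\<close> only \<open>Im (B z) = 0\<close> is known. On the
      circle \<open>B z\<close> is an odd polynomial in \<open>z\<close>, hence without constant
      term, so multiplication by \<open>- \<i>\<close> makes
      \<open>poly_eq_0_if_Re_zero_on_circle\<close> applicable.\<close>
    define q where "q = smult (- \<i> * \<beta> N) (monom 1 1 * pcompose (pderiv p) (monom 1 2))"
    have "q = 0"
    proof (rule poly_eq_0_if_Re_zero_on_circle)
      fix z :: complex assume z: "norm z = 1"
      have d1: "z ^ d = z * z ^ (d - 1)" using d by (simp flip: power_Suc)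
      have "z * (z ^ (d - 1) * Qz 1 z) = z * (z * poly (pderiv p) (z\<^sup>2))"
        using Qzc[OF z] unfolding m1 e d1 by (simp add: power2_eq_square mult_ac)
      then have "z ^ (d - 1) * Qz 1 z = z * poly (pderiv p) (z\<^sup>2)"
        using z by auto
      then have "B z = \<beta> N * (z * poly (pderiv p) (z\<^sup>2))"
        unfolding B_def True m1 by (simp add: mult_ac)
      then have "poly q z = - \<i> * B z"
        by (simp add: q_def poly_monom poly_pcompose)
      then show "Re (poly q z) = 0"
        using fi(2)[of z, OF True] S0 by simp
    qed (simp add: q_def coeff_monom_mult)
    then have "\<beta> N = 0 \<or> pcompose (pderiv p) (monom 1 2) = 0"
      by (simp add: q_def)
    moreover have "pcompose (pderiv p) (monom 1 2) \<noteq> 0"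
      using p' by (subst pcompose_eq_0_iff) (auto simp: degree_monom_eq)
    ultimately show ?thesis by blast
  next
    case False
    have "smult (\<beta> N) (pderiv p) = 0" if "N \<le> d"
    proof (rule poly_eq_0_if_zero_on_circle)
      fix s :: complex assume s: "norm s = 1"
      then obtain z where z: "norm z = 1" "z\<^sup>2 = s" by (rule circle_square_root)
      have z0: "z \<noteq> 0" using z by auto
      have "B z = 0" using fi(1)[of z] False N S0 by simp
      then have "\<beta> N * (z ^ (e + 1) * Qz m z) = 0" using z0 by (auto simp: B_def)
      then show "poly (smult (\<beta> N) (pderiv p)) s = 0"
        unfolding Qzc[OF z(1)] using z0 z by auto
    qed
    then show ?thesis using p' \<beta>_supp[of N] by (cases "N \<le> d") auto
  qed
  then have B0: "B z = 0" for z by (simp add: B_def)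
  have "\<alpha> (N + 1) = 0"
  proof (cases "N + 1 \<le> d")
    case True
    \<comment> \<open>On the circle the relation between \<open>A\<close> and \<open>H\<close> says
      that a multiple of \<open>p\<close> equals \<open>h * s ^ e\<close>, which corresponds to the
      holomorphic power \<open>z ^ e\<close>. Since \<open>e \<ge> 1\<close>, the symmetry of
      \<open>c m\<close> does not allow the top form to be a multiple of it.\<close>
    define h where "h = (if m = 1 then \<eta> (N + m) else 0)"
    have "smult (of_nat m * \<alpha> (N + 1)) p - monom h e = 0"
    proof (rule poly_eq_0_if_zero_on_circle)
      fix s :: complex assume s: "norm s = 1"
      then obtain z where z: "norm z = 1" "z\<^sup>2 = s" by (rule circle_square_root)
      have z0: "z \<noteq> 0" using z by auto
      have Qc: "z ^ e * of_real (Q m z) = poly p s"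
        using Q_circle[of m z] md z by (simp add: p_def e_def)
      have "A z = (if m = 1 then H z else 0)" using fi(3)[of z, OF S0 B0] by simp
      then have AH: "z ^ e * A z = h * (z ^ e * z ^ (2 * d - 1 - (N + m)))" by (simp add: h_def H_def)
      have E: "z ^ e * z ^ (2 * d - 1 - (N + m)) = z ^ (d - (N + 1)) * s ^ e" if "m = 1"
      proof -
        have "e + (2 * d - 1 - (N + m)) = (d - (N + 1)) + 2 * e" using True that by (simp add: e_def)
        then show ?thesis unfolding z(2)[symmetric] by (metis power_add power_mult)
      qed
      have "z ^ e * A z = z ^ (d - (N + 1)) * (h * s ^ e)"
      proof (cases "m = 1")
        case True
        then show ?thesis unfolding AH E[OF True] by (simp only: mult.left_commute)
      next
        case False
        then have "h = 0" by (simp add: h_def)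
        then show ?thesis unfolding AH by simp
      qed
      moreover have "z ^ e * A z = z ^ (d - (N + 1)) * (of_nat m * \<alpha> (N + 1) * poly p s)"
        unfolding A_def Qc[symmetric] by (simp add: mult_ac)
      ultimately show "poly (smult (of_nat m * \<alpha> (N + 1)) p - monom h e) s = 0"
        using z0 by (simp add: poly_monom)
    qed
    then have *: "of_nat m * \<alpha> (N + 1) * coeff p j = coeff (monom h e) j" for j
      by (metis coeff_smult right_minus_eq)
    show ?thesis
    proof (rule ccontr)
      assume "\<alpha> (N + 1) \<noteq> 0"
      then have z: "c m j = 0" if "j < e" for j
        using *[of j] that m by (simp add: p_def coeff_seq_poly)
      moreover have "c m e = cnj (c m 0)"
        using c_sym'[of m 0] md by (simp add: e_def)
      ultimately have "c m j = 0" if "j \<le> e" for j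
        using e1 that by (cases "j = e") auto
      then show False using cm i by blast
    qed
  qed (simp add: \<alpha>_supp)
  with \<beta>0 show "\<beta> N = 0 \<and> \<alpha> (N + 1) = 0" by simp
qed

text \<open>Downward induction on \<open>N\<close>: above \<open>d\<close> the support conditions
  hold, and each application of \<open>leading_step\<close> lowers both bounds by one.\<close>

lemma vanishing_above:
  assumes top: "\<And>k j. k > m \<Longrightarrow> c k j = 0" and m: "m \<ge> 1" and cm: "c m i \<noteq> 0"
    and N: "N \<ge> 1" "N + 1 \<ge> m"
  shows "\<forall>j. (j \<ge> N \<longrightarrow> \<beta> j = 0) \<and> (j \<ge> N + 1 \<longrightarrow> \<alpha> j = 0)"
  using N
proof (induction "d - N" arbitrary: N rule: less_induct)
  case less
  show ?case
  proof (cases "N > d")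
    case True
    then show ?thesis using \<alpha>_supp \<beta>_supp by auto
  next
    case False
    then have *: "\<forall>j. (j \<ge> N + 1 \<longrightarrow> \<beta> j = 0) \<and> (j \<ge> N + 1 + 1 \<longrightarrow> \<alpha> j = 0)"
      using less.hyps[of "N + 1"] less.prems \<alpha>_supp \<beta>_supp by (cases "N = d") (simp_all del: One_nat_def)
    have "\<beta> N = 0 \<and> \<alpha> (N + 1) = 0"
      by (rule leading_step[OF top m cm less(2,3)]) (use * in auto)
    then show ?thesis using * by (metis le_neq_implies_less Suc_eq_plus1 Suc_leI)
  qed
qed

text \<open>For \<open>m \<ge> 2\<close> the descent reaches \<open>N = m - 1\<close>, the value at
  which the square of the top form appears, and this is contradictory. For \<open>m = 1\<close> it
  stops at \<open>N = 1\<close>, leaving only \<open>\<beta> 0\<close>, \<open>\<alpha> 0\<close>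
  and \<open>\<alpha> 1\<close>.\<close>

lemma linear_in_y:
  assumes top: "\<And>k j. k > m \<Longrightarrow> c k j = 0" and m: "m \<ge> 1" and cm: "c m i \<noteq> 0"
  shows "m = 1" "\<And>j. j \<ge> 1 \<Longrightarrow> \<beta> j = 0" "\<And>j. j \<ge> 2 \<Longrightarrow> \<alpha> j = 0"
proof -
  show m1: "m = 1"
  proof (rule ccontr)
    assume "m \<noteq> 1"
    then have "m \<ge> 2" using m by simp
    then have "\<forall>j. (j \<ge> m - 1 \<longrightarrow> \<beta> j = 0) \<and> (j \<ge> m - 1 + 1 \<longrightarrow> \<alpha> j = 0)"
      by (intro vanishing_above[OF top m cm]) auto
    then have "m - 1 + 1 \<noteq> m"
      by (intro leading_step_square[OF top m cm]) (use \<open>m \<ge> 2\<close> in auto)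
    with m show False by simp
  qed
  from vanishing_above[OF top m cm, of 1] m1
  show "\<And>j. j \<ge> 1 \<Longrightarrow> \<beta> j = 0" "\<And>j. j \<ge> 2 \<Longrightarrow> \<alpha> j = 0" by auto
qed


section \<open>Coefficients of a model that is linear in y\<close>

definition p :: "nat \<Rightarrow> complex poly" where "p k = seq_poly (c k) (d - k)"

lemma coeff_p: "k \<le> d \<Longrightarrow> coeff (p k) j = c k j"
  using c_supp[of k j] by (auto simp: p_def coeff_seq_poly)

text \<open>For \<open>m = 1\<close> and \<open>N = 0\<close> the leading part is real-linear in
  \<zeta>, so its values at \<open>\<zeta> = 1\<close> and \<open>\<zeta> = \<i>\<close> carry all
  the information.\<close>

lemma linear_form_equation:
  assumes top: "\<And>k j. k > 1 \<Longrightarrow> c k j = 0"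
    and \<beta>: "\<And>j. j \<ge> 1 \<Longrightarrow> \<beta> j = 0" and \<alpha>: "\<And>j. j \<ge> 2 \<Longrightarrow> \<alpha> j = 0"
  shows "Im (\<alpha> 1 * z ^ (d - 1)) * Q 1 z = Im (\<eta> 1 * z ^ (2 * d - 2))"
    and "Q 1 z ^ 2 + Re (\<alpha> 1 * z ^ (d - 1)) * Q 1 z + 2 * Re (\<beta> 0 * z ^ d * Qz 1 z)
      = Re (\<eta> 1 * z ^ (2 * d - 2))"
proof -
  have *: "(real 1 * Q (0 + 1) z * Q 1 z) * Im \<zeta> ^ (0 + 1)
      + Im ((of_real (real 1 * Q 1 z) * \<alpha> (0 + 1) * z ^ (d - (0 + 1))) * \<zeta> ^ (0 + 1)) * Im \<zeta> ^ (1 - 1)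
      + 2 * Re ((\<beta> 0 * z ^ (d - 0) * Qz 1 z) * \<zeta> ^ 0) * Im \<zeta> ^ 1
      = Im ((\<eta> (0 + 1) * z ^ (2 * d - 1 - (0 + 1))) * \<zeta> ^ (0 + 1))" for \<zeta>
    by (rule leading_form) (use top \<alpha> \<beta> in auto)
  have n: "2 * d - 1 - 1 = 2 * d - 2" by simp
  have a: "of_real (Q 1 z) * \<alpha> 1 * z ^ (d - 1) = of_real (Q 1 z) * (\<alpha> 1 * z ^ (d - 1))" by (simp only: mult.assoc)
  have q: "Q 1 z * Q 1 z = Q 1 z ^ 2" by (simp add: power2_eq_square)
  show "Im (\<alpha> 1 * z ^ (d - 1)) * Q 1 z = Im (\<eta> 1 * z ^ (2 * d - 2))"
    using *[of 1] unfolding n add_0 of_nat_1 mult_1_left mult_1_right power_one power_one_right diff_self_eq_0 power_0 a Im_of_real_mult one_complex.sel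
    by (simp only: mult_zero_right mult_zero_left add_0_left add_0_right mult.commute n)
  have I: "Im (x * \<i>) = Re x" for x by simp
  show "Q 1 z ^ 2 + Re (\<alpha> 1 * z ^ (d - 1)) * Q 1 z + 2 * Re (\<beta> 0 * z ^ d * Qz 1 z)
      = Re (\<eta> 1 * z ^ (2 * d - 2))"
    using *[of \<i>] unfolding n add_0 of_nat_1 mult_1_left mult_1_right power_one power_one_right diff_self_eq_0 power_0 diff_zero
     I a Re_of_real_mult imaginary_unit.sel q
    by (simp only: mult_1_right power_one mult.commute n)
qed

text \<open>On the circle \<open>u\<close> encodes the imaginary part and \<open>v\<close> the full
  complex form of the two equations. Entry \<open>l\<close> of \<open>v\<close> contains the sum of
  the squared moduli of the \<open>c 1 j\<close>, which forces \<open>a\<close> and \<mu> to be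
  nonzero. The entries of \<open>u\<close> strictly between \<open>l\<close> and
  \<open>2 * l\<close> then kill the middle coefficients, and the entries \<open>2 * l\<close> of
  \<open>u\<close> and \<open>v\<close> together give the value of \<open>\<beta> 0\<close>.\<close>

lemma linear_coefficients:
  assumes top: "\<And>k j. k > 1 \<Longrightarrow> c k j = 0" and c1: "c 1 i \<noteq> 0"
    and \<beta>: "\<And>j. j \<ge> 1 \<Longrightarrow> \<beta> j = 0" and \<alpha>: "\<And>j. j \<ge> 2 \<Longrightarrow> \<alpha> j = 0"
  shows "\<And>j. 0 < j \<Longrightarrow> j < d - 1 \<Longrightarrow> c 1 j = 0" "c 1 (d - 1) \<noteq> 0"
    "\<beta> 0 * of_nat (d - 1) = - c 1 (d - 1)"
proof -
  note One_nat_def [simp del]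
  define l where "l = d - 1"
  have l: "l \<ge> 2" "d = l + 1" "d - 1 = l" "2 * d - 2 = 2 * l" using d by (auto simp: l_def)
  note eqs = linear_form_equation[OF top \<beta> \<alpha>, unfolded l(3,4)]
  define r where "r = seq_poly (\<lambda>i. of_nat (l - i) * cnj (c 1 (l - i))) l"
  define a where "a = \<alpha> 1"
  define u where "u = monom a l * p 1 - smult (cnj a) (p 1) - monom (\<eta> 1) (2 * l) + [:cnj (\<eta> 1):]"
  define v where "v = monom a l * p 1 + p 1 * p 1 + monom (\<beta> 0) (l + 1) * pderiv (p 1)
      + smult (cnj (\<beta> 0)) r - monom (\<eta> 1) (2 * l)"
  have uv: "poly u s = 0 \<and> poly v s = 0" if s: "norm s = 1" for s
  proof -
    obtain z where z: "norm z = 1" "z\<^sup>2 = s" "z * cnj z = 1" using s by (rule circle_square_root)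
    have sp: "s ^ n = z ^ n * z ^ n" for n using z by (simp flip: power_mult_distrib add: power2_eq_square)
    have zp: "z ^ n * cnj z ^ n = 1" for n using z(3) by (metis power_mult_distrib power_one)
    have P: "z ^ l * of_real (Q 1 z) = poly (p 1) s"
      using Q_circle[of 1 z, OF _ z(1)] d unfolding p_def l(3) z(2) by simp
    have P': "z ^ d * Qz 1 z = s * poly (pderiv (p 1)) s"
      using Qz_circle[OF z(1), of 1] d unfolding p_def z(2) by simp
    have R: "s ^ l * cnj (z ^ d * Qz 1 z) = poly r s"
      unfolding P' p_def r_def l(3) by (rule cnj_zform_deriv_circle[OF s])
    have z2: "z ^ (2 * l) = s ^ l" using z by (simp add: power_mult)
    have I: "2 * \<i> * of_real (Im x) = x - cnj x" for x by (simp add: complex_eq_iff)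
    have "2 * \<i> * of_real (Im (a * z ^ l)) * of_real (Q 1 z) = 2 * \<i> * of_real (Im (\<eta> 1 * z ^ (2 * l)))"
      using eqs(1)[of z] by (metis a_def mult.assoc of_real_mult)
    then have "(a * z ^ l - cnj a * cnj z ^ l) * of_real (Q 1 z) = \<eta> 1 * s ^ l - cnj (\<eta> 1) * cnj s ^ l"
      unfolding I z2 by simp
    then have M1: "s ^ l * ((a * z ^ l - cnj a * cnj z ^ l) * of_real (Q 1 z)) = s ^ l * (\<eta> 1 * s ^ l - cnj (\<eta> 1) * cnj s ^ l)"
      by simp
    have M2: "s ^ l * cnj s ^ l = 1"
      using s by (metis mult_1_right power_mult_distrib power_one complex_norm_square of_real_1)
    have M3: "s ^ l * ((a * z ^ l - cnj a * cnj z ^ l) * of_real (Q 1 z))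
       = a * s ^ l * (z ^ l * of_real (Q 1 z)) - cnj a * (z ^ l * cnj z ^ l) * (z ^ l * of_real (Q 1 z))"
      unfolding sp by (simp add: algebra_simps)
    have "a * s ^ l * poly (p 1) s - cnj a * poly (p 1) s = s ^ l * (\<eta> 1 * s ^ l - cnj (\<eta> 1) * cnj s ^ l)"
      using M1 unfolding M3 P zp by simp
    also have "\<dots> = \<eta> 1 * (s ^ l * s ^ l) - cnj (\<eta> 1) * (s ^ l * cnj s ^ l)"
      by (simp add: algebra_simps)
    finally have "a * s ^ l * poly (p 1) s - cnj a * poly (p 1) s = \<eta> 1 * (s ^ l * s ^ l) - cnj (\<eta> 1)"
      unfolding M2 by simp
    then have u: "poly u s = 0"
      by (simp add: u_def poly_monom power_add mult_2)
    have "of_real (Q 1 z) * (a * z ^ l) + (of_real (Q 1 z ^ 2)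
        + (\<beta> 0 * z ^ d * Qz 1 z + cnj (\<beta> 0 * z ^ d * Qz 1 z))) = \<eta> 1 * z ^ (2 * l)" (is "?L = ?R")
    proof (rule complex_eqI)
      show "Re ?L = Re ?R" using eqs(2)[of z] unfolding a_def plus_complex.sel Re_of_real_mult cnj.sel
        by (simp only: Re_complex_of_real mult.commute) simp
      show "Im ?L = Im ?R" using eqs(1)[of z] unfolding a_def plus_complex.sel Im_of_real_mult cnj.sel
        by (simp only: Im_complex_of_real mult.commute)
    qed
    then have N1: "s ^ l * (of_real (Q 1 z) * (a * z ^ l) + (of_real (Q 1 z ^ 2)
        + (\<beta> 0 * z ^ d * Qz 1 z + cnj (\<beta> 0 * z ^ d * Qz 1 z)))) = s ^ l * (\<eta> 1 * s ^ l)"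
      unfolding z2 by simp
    have N2: "s ^ l * (of_real (Q 1 z) * (a * z ^ l) + (of_real (Q 1 z ^ 2)
        + (\<beta> 0 * z ^ d * Qz 1 z + cnj (\<beta> 0 * z ^ d * Qz 1 z))))
        = a * s ^ l * (z ^ l * of_real (Q 1 z)) + (z ^ l * of_real (Q 1 z)) * (z ^ l * of_real (Q 1 z))
         + \<beta> 0 * s ^ l * (z ^ d * Qz 1 z) + cnj (\<beta> 0) * (s ^ l * cnj (z ^ d * Qz 1 z))"
      by (simp add: algebra_simps power2_eq_square sp)
    have "a * s ^ l * poly (p 1) s + poly (p 1) s * poly (p 1) s + \<beta> 0 * s ^ l * (s * poly (pderiv (p 1)) s)
        + cnj (\<beta> 0) * poly r s = s ^ l * (\<eta> 1 * s ^ l)"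
      using N1 unfolding N2 P R unfolding P' .
    then have v: "poly v s = 0"
      by (simp add: v_def poly_monom power_add mult_2 mult_2_right mult_ac)
    show ?thesis using u v by simp
  qed
  have u0: "u = 0" and v0: "v = 0" using uv by (blast intro: poly_eq_0_if_zero_on_circle)+
  have cp: "coeff (p 1) j = c 1 j" for j using coeff_p[of 1 j] d by simp
  have cl: "c 1 j = 0" if "j > l" for j using c_supp[of 1 j] that l by simp
  have const: "coeff [:x:] n = 0" if "n > 0" for x :: complex and n
    using that by (cases n) auto
  have sym: "c 1 (l - j) = cnj (c 1 j)" if "j \<le> l" for j
    using c_sym[of 1 j] that l by simp
  define \<mu> where "\<mu> = c 1 l"
  have c0: "c 1 0 = cnj \<mu>" using sym[of l] by (simp add: \<mu>_def)
  \<comment> \<open>Index \<open>l\<close> sees neither \<open>pderiv (p 1)\<close>, which is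
    shifted by \<open>l + 1\<close>, nor \<open>r\<close>, whose entry there has the factor
    \<open>l - l\<close>.\<close>
  have "coeff v l = a * c 1 0 + coeff (p 1 * p 1) l"
    using l(1) by (simp add: v_def coeff_monom_mult cp r_def coeff_seq_poly del: One_nat_def)
  then have vl: "a * cnj \<mu> + coeff (p 1 * p 1) l = 0" using v0 c0 by simp
  have "coeff (p 1 * p 1) l \<noteq> 0"
    unfolding p_def l(3) by (rule coeff_square_middle_nonzero[OF sym _ c1]) (use cl[of i] c1 in force)+
  then have a0: "a \<noteq> 0" and \<mu>0: "\<mu> \<noteq> 0" using vl by auto
  have cmid: "c 1 j = 0" if "0 < j" "j < l" for j
  proof -
    have "coeff u (l + j) = a * c 1 j"
      using that cl[of "l + j"] const[of "l + j"] by (simp add: u_def coeff_monom_mult cp)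
    then show ?thesis using a0 u0 by simp
  qed
  then show "\<And>j. 0 < j \<Longrightarrow> j < d - 1 \<Longrightarrow> c 1 j = 0" unfolding l(3) by blast
  show "c 1 (d - 1) \<noteq> 0" using \<mu>0 unfolding l(3) \<mu>_def .
  have "coeff u (2 * l) = a * \<mu> - \<eta> 1"
    using l(1) cl[of "2 * l"] const[of "2 * l"] by (simp add: u_def coeff_monom_mult cp \<mu>_def mult_2)
  then have \<eta>: "\<eta> 1 = a * \<mu>" using u0 by simp
  have "coeff (p 1 * p 1) (l + l) = \<mu> * \<mu>"
    by (subst coeff_mult_top) (simp_all add: cp cl \<mu>_def)
  moreover have "coeff (monom (\<beta> 0) (l + 1) * pderiv (p 1)) (l + l) = \<beta> 0 * (of_nat l * \<mu>)"
    using l(1) by (simp add: coeff_monom_mult coeff_pderiv cp \<mu>_def)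
  moreover have "coeff r (l + l) = 0" using l by (simp add: r_def coeff_seq_poly)
  moreover have "coeff (monom a l * p 1) (l + l) = a * \<mu>" by (simp add: coeff_monom_mult cp \<mu>_def)
  ultimately have "coeff v (l + l) = \<mu> * \<mu> + \<beta> 0 * (of_nat l * \<mu>)"
    by (simp add: v_def \<eta> mult_2)
  then have "\<mu> * (\<mu> + \<beta> 0 * of_nat l) = 0" using v0 by (simp add: algebra_simps)
  then show "\<beta> 0 * of_nat (d - 1) = - c 1 (d - 1)"
    using \<mu>0 unfolding l(3) \<mu>_def by (simp add: eq_neg_iff_add_eq_0 add.commute)
qed

text \<open>At \<open>\<zeta> = 0\<close>, index \<open>l + k\<close> of the circle polynomial
  isolates \<open>(\<mu> + \<beta> 0 * of_nat k) * c 0 k = 0\<close>. Because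
  \<open>\<beta> 0 * of_nat l = - \<mu>\<close>, the factor vanishes only for \<open>k = l\<close>,
  which is why the term in \<open>z ^ l * cnj z\<close> and its conjugate may survive.\<close>

lemma constant_coefficients:
  assumes top: "\<And>k j. k > 1 \<Longrightarrow> c k j = 0"
    and c1: "\<And>j. 0 < j \<Longrightarrow> j < d - 1 \<Longrightarrow> c 1 j = 0" "c 1 (d - 1) \<noteq> 0"
    and \<beta>: "\<beta> 0 * of_nat (d - 1) = - c 1 (d - 1)"
    and k: "2 \<le> k" "k \<le> d - 2"
  shows "c 0 k = 0"
proof -
  note One_nat_def [simp del]
  define l where "l = d - 1"
  have l: "l \<ge> 2" "d = l + 1" "d - 1 = l" using d by (auto simp: l_def)
  define \<mu> where "\<mu> = c 1 l"
  have \<mu>0: "\<mu> \<noteq> 0" using c1(2) by (simp add: \<mu>_def l)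
  have cl: "c 1 j = 0" if "j > l" for j using c_supp[of 1 j] that l by simp
  have c0: "c 1 0 = cnj \<mu>" using c_sym[of 1 l] l by (simp add: \<mu>_def)
  define r where "r = seq_poly (\<lambda>i. of_nat (d - i) * cnj (c 0 (d - i))) d"
  define q where "q = p 0 * p 1 + smult (1 / (2 * \<i>)) (monom (\<alpha> 0) d * p 1 - smult (cnj (\<alpha> 0)) (p 1))
    + monom (\<beta> 0) (l + 1) * pderiv (p 0) + smult (cnj (\<beta> 0)) r
    - smult (1 / (2 * \<i>)) (monom (\<eta> 0) (2 * d - 1) - [:cnj (\<eta> 0):])"
  have pp: "p 1 = monom \<mu> l + [:cnj \<mu>:]"
  proof (rule poly_eqI)
    fix j show "coeff (p 1) j = coeff (monom \<mu> l + [:cnj \<mu>:]) j"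
      using coeff_p[of 1 j] c0 c1(1)[of j] cl[of j] l
      by (cases "j = 0"; cases "j < l"; cases "j = l") (auto simp: coeff_pCons \<mu>_def split: nat.splits)
  qed
  have "q = 0"
  proof (rule poly_eq_0_if_zero_on_circle)
    fix s :: complex assume s: "norm s = 1"
    then obtain z where z: "norm z = 1" "z\<^sup>2 = s" "z * cnj z = 1" by (rule circle_square_root)
    have sp: "s ^ n = z ^ n * z ^ n" for n using z by (simp flip: power_mult_distrib add: power2_eq_square)
    have zp: "z ^ n * cnj z ^ n = 1" for n using z(3) by (metis power_mult_distrib power_one)
    have P1: "z ^ l * of_real (Q 1 z) = poly (p 1) s"
      using Q_circle[of 1 z, OF _ z(1)] d unfolding p_def l(3) z(2) by simp
    have P0: "z ^ d * of_real (Q 0 z) = poly (p 0) s"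
      using Q_circle[of 0 z, OF _ z(1)] unfolding p_def z(2) by simp
    have P': "z * (z ^ d * Qz 0 z) = s * poly (pderiv (p 0)) s"
      using Qz_circle[OF z(1), of 0] unfolding p_def z(2) by (simp add: power_add mult_ac)
    have R: "s ^ d * cnj (z * (z ^ d * Qz 0 z)) = poly r s"
      unfolding P' p_def r_def diff_zero by (rule cnj_zform_deriv_circle[OF s])
    have I: "of_real (Im x) = (x - cnj x) / (2 * \<i>)" for x by (simp add: complex_eq_iff)
    have R2: "of_real (2 * Re x) = x + cnj x" for x by (simp add: complex_eq_iff)
    have sing: "(\<Sum>j\<le>n. f j) = f 0" if "\<And>j. j > 0 \<Longrightarrow> f j = 0" for f :: "nat \<Rightarrow> 'a::comm_monoid_add" and n
      using that by (subst sum.atMost_shift) simp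
    have E: "Q 0 z * Q 1 z + Im (\<alpha> 0 * z ^ d) * Q 1 z + 2 * Re (\<beta> 0 * z ^ d * Qz 0 z)
        = Im (\<eta> 0 * z ^ (2 * d - 1))"
    proof -
      have "(\<Sum>k\<le>d. Im 0 ^ k * Re (zform (c k) (d - k) z)) = Q 0 z"
        by (subst sing) (simp_all add: power_0_left Q_def)
      moreover have "(\<Sum>k\<le>d. real (Suc k) * Im 0 ^ k * Re (zform (c (Suc k)) (d - Suc k) z)) = Q 1 z"
        by (subst sing) (simp_all add: power_0_left Q_def One_nat_def)
      moreover have "(\<Sum>k\<le>d. of_real (Im 0 ^ k) * zform_deriv (c k) (d - k) z) = Qz 0 z"
        by (subst sing) (simp_all add: power_0_left Qz_def)
      moreover have "(\<Sum>j\<le>n. f j * 0 ^ j * z ^ (n - j)) = f 0 * z ^ n" for f :: "nat \<Rightarrow> complex" and n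
        by (subst sing) (simp_all add: power_0_left)
      ultimately show ?thesis using symmetry[of 0 z] by (simp only:)
    qed
    have "2 * d - 1 = d + l" using l by simp
    then have n: "z ^ (2 * d - 1) = z ^ d * z ^ l" by (simp only: power_add)
    have K1: "z ^ (2 * d - 1) * (of_real (Q 0 z) * of_real (Q 1 z) + of_real (Im (\<alpha> 0 * z ^ d)) * of_real (Q 1 z)
        + of_real (2 * Re (\<beta> 0 * z ^ d * Qz 0 z))) = z ^ (2 * d - 1) * of_real (Im (\<eta> 0 * z ^ (2 * d - 1)))"
      unfolding E[symmetric] by simp
    have K2: "z ^ (2 * d - 1) * of_real (Im (\<eta> 0 * z ^ (2 * d - 1))) = (\<eta> 0 * s ^ (2 * d - 1) - cnj (\<eta> 0)) / (2 * \<i>)"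
    proof -
      have "z ^ (2 * d - 1) * of_real (Im (\<eta> 0 * z ^ (2 * d - 1)))
        = (\<eta> 0 * (z ^ (2 * d - 1) * z ^ (2 * d - 1)) - cnj (\<eta> 0) * (z ^ (2 * d - 1) * cnj z ^ (2 * d - 1))) / (2 * \<i>)"
        unfolding I by (simp add: algebra_simps)
      then show ?thesis unfolding zp sp by simp
    qed
    have K3: "z ^ (2 * d - 1) * (of_real (Q 0 z) * of_real (Q 1 z) + of_real (Im (\<alpha> 0 * z ^ d)) * of_real (Q 1 z)
        + of_real (2 * Re (\<beta> 0 * z ^ d * Qz 0 z)))
      = poly (p 0) s * poly (p 1) s + (\<alpha> 0 * s ^ d - cnj (\<alpha> 0)) / (2 * \<i>) * poly (p 1) s
        + \<beta> 0 * s ^ l * (s * poly (pderiv (p 0)) s) + cnj (\<beta> 0) * poly r s"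
    proof -
      have 1: "z ^ (2 * d - 1) * (of_real (Q 0 z) * of_real (Q 1 z)) = poly (p 0) s * poly (p 1) s"
        unfolding P0[symmetric] P1[symmetric] n by (simp only: mult_ac)
      have "z ^ (2 * d - 1) * (of_real (Im (\<alpha> 0 * z ^ d)) * of_real (Q 1 z))
        = (\<alpha> 0 * (z ^ d * z ^ d) - cnj (\<alpha> 0) * (z ^ d * cnj z ^ d)) / (2 * \<i>) * (z ^ l * of_real (Q 1 z))"
        unfolding n I by (simp add: algebra_simps)
      then have 2: "z ^ (2 * d - 1) * (of_real (Im (\<alpha> 0 * z ^ d)) * of_real (Q 1 z))
        = (\<alpha> 0 * s ^ d - cnj (\<alpha> 0)) / (2 * \<i>) * poly (p 1) s"
        unfolding zp P1 sp by simp
      have zl: "z ^ d = z ^ l * z" "z ^ (2 * d - 1) = z ^ l * z ^ l * z"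
        unfolding n by (simp_all add: l power_add)
      have 3: "z ^ (2 * d - 1) * (\<beta> 0 * z ^ d * Qz 0 z) = \<beta> 0 * s ^ l * (s * poly (pderiv (p 0)) s)"
        unfolding P'[symmetric] sp zl by (simp only: mult_ac)
      have sd: "s ^ d * cnj z = z ^ (2 * d - 1)"
      proof -
        have "s ^ d * cnj z = z ^ d * (z ^ l * (z * cnj z))" unfolding sp by (simp add: l power_add)
        then show ?thesis unfolding n z(3) by simp
      qed
      have 4: "z ^ (2 * d - 1) * cnj (\<beta> 0 * z ^ d * Qz 0 z) = cnj (\<beta> 0) * poly r s"
        unfolding R[symmetric] sd[symmetric] by (simp add: mult_ac)
      show ?thesis unfolding R2 distrib_left 1 2 3 4 by (simp only: add.assoc)
    qed
    show "poly q s = 0"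
      using K1 unfolding K2 K3
      by (simp add: q_def poly_monom diff_divide_distrib left_diff_distrib right_diff_distrib power_add mult_ac)
  qed
  then have "coeff q (l + k) = 0" by simp
  moreover have "coeff (p 0 * p 1) (l + k) = \<mu> * c 0 k"
  proof -
    have "p 0 * p 1 = monom \<mu> l * p 0 + smult (cnj \<mu>) (p 0)"
      unfolding pp by (simp add: algebra_simps)
    moreover have "c 0 (l + k) = 0" using k l c_supp[of 0 "l + k"] by simp
    ultimately show ?thesis by (simp add: coeff_monom_mult coeff_p)
  qed
  moreover have "coeff (monom (\<alpha> 0) d * p 1) (l + k) = 0"
  proof -
    have "l + k - d = k - 1" using l by simp
    moreover have "coeff (p 1) (k - 1) = 0"
      using coeff_p[of 1 "k - 1"] d c1(1)[of "k - 1"] k by simp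
    ultimately show ?thesis by (simp add: coeff_monom_mult)
  qed
  moreover have "coeff (p 1) (l + k) = 0"
    using k cl[of "l + k"] coeff_p[of 1 "l + k"] d by simp
  moreover have "coeff (monom (\<beta> 0) (l + 1) * pderiv (p 0)) (l + k) = \<beta> 0 * (of_nat k * c 0 k)"
    using k by (simp add: coeff_monom_mult coeff_pderiv coeff_p)
  moreover have "coeff r (l + k) = 0" using k l by (simp add: r_def coeff_seq_poly)
  moreover have "coeff (monom (\<eta> 0) (2 * d - 1) - [:cnj (\<eta> 0):]) (l + k) = 0"
  proof -
    have "2 * d - 1 \<noteq> l + k" "l + k \<noteq> 0" using k l by linarith+
    moreover from this obtain i where "l + k = Suc i" by (cases "l + k") auto
    ultimately show ?thesis by simp
  qed
  ultimately have "(\<mu> + \<beta> 0 * of_nat k) * c 0 k = 0"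
    unfolding q_def by (simp add: algebra_simps)
  moreover have "\<mu> + \<beta> 0 * of_nat k \<noteq> 0"
  proof
    assume "\<mu> + \<beta> 0 * of_nat k = 0"
    then have "\<beta> 0 * of_nat k = - \<mu>" by (simp add: eq_neg_iff_add_eq_0 add.commute)
    then have "\<beta> 0 * of_nat l = \<beta> 0 * of_nat k" using \<beta> unfolding l(3) \<mu>_def by metis
    moreover have "\<beta> 0 \<noteq> 0" using \<beta> c1(2) by auto
    ultimately have "l = k" by simp
    with k l show False by simp
  qed
  ultimately show ?thesis by simp
qed

text \<open>The preceding lemmas are relative to the top exponent of \<open>y\<close>. It is taken
  here as the largest \<open>k\<close> with a nonzero coefficient and is positive because
  \<open>Q\<close> is assumed to depend on \<open>y\<close>.\<close>

lemma classification:
  assumes "k \<ge> 1" "c k j \<noteq> 0"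
  shows "\<And>k j. k > 1 \<Longrightarrow> c k j = 0"
    "\<And>j. 0 < j \<Longrightarrow> j < d - 1 \<Longrightarrow> c 1 j = 0" "c 1 (d - 1) \<noteq> 0"
    "\<And>k. 2 \<le> k \<Longrightarrow> k \<le> d - 2 \<Longrightarrow> c 0 k = 0"
proof -
  define M where "M = {k. \<exists>j. c k j \<noteq> 0}"
  define m where "m = Max M"
  have "k \<le> d" if "c k j \<noteq> 0" for k j
    using c_supp[of k j] that by (cases "k \<le> d") auto
  then have "M \<subseteq> {..d}" by (auto simp: M_def)
  then have fin: "finite M" by (rule finite_subset) simp
  have "k \<in> M" using assms by (auto simp: M_def)
  then have "m \<ge> k" "m \<in> M" unfolding m_def using fin by (auto intro: Max_in)
  then have m1: "m \<ge> 1" using assms by simp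
  obtain i where cm: "c m i \<noteq> 0" using \<open>m \<in> M\<close> by (auto simp: M_def)
  have top: "c k j = 0" if "k > m" for k j
  proof (rule ccontr)
    assume "c k j \<noteq> 0"
    then have "k \<in> M" by (auto simp: M_def)
    then have "k \<le> m" unfolding m_def using fin by simp
    with that show False by simp
  qed
  have m: "m = 1" by (rule linear_in_y(1)[OF top m1 cm])
  have \<beta>: "\<And>j. j \<ge> 1 \<Longrightarrow> \<beta> j = 0" by (rule linear_in_y(2)[OF top m1 cm])
  have \<alpha>: "\<And>j. j \<ge> 2 \<Longrightarrow> \<alpha> j = 0" by (rule linear_in_y(3)[OF top m1 cm])
  have top1: "\<And>k j. k > 1 \<Longrightarrow> c k j = 0" using top m by simp
  note co = linear_coefficients[OF top1 cm[unfolded m] \<beta> \<alpha>]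
  show "\<And>k j. k > 1 \<Longrightarrow> c k j = 0" by (fact top1)
  show "\<And>j. 0 < j \<Longrightarrow> j < d - 1 \<Longrightarrow> c 1 j = 0" by (rule co(1))
  show "c 1 (d - 1) \<noteq> 0" by (rule co(2))
  show "\<And>k. 2 \<le> k \<Longrightarrow> k \<le> d - 2 \<Longrightarrow> c 0 k = 0"
    by (rule constant_coefficients[OF top1 co])
qed

end

section \<open>Homogeneous polynomial functions\<close>

text \<open>Coefficients beyond \<open>n\<close> are required to be zero to match the support
  conditions of \<open>tube_symmetry\<close>.\<close>

definition hom2 :: "nat \<Rightarrow> (complex \<Rightarrow> complex \<Rightarrow> complex) \<Rightarrow> bool" where
  "hom2 n f \<longleftrightarrow> (\<exists>\<alpha>. (\<forall>j>n. \<alpha> j = 0) \<and> (\<forall>x z. f x z = (\<Sum>j\<le>n. \<alpha> j * x ^ j * z ^ (n - j))))"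

lemma hom2E:
  assumes "hom2 n f"
  obtains \<alpha> where "\<And>j. j > n \<Longrightarrow> \<alpha> j = 0" "\<And>x z. f x z = (\<Sum>j\<le>n. \<alpha> j * x ^ j * z ^ (n - j))"
  using assms unfolding hom2_def by blast

lemma hom2I:
  assumes "\<And>x z. f x z = (\<Sum>j\<le>n. \<alpha> j * x ^ j * z ^ (n - j))"
  shows "hom2 n f"
  unfolding hom2_def using assms by (intro exI[of _ "\<lambda>j. if j \<le> n then \<alpha> j else 0"]) auto

lemma hom2_0: "hom2 n (\<lambda>_ _. 0)"
  by (rule hom2I[of _ "\<lambda>_. 0"]) simp

lemma hom2_const: "hom2 0 (\<lambda>_ _. a)"
  by (rule hom2I[of _ "\<lambda>_. a"]) simp

lemma hom2_add:
  assumes "hom2 n f" "hom2 n g"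
  shows "hom2 n (\<lambda>x z. f x z + g x z)"
proof -
  obtain \<alpha> \<beta> where "\<And>x z. f x z = (\<Sum>j\<le>n. \<alpha> j * x ^ j * z ^ (n - j))"
    "\<And>x z. g x z = (\<Sum>j\<le>n. \<beta> j * x ^ j * z ^ (n - j))"
    using assms by (elim hom2E) blast
  then show ?thesis
    by (intro hom2I[of _ "\<lambda>j. \<alpha> j + \<beta> j"]) (simp add: algebra_simps sum.distrib)
qed

lemma hom2_cmult:
  assumes "hom2 n f"
  shows "hom2 n (\<lambda>x z. a * f x z)"
proof -
  obtain \<alpha> where "\<And>x z. f x z = (\<Sum>j\<le>n. \<alpha> j * x ^ j * z ^ (n - j))"
    using assms by (elim hom2E) blast
  then show ?thesis
    by (intro hom2I[of _ "\<lambda>j. a * \<alpha> j"]) (simp add: sum_distrib_left mult_ac)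
qed

lemma hom2_diff: "hom2 n f \<Longrightarrow> hom2 n g \<Longrightarrow> hom2 n (\<lambda>x z. f x z - g x z)"
  using hom2_add[of n f "\<lambda>x z. - 1 * g x z"] hom2_cmult[of n g "- 1"] by simp

lemma hom2_mult_lin:
  assumes "hom2 n f"
  shows "hom2 (Suc n) (\<lambda>x z. (a * x + b * z) * f x z)"
proof -
  obtain \<alpha> where \<alpha>: "\<And>j. j > n \<Longrightarrow> \<alpha> j = 0" "\<And>x z. f x z = (\<Sum>j\<le>n. \<alpha> j * x ^ j * z ^ (n - j))"
    using assms by (rule hom2E) blast
  have "hom2 (Suc n) (\<lambda>x z. x * f x z)"
    by (rule hom2I[of _ "\<lambda>j. case j of 0 \<Rightarrow> 0 | Suc i \<Rightarrow> \<alpha> i"], subst sum.atMost_Suc_shift)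
       (simp add: \<alpha> sum_distrib_left mult_ac)
  moreover have "hom2 (Suc n) (\<lambda>x z. z * f x z)"
    by (rule hom2I[of _ \<alpha>]) (simp add: \<alpha> sum_distrib_left Suc_diff_le mult_ac)
  ultimately show ?thesis
    using hom2_add[OF hom2_cmult[of _ _ a] hom2_cmult[of _ _ b]] by (fastforce simp: algebra_simps)
qed

lemma hom2_mult_lin_power: "hom2 n f \<Longrightarrow> hom2 (i + n) (\<lambda>x z. (a * x + b * z) ^ i * f x z)"
proof (induction i)
  case (Suc i)
  then show ?case using hom2_mult_lin[of "i + n" "\<lambda>x z. (a * x + b * z) ^ i * f x z" a b]
    by (simp add: mult.assoc)
qed simp

lemma hom2_sum: "finite A \<Longrightarrow> (\<And>i. i \<in> A \<Longrightarrow> hom2 n (f i)) \<Longrightarrow> hom2 n (\<lambda>x z. \<Sum>i\<in>A. f i x z)"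
  by (induction A rule: finite_induct) (auto intro: hom2_0 hom2_add)

lemma hom2_mult:
  assumes "hom2 n f" "hom2 m g"
  shows "hom2 (n + m) (\<lambda>x z. f x z * g x z)"
proof -
  obtain \<alpha> where \<alpha>: "\<And>x z. f x z = (\<Sum>j\<le>n. \<alpha> j * x ^ j * z ^ (n - j))"
    using assms(1) by (rule hom2E) blast
  have "hom2 (n + m) (\<lambda>x z. \<alpha> j * ((1 * x + 0 * z) ^ j * ((0 * x + 1 * z) ^ (n - j) * g x z)))" if "j \<le> n" for j
  proof -
    have "j + (n - j + m) = n + m" using that by simp
    then show ?thesis
      using hom2_cmult[OF hom2_mult_lin_power[OF hom2_mult_lin_power[OF assms(2), of "n - j" 0 1], of j 1 0], of "\<alpha> j"] by simp
  qed
  then have "hom2 (n + m) (\<lambda>x z. \<Sum>j\<le>n. \<alpha> j * ((1 * x + 0 * z) ^ j * ((0 * x + 1 * z) ^ (n - j) * g x z)))"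
    by (intro hom2_sum) auto
  then show ?thesis by (simp add: \<alpha> sum_distrib_right mult.assoc)
qed

lemma hom2_subst:
  assumes "hom2 n f"
  shows "hom2 n (\<lambda>x z. f (a * x + b * z) (a' * x + b' * z))"
proof -
  obtain \<alpha> where \<alpha>: "\<And>x z. f x z = (\<Sum>j\<le>n. \<alpha> j * x ^ j * z ^ (n - j))"
    using assms(1) by (rule hom2E) blast
  have "hom2 n (\<lambda>x z. \<alpha> j * (a * x + b * z) ^ j * (a' * x + b' * z) ^ (n - j))" if "j \<le> n" for j
    using hom2_mult_lin_power[OF hom2_mult_lin_power[OF hom2_const, of "n - j" a' b' "\<alpha> j"], of j a b] that
    by (simp add: mult_ac)
  then show ?thesis unfolding \<alpha> by (intro hom2_sum) auto
qed

lemma hom2_scale: "hom2 n f \<Longrightarrow> f (t * x) (t * z) = t ^ n * f x z"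
proof (elim hom2E)
  fix \<alpha> assume \<alpha>: "\<And>x z. f x z = (\<Sum>j\<le>n. \<alpha> j * x ^ j * z ^ (n - j))"
  have "t ^ n = t ^ j * t ^ (n - j)" if "j \<le> n" for j using that by (simp flip: power_add)
  then show ?thesis unfolding \<alpha> sum_distrib_left
    by (intro sum.cong refl) (simp add: power_mult_distrib mult_ac)
qed

text \<open>The first variable is real and so has no separate conjugate: this is the shape of
  \<open>Q(y, z)\<close>.\<close>

definition hom3 :: "nat \<Rightarrow> (real \<Rightarrow> complex \<Rightarrow> complex) \<Rightarrow> bool" where
  "hom3 n f \<longleftrightarrow> (\<exists>c. \<forall>y z. f y z = (\<Sum>k\<le>n. \<Sum>j\<le>n - k. c k j * of_real y ^ k * z ^ j * cnj z ^ (n - k - j)))"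

lemma hom3_0: "hom3 n (\<lambda>_ _. 0)"
  unfolding hom3_def by (intro exI[of _ "\<lambda>_ _. 0"]) simp

lemma hom3_const: "hom3 0 (\<lambda>_ _. a)"
  unfolding hom3_def by (intro exI[of _ "\<lambda>_ _. a"]) simp

lemma hom3E:
  assumes "hom3 n f"
  obtains c where "\<And>y z. f y z = (\<Sum>k\<le>n. \<Sum>j\<le>n - k. c k j * of_real y ^ k * z ^ j * cnj z ^ (n - k - j))"
  using assms unfolding hom3_def by blast

lemma hom3I:
  assumes "\<And>y z. f y z = (\<Sum>k\<le>n. \<Sum>j\<le>n - k. c k j * of_real y ^ k * z ^ j * cnj z ^ (n - k - j))"
  shows "hom3 n f"
  using assms unfolding hom3_def by blast

lemma hom3_add:
  assumes "hom3 n f" "hom3 n g"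
  shows "hom3 n (\<lambda>x z. f x z + g x z)"
proof -
  obtain c c' where "\<And>y z. f y z = (\<Sum>k\<le>n. \<Sum>j\<le>n - k. c k j * of_real y ^ k * z ^ j * cnj z ^ (n - k - j))"
    "\<And>y z. g y z = (\<Sum>k\<le>n. \<Sum>j\<le>n - k. c' k j * of_real y ^ k * z ^ j * cnj z ^ (n - k - j))"
    using assms by (elim hom3E) blast
  then show ?thesis
    by (intro hom3I[where c = "\<lambda>k j. c k j + c' k j"]) (simp add: algebra_simps sum.distrib)
qed

lemma hom3_cmult:
  assumes "hom3 n f"
  shows "hom3 n (\<lambda>x z. a * f x z)"
proof -
  obtain c where "\<And>y z. f y z = (\<Sum>k\<le>n. \<Sum>j\<le>n - k. c k j * of_real y ^ k * z ^ j * cnj z ^ (n - k - j))"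
    using assms by (elim hom3E) blast
  then show ?thesis
    by (intro hom3I[where c = "\<lambda>k j. a * c k j"]) (simp add: sum_distrib_left mult_ac)
qed

lemma hom3_sum: "finite A \<Longrightarrow> (\<And>i. i \<in> A \<Longrightarrow> hom3 n (f i)) \<Longrightarrow> hom3 n (\<lambda>x z. \<Sum>i\<in>A. f i x z)"
  by (induction A rule: finite_induct) (auto intro: hom3_0 hom3_add)

lemma hom3_mult_lin:
  assumes "hom3 n f"
  shows "hom3 (Suc n) (\<lambda>y z. (p * of_real y + q * z + r * cnj z) * f y z)"
proof -
  obtain c where c: "\<And>y z. f y z = (\<Sum>k\<le>n. \<Sum>j\<le>n - k. c k j * of_real y ^ k * z ^ j * cnj z ^ (n - k - j))"
    using assms unfolding hom3_def by blast
  have 1: "hom3 (Suc n) (\<lambda>y z. of_real y * f y z)"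
    unfolding hom3_def
    by (rule exI[of _ "\<lambda>k j. case k of 0 \<Rightarrow> 0 | Suc i \<Rightarrow> c i j"], subst sum.atMost_Suc_shift)
       (simp add: c sum_distrib_left mult_ac)
  have 2: "hom3 (Suc n) (\<lambda>y z. z * f y z)"
    unfolding hom3_def
  proof (intro exI allI)
    fix y :: real and z :: complex
    let ?c = "\<lambda>k j. if k \<le> n then (case j of 0 \<Rightarrow> 0 | Suc i \<Rightarrow> c k i) else 0"
    have "(\<Sum>k\<le>Suc n. \<Sum>j\<le>Suc n - k. ?c k j * of_real y ^ k * z ^ j * cnj z ^ (Suc n - k - j))
      = (\<Sum>k\<le>n. \<Sum>j\<le>Suc (n - k). ?c k j * of_real y ^ k * z ^ j * cnj z ^ (Suc (n - k) - j))"
      by (simp add: Suc_diff_le)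
    also have "\<dots> = z * f y z"
      unfolding c sum_distrib_left
      by (rule sum.cong[OF refl], subst sum.atMost_Suc_shift) (simp add: mult_ac)
    finally show "z * f y z = (\<Sum>k\<le>Suc n. \<Sum>j\<le>Suc n - k. ?c k j * of_real y ^ k * z ^ j * cnj z ^ (Suc n - k - j))"
      by simp
  qed
  have 3: "hom3 (Suc n) (\<lambda>y z. cnj z * f y z)"
    unfolding hom3_def
  proof (intro exI allI)
    fix y :: real and z :: complex
    let ?c = "\<lambda>k j. if k \<le> n \<and> j \<le> n - k then c k j else 0"
    have "(\<Sum>k\<le>Suc n. \<Sum>j\<le>Suc n - k. ?c k j * of_real y ^ k * z ^ j * cnj z ^ (Suc n - k - j))
      = (\<Sum>k\<le>n. \<Sum>j\<le>Suc (n - k). ?c k j * of_real y ^ k * z ^ j * cnj z ^ (Suc (n - k) - j))"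
      by (simp add: Suc_diff_le)
    also have "\<dots> = cnj z * f y z"
      unfolding c sum_distrib_left
      by (rule sum.cong[OF refl]) (simp add: Suc_diff_le mult_ac)
    finally show "cnj z * f y z = (\<Sum>k\<le>Suc n. \<Sum>j\<le>Suc n - k. ?c k j * of_real y ^ k * z ^ j * cnj z ^ (Suc n - k - j))"
      by simp
  qed
  show ?thesis
    using hom3_add[OF hom3_cmult[OF 1, of p] hom3_add[OF hom3_cmult[OF 2, of q] hom3_cmult[OF 3, of r]]]
    by (simp add: algebra_simps)
qed

lemma hom3_mult_lin_power:
  "hom3 n f \<Longrightarrow> hom3 (i + n) (\<lambda>y z. (p * of_real y + q * z + r * cnj z) ^ i * f y z)"
proof (induction i)
  case (Suc i)
  then show ?case using hom3_mult_lin[of "i + n" "\<lambda>y z. (p * of_real y + q * z + r * cnj z) ^ i * f y z" p q r]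
    by (simp add: mult.assoc)
qed simp

lemma hom3_hom2:
  assumes "hom2 n f"
  shows "hom3 n (\<lambda>y z. f (a * of_real y) z)" "hom3 n (\<lambda>y z. cnj (f (a * of_real y) z))"
proof -
  obtain \<alpha> where \<alpha>: "\<And>x z. f x z = (\<Sum>j\<le>n. \<alpha> j * x ^ j * z ^ (n - j))"
    using assms(1) by (rule hom2E) blast
  have "hom3 n (\<lambda>y z. \<alpha> j * (a * of_real y) ^ j * z ^ (n - j))" if "j \<le> n" for j
    using hom3_mult_lin_power[OF hom3_mult_lin_power[OF hom3_const, of "n - j" 0 1 0 "\<alpha> j"], of j a 0 0] that
    by (simp add: mult_ac)
  then show "hom3 n (\<lambda>y z. f (a * of_real y) z)" unfolding \<alpha> by (intro hom3_sum) auto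
  have "hom3 n (\<lambda>y z. cnj (\<alpha> j) * (cnj a * of_real y) ^ j * cnj z ^ (n - j))" if "j \<le> n" for j
    using hom3_mult_lin_power[OF hom3_mult_lin_power[OF hom3_const, of "n - j" 0 0 1 "cnj (\<alpha> j)"], of j "cnj a" 0 0] that
    by (simp add: mult_ac)
  then show "hom3 n (\<lambda>y z. cnj (f (a * of_real y) z))" unfolding \<alpha> cnj_sum by (intro hom3_sum) auto
qed

text \<open>Averaging the coefficients with their reversed conjugates leaves a real-valued sum
  unchanged. This yields the symmetry without an appeal to uniqueness of coefficients.\<close>

lemma hom3_real_coeffs:
  assumes "hom3 n (\<lambda>y z. of_real (Q y z))"
  obtains c where "\<And>k j. k + j > n \<Longrightarrow> c k j = 0" "\<And>k j. k + j \<le> n \<Longrightarrow> c k (n - k - j) = cnj (c k j)"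
    "\<And>y z. complex_of_real (Q y z) = (\<Sum>k\<le>n. \<Sum>j\<le>n - k. c k j * of_real y ^ k * z ^ j * cnj z ^ (n - k - j))"
proof -
  obtain c where c: "\<And>y z. complex_of_real (Q y z) = (\<Sum>k\<le>n. \<Sum>j\<le>n - k. c k j * of_real y ^ k * z ^ j * cnj z ^ (n - k - j))"
    using assms unfolding hom3_def by blast
  define c' where "c' k j = (if k + j \<le> n then (c k j + cnj (c k (n - k - j))) / 2 else 0)" for k j
  show thesis
  proof
    show "c' k j = 0" if "k + j > n" for k j using that by (simp add: c'_def)
    show "c' k (n - k - j) = cnj (c' k j)" if "k + j \<le> n" for k j
      using that by (simp add: c'_def algebra_simps)
    fix y z
    have "complex_of_real (Q y z) = cnj (complex_of_real (Q y z))" by simp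
    also have "\<dots> = (\<Sum>k\<le>n. \<Sum>j\<le>n - k. cnj (c k j) * of_real y ^ k * cnj z ^ j * z ^ (n - k - j))"
      unfolding c by simp
    also have "\<dots> = (\<Sum>k\<le>n. \<Sum>j\<le>n - k. cnj (c k (n - k - j)) * of_real y ^ k * z ^ j * cnj z ^ (n - k - j))"
    proof (rule sum.cong[OF refl])
      fix k assume "k \<in> {..n}"
      show "(\<Sum>j\<le>n - k. cnj (c k j) * of_real y ^ k * cnj z ^ j * z ^ (n - k - j))
        = (\<Sum>j\<le>n - k. cnj (c k (n - k - j)) * of_real y ^ k * z ^ j * cnj z ^ (n - k - j))"
        by (rule sum.reindex_bij_witness[of _ "\<lambda>j. n - k - j" "\<lambda>j. n - k - j"])
            (auto simp del: diff_diff_left)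
    qed
    finally have "2 * complex_of_real (Q y z)
        = (\<Sum>k\<le>n. \<Sum>j\<le>n - k. c k j * of_real y ^ k * z ^ j * cnj z ^ (n - k - j)
            + cnj (c k (n - k - j)) * of_real y ^ k * z ^ j * cnj z ^ (n - k - j))"
      using c[of y z] unfolding sum.distrib mult_2 by simp
    also have "\<dots> = (\<Sum>k\<le>n. \<Sum>j\<le>n - k. 2 * c' k j * of_real y ^ k * z ^ j * cnj z ^ (n - k - j))"
      by (intro sum.cong refl) (simp add: c'_def algebra_simps)
    finally have "2 * complex_of_real (Q y z) = (\<Sum>k\<le>n. \<Sum>j\<le>n - k. 2 * c' k j * of_real y ^ k * z ^ j * cnj z ^ (n - k - j))" .
    then show "complex_of_real (Q y z) = (\<Sum>k\<le>n. \<Sum>j\<le>n - k. c' k j * of_real y ^ k * z ^ j * cnj z ^ (n - k - j))"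
      by (simp add: mult.assoc flip: sum_distrib_left)
  qed
qed

section \<open>Tangency of weighted homogeneous fields\<close>

lemma weight_eq_iff:
  fixes d a b k :: nat
  assumes "d > 0"
  shows "(real a + real b) / real d + real k = real n / real d \<longleftrightarrow> a + b + k * d = n"
proof -
  have "(real a + real b) / real d + real k = real n / real d \<longleftrightarrow> real (a + b + k * d) = real n"
    using assms by (simp add: field_simps)
  then show ?thesis by (simp only: of_nat_eq_iff)
qed

lemma weighted_homogeneous_1:
  assumes "d > 0" "weighted_homogeneous d 1 f"
  obtains \<gamma> q where "hom2 d q" "\<And>p. f p = \<gamma> * p $ 3 + q (p $ 1) (p $ 2)"
proof -
  obtain c where c: "\<And>p. f p = (\<Sum>(a, b, k) \<in> {(a, b, k). (real a + real b) / real d + real k = 1}.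
                 c a b k * (p $ 1) ^ a * (p $ 2) ^ b * (p $ 3) ^ k)"
    using assms(2) unfolding weighted_homogeneous_def by blast
  have S: "{(a, b, k). (real a + real b) / real d + real k = 1} = insert (0, 0, 1) ((\<lambda>j. (j, d - j, 0)) ` {..d})"
  proof (intro set_eqI, clarify)
    fix a b k :: nat
    have "(real a + real b) / real d + real k = 1 \<longleftrightarrow> a + b + k * d = d"
      using weight_eq_iff[of d a b k d] assms(1) by simp
    also have "\<dots> \<longleftrightarrow> (k = 0 \<and> a + b = d) \<or> (k = 1 \<and> a = 0 \<and> b = 0)"
    proof (cases "k \<ge> 2")
      case True
      then have "2 * d \<le> k * d" by simp
      then have "a + b + k * d \<noteq> d" using assms(1) by linarith
      with True show ?thesis by simp
    next
      case False
      then have "k = 0 \<or> k = 1" by auto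
      then show ?thesis by auto
    qed
    also have "\<dots> \<longleftrightarrow> (a, b, k) \<in> insert (0, 0, 1) ((\<lambda>j. (j, d - j, 0)) ` {..d})"
      by (auto simp: image_iff)
    finally show "(a, b, k) \<in> {(a, b, k). (real a + real b) / real d + real k = 1} \<longleftrightarrow>
      (a, b, k) \<in> insert (0, 0, 1) ((\<lambda>j. (j, d - j, 0)) ` {..d})" by simp
  qed
  show thesis
  proof
    show "hom2 d (\<lambda>x z. \<Sum>j\<le>d. c j (d - j) 0 * x ^ j * z ^ (d - j))"
      by (rule hom2I) (rule refl)
    fix p :: "complex ^ 3"
    have "inj_on (\<lambda>j. (j, d - j, 0::nat)) {..d}" by (auto simp: inj_on_def)
    then show "f p = c 0 0 1 * p $ 3 + (\<Sum>j\<le>d. c j (d - j) 0 * (p $ 1) ^ j * (p $ 2) ^ (d - j))"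
      unfolding c S by (subst sum.insert) (auto simp: sum.reindex)
  qed
qed

text \<open>After multiplication by \<open>d\<close> the weight condition reads
  \<open>a + b + k * d = 2 * d - 1\<close>, so \<open>k \<le> 1\<close>: there is a part linear in
  \<open>w\<close> with a form of degree \<open>d - 1\<close>, and a part without \<open>w\<close>
  of degree \<open>2 * d - 1\<close>.\<close>

lemma weighted_homogeneous_2:
  assumes d: "d > 1" and "weighted_homogeneous d (2 - 1 / real d) f"
  obtains G h where "hom2 (d - 1) G" "hom2 (2 * d - 1) h" "\<And>p. f p = p $ 3 * G (p $ 1) (p $ 2) + h (p $ 1) (p $ 2)"
proof -
  obtain c where c: "\<And>p. f p = (\<Sum>(a, b, k) \<in> {(a, b, k). (real a + real b) / real d + real k = 2 - 1 / real d}.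
                 c a b k * (p $ 1) ^ a * (p $ 2) ^ b * (p $ 3) ^ k)"
    using assms(2) unfolding weighted_homogeneous_def by blast
  have S: "{(a, b, k). (real a + real b) / real d + real k = 2 - 1 / real d}
     = (\<lambda>j. (j, d - 1 - j, 1)) ` {..d - 1} \<union> (\<lambda>j. (j, 2 * d - 1 - j, 0)) ` {..2 * d - 1}"
  proof (intro set_eqI, clarify)
    fix a b k :: nat
    have "2 - 1 / real d = real (2 * d - 1) / real d" using d by (simp add: field_simps of_nat_diff)
    then have "(real a + real b) / real d + real k = 2 - 1 / real d \<longleftrightarrow> a + b + k * d = 2 * d - 1"
      using weight_eq_iff[of d a b k "2 * d - 1"] d by simp
    also have "\<dots> \<longleftrightarrow> (k = 1 \<and> a + b = d - 1) \<or> (k = 0 \<and> a + b = 2 * d - 1)"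
    proof (cases "k \<ge> 2")
      case True
      then have "2 * d \<le> k * d" by simp
      then have "a + b + k * d \<noteq> 2 * d - 1" using d by linarith
      with True show ?thesis by simp
    next
      case False
      then have "k = 0 \<or> k = 1" by auto
      then show ?thesis using d by auto
    qed
    also have "\<dots> \<longleftrightarrow> (a, b, k) \<in> (\<lambda>j. (j, d - 1 - j, 1)) ` {..d - 1} \<union> (\<lambda>j. (j, 2 * d - 1 - j, 0)) ` {..2 * d - 1}"
      by (auto simp: image_iff)
    finally show "(a, b, k) \<in> {(a, b, k). (real a + real b) / real d + real k = 2 - 1 / real d} \<longleftrightarrow>
      (a, b, k) \<in> (\<lambda>j. (j, d - 1 - j, 1)) ` {..d - 1} \<union> (\<lambda>j. (j, 2 * d - 1 - j, 0)) ` {..2 * d - 1}" by simp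
  qed
  show thesis
  proof
    show "hom2 (d - 1) (\<lambda>x z. \<Sum>j\<le>d - 1. c j (d - 1 - j) 1 * x ^ j * z ^ (d - 1 - j))"
      by (rule hom2I) (rule refl)
    show "hom2 (2 * d - 1) (\<lambda>x z. \<Sum>j\<le>2 * d - 1. c j (2 * d - 1 - j) 0 * x ^ j * z ^ (2 * d - 1 - j))"
      by (rule hom2I) (rule refl)
    fix p :: "complex ^ 3"
    have "inj_on (\<lambda>j. (j, d - 1 - j, 1::nat)) {..d - 1}" "inj_on (\<lambda>j. (j, 2 * d - 1 - j, 0::nat)) {..2 * d - 1}"
      by (auto simp: inj_on_def)
    then show "f p = p $ 3 * (\<Sum>j\<le>d - 1. c j (d - 1 - j) 1 * (p $ 1) ^ j * (p $ 2) ^ (d - 1 - j))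
        + (\<Sum>j\<le>2 * d - 1. c j (2 * d - 1 - j) 0 * (p $ 1) ^ j * (p $ 2) ^ (2 * d - 1 - j))"
      unfolding c S by (subst sum.union_disjoint) (auto simp: sum.reindex sum_distrib_left mult_ac)
  qed
qed

text \<open>The Wirtinger sum is the complex-linear part of the real differential, evaluated on the
  field. Hence tangency of the real part is \<open>D (X p) = 0\<close>, and complex tangency demands
  \<open>D (\<i> *s X p) = 0\<close> in addition.\<close>

lemma vf_apply_eq:
  fixes X :: "complex ^ 'n \<Rightarrow> complex ^ 'n"
  assumes D: "(\<rho> has_derivative D) (at p)"
  shows "vf_apply X \<rho> p = (of_real (D (X p)) - \<i> * of_real (D (\<i> *s X p))) / 2"
proof -
  have fd: "frechet_derivative \<rho> (at p) = D"
    using D by (rule frechet_derivative_at[symmetric])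
  have lin: "linear D" using D by (rule has_derivative_linear)
  have ax: "D (axis j x) = Re x * D (axis j 1) + Im x * D (axis j \<i>)" for j x
  proof -
    have "axis j x = Re x *\<^sub>R axis j (1::complex) + Im x *\<^sub>R axis j \<i>"
      by (simp add: vec_eq_iff axis_def complex_eq_iff)
    then show ?thesis
      by (simp add: linear_add[OF lin] linear_cmul[OF lin])
  qed
  have DX: "D v = (\<Sum>j\<in>UNIV. Re (v $ j) * D (axis j 1) + Im (v $ j) * D (axis j \<i>))" for v
  proof -
    have "v = (\<Sum>j\<in>UNIV. axis j (v $ j))"
      by (simp add: vec_eq_iff axis_def)
    then have "D v = (\<Sum>j\<in>UNIV. D (axis j (v $ j)))"
      by (metis linear_sum[OF lin])
    also have "\<dots> = (\<Sum>j\<in>UNIV. Re (v $ j) * D (axis j 1) + Im (v $ j) * D (axis j \<i>))"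
      by (rule sum.cong[OF refl]) (rule ax)
    finally show ?thesis .
  qed
  have t: "x * ((of_real A - \<i> * of_real B) / 2)
      = of_real (Re x * A + Im x * B) / 2 - \<i> * of_real (Re (\<i> * x) * A + Im (\<i> * x) * B) / 2" for x A B
    by (simp add: complex_eq_iff add_divide_distrib diff_divide_distrib)
  show ?thesis
    unfolding vf_apply_def wirtinger_def fd t
    by (simp only: DX[of "X p"] DX[of "\<i> *s X p"] vector_smult_component diff_divide_distrib sum_subtractf of_real_sum
        sum_distrib_left sum_divide_distrib)
qed

section \<open>The differential of a real homogeneous polynomial\<close>

definition mono_deriv :: "nat \<Rightarrow> nat \<Rightarrow> complex \<Rightarrow> complex \<Rightarrow> complex \<Rightarrow> complex \<Rightarrow> complex" where
  "mono_deriv a b z1 z2 v1 v2 = of_nat a * z1 ^ (a - 1) * v1 * z2 ^ b + of_nat b * z1 ^ a * z2 ^ (b - 1) * v2"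

lemma has_derivative_mono:
  "((\<lambda>p. fst p ^ a * snd p ^ b) has_derivative (\<lambda>v. mono_deriv a b z1 z2 (fst v) (snd v))) (at (z1, z2))"
  unfolding mono_deriv_def
  by (auto intro!: derivative_eq_intros simp: mult_ac)

definition multi_indices :: "nat \<Rightarrow> (nat \<times> nat \<times> nat \<times> nat) set" where
  "multi_indices d = {(a1, a2, b1, b2). a1 + a2 + b1 + b2 = d}"

lemma finite_multi_indices: "finite (multi_indices d)"
  by (rule finite_subset[of _ "{..d} \<times> {..d} \<times> {..d} \<times> {..d}"]) (auto simp: multi_indices_def)

locale homogeneous_polynomial =
  fixes d :: nat and P :: "complex \<Rightarrow> complex \<Rightarrow> real" and c :: "nat \<Rightarrow> nat \<Rightarrow> nat \<Rightarrow> nat \<Rightarrow> complex"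
  assumes coeffs: "homogeneous_poly_with_coeffs d c P"
begin

lemma P_eq: "complex_of_real (P z1 z2) = (\<Sum>(a1, a2, b1, b2) \<in> multi_indices d.
    c a1 a2 b1 b2 * z1 ^ a1 * z2 ^ a2 * cnj z1 ^ b1 * cnj z2 ^ b2)"
  using coeffs by (simp add: homogeneous_poly_with_coeffs_def multi_indices_def)

text \<open>Twice the \<open>(1,0)\<close>-part of the differential of \<open>P\<close>.\<close>

definition dP10 :: "complex \<Rightarrow> complex \<Rightarrow> complex \<Rightarrow> complex \<Rightarrow> complex" where
  "dP10 z1 z2 v1 v2 = (\<Sum>(a1, a2, b1, b2) \<in> multi_indices d.
     c a1 a2 b1 b2 * mono_deriv a1 a2 z1 z2 v1 v2 * (cnj z1 ^ b1 * cnj z2 ^ b2)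
     + cnj (c a1 a2 b1 b2) * mono_deriv b1 b2 z1 z2 v1 v2 * (cnj z1 ^ a1 * cnj z2 ^ a2))"

definition dP :: "complex \<Rightarrow> complex \<Rightarrow> complex \<Rightarrow> complex \<Rightarrow> real" where
  "dP z1 z2 v1 v2 = Re (dP10 z1 z2 v1 v2)"

lemma P_has_derivative:
  "((\<lambda>p. P (fst p) (snd p)) has_derivative (\<lambda>v. dP z1 z2 (fst v) (snd v))) (at (z1, z2))"
proof -
  let ?D = "\<lambda>(a1, a2, b1, b2) v. c a1 a2 b1 b2 * (mono_deriv a1 a2 z1 z2 (fst v) (snd v) * cnj (z1 ^ b1 * z2 ^ b2)
        + (z1 ^ a1 * z2 ^ a2) * cnj (mono_deriv b1 b2 z1 z2 (fst v) (snd v)))"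
  have D: "((\<lambda>p. \<Sum>(a1, a2, b1, b2) \<in> multi_indices d.
      c a1 a2 b1 b2 * ((fst p ^ a1 * snd p ^ a2) * cnj (fst p ^ b1 * snd p ^ b2)))
    has_derivative (\<lambda>v. \<Sum>i \<in> multi_indices d. ?D i v)) (at (z1, z2))"
  proof (rule has_derivative_sum)
    fix i assume "i \<in> multi_indices d"
    obtain a1 a2 b1 b2 where i: "i = (a1, a2, b1, b2)" by (cases i)
    have "((\<lambda>p. c a1 a2 b1 b2 * ((fst p ^ a1 * snd p ^ a2) * cnj (fst p ^ b1 * snd p ^ b2)))
      has_derivative ?D (a1, a2, b1, b2)) (at (z1, z2))"
      by (rule has_derivative_eq_rhs[OF has_derivative_mult_right[OF has_derivative_mult[OF has_derivative_mono
            bounded_linear.has_derivative[OF bounded_linear_cnj has_derivative_mono]]]])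
         (simp add: fun_eq_iff algebra_simps)
    then show "((\<lambda>p. case i of (a1, a2, b1, b2) \<Rightarrow>
        c a1 a2 b1 b2 * ((fst p ^ a1 * snd p ^ a2) * cnj (fst p ^ b1 * snd p ^ b2)))
      has_derivative ?D i) (at (z1, z2))"
      unfolding i by simp
  qed
  have eq: "P (fst p) (snd p) = Re (\<Sum>(a1, a2, b1, b2) \<in> multi_indices d.
      c a1 a2 b1 b2 * ((fst p ^ a1 * snd p ^ a2) * cnj (fst p ^ b1 * snd p ^ b2)))" for p
    using arg_cong[OF P_eq[of "fst p" "snd p"], of Re]
    by (simp only: Re_complex_of_real mult.assoc complex_cnj_mult complex_cnj_power)
  have "((\<lambda>p. P (fst p) (snd p)) has_derivative (\<lambda>v. Re (\<Sum>i \<in> multi_indices d. ?D i v))) (at (z1, z2))"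
    unfolding eq by (rule bounded_linear.has_derivative[OF bounded_linear_Re D])
  moreover have "Re (\<Sum>i \<in> multi_indices d. ?D i v) = dP z1 z2 (fst v) (snd v)" for v
  proof -
    have "Re (?D i v) = Re ((\<lambda>(a1, a2, b1, b2). c a1 a2 b1 b2 * mono_deriv a1 a2 z1 z2 (fst v) (snd v) * (cnj z1 ^ b1 * cnj z2 ^ b2)
        + cnj (c a1 a2 b1 b2) * mono_deriv b1 b2 z1 z2 (fst v) (snd v) * (cnj z1 ^ a1 * cnj z2 ^ a2)) i)" for i
    proof -
      obtain a1 a2 b1 b2 where i: "i = (a1, a2, b1, b2)" by (cases i)
      \<comment> \<open>Only the real part matters, so the antilinear half may be replaced by its
        conjugate; this makes the whole expression complex-linear in \<open>v\<close>.\<close>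
      have "Re (c a1 a2 b1 b2 * ((z1 ^ a1 * z2 ^ a2) * cnj (mono_deriv b1 b2 z1 z2 (fst v) (snd v))))
        = Re (cnj (c a1 a2 b1 b2 * ((z1 ^ a1 * z2 ^ a2) * cnj (mono_deriv b1 b2 z1 z2 (fst v) (snd v)))))"
        by (simp only: cnj.sel)
      also have "cnj (c a1 a2 b1 b2 * ((z1 ^ a1 * z2 ^ a2) * cnj (mono_deriv b1 b2 z1 z2 (fst v) (snd v))))
        = cnj (c a1 a2 b1 b2) * mono_deriv b1 b2 z1 z2 (fst v) (snd v) * (cnj z1 ^ a1 * cnj z2 ^ a2)"
        by simp
      finally show ?thesis
        unfolding i prod.case distrib_left plus_complex.sel by (simp add: mult.assoc)
    qed
    then show ?thesis
      unfolding dP_def dP10_def Re_sum by (intro sum.cong refl)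
  qed
  ultimately show ?thesis by simp
qed

lemma dP10_linear: "dP10 z1 z2 (a * v1 + b * w1) (a * v2 + b * w2) = a * dP10 z1 z2 v1 v2 + b * dP10 z1 z2 w1 w2"
  unfolding dP10_def sum_distrib_left sum.distrib[symmetric] mono_deriv_def
  by (rule sum.cong[OF refl]) (auto simp: algebra_simps)

lemma P_scale: "P (of_real t * z1) (of_real t * z2) = t ^ d * P z1 z2"
proof -
  have "complex_of_real (P (of_real t * z1) (of_real t * z2)) = of_real (t ^ d * P z1 z2)"
    unfolding P_eq of_real_mult sum_distrib_left
  proof (rule sum.cong[OF refl], clarify)
    fix a1 a2 b1 b2 assume "(a1, a2, b1, b2) \<in> multi_indices d"
    then have "d = a1 + a2 + b1 + b2" by (simp add: multi_indices_def)
    then show "c a1 a2 b1 b2 * (of_real t * z1) ^ a1 * (of_real t * z2) ^ a2 * cnj (of_real t * z1) ^ b1 * cnj (of_real t * z2) ^ b2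
      = of_real (t ^ d) * (c a1 a2 b1 b2 * z1 ^ a1 * z2 ^ a2 * cnj z1 ^ b1 * cnj z2 ^ b2)"
      by (simp add: power_mult_distrib power_add mult_ac)
  qed
  then show ?thesis using of_real_eq_iff by blast
qed

lemma P_curve:
  assumes "(f has_derivative f') (at x)" "(g has_derivative g') (at x)"
  shows "((\<lambda>x. P (f x) (g x)) has_derivative (\<lambda>v. dP (f x) (g x) (f' v) (g' v))) (at x)"
  using has_derivative_compose[OF has_derivative_Pair[OF assms] P_has_derivative[of "f x" "g x"]]
  by simp

lemma dP_scale: "t * dP (of_real t * z1) (of_real t * z2) v1 v2 = t ^ d * dP z1 z2 v1 v2"
proof -
  have "((\<lambda>p. P (of_real t * fst p) (of_real t * snd p)) has_derivative
     (\<lambda>v. dP (of_real t * z1) (of_real t * z2) (of_real t * fst v) (of_real t * snd v))) (at (z1, z2))"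
    by (rule has_derivative_eq_rhs[OF P_curve]) (auto intro!: derivative_eq_intros)
  moreover have "((\<lambda>p. t ^ d * P (fst p) (snd p)) has_derivative (\<lambda>v. t ^ d * dP z1 z2 (fst v) (snd v))) (at (z1, z2))"
    by (rule has_derivative_mult_right[OF P_has_derivative])
  ultimately have "(\<lambda>v. dP (of_real t * z1) (of_real t * z2) (of_real t * fst v) (of_real t * snd v))
    = (\<lambda>v. t ^ d * dP z1 z2 (fst v) (snd v))"
    unfolding P_scale by (rule has_derivative_unique)
  from fun_cong[OF this, of "(v1, v2)"]
  have "dP (of_real t * z1) (of_real t * z2) (of_real t * v1) (of_real t * v2) = t ^ d * dP z1 z2 v1 v2"
    by simp
  moreover have "dP (of_real t * z1) (of_real t * z2) (of_real t * v1) (of_real t * v2)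
     = t * dP (of_real t * z1) (of_real t * z2) v1 v2"
    unfolding dP_def using dP10_linear[of _ _ "of_real t" v1 0 0 v2 0] by simp
  ultimately show ?thesis by simp
qed

lemma defining_fun_has_derivative:
  "(defining_fun P has_derivative (\<lambda>v. Im (v $ 3) - dP (p $ 1) (p $ 2) (v $ 1) (v $ 2))) (at p)"
proof -
  have nth: "((\<lambda>p. p $ i) has_derivative (\<lambda>v. v $ i)) (at p)" for i :: 3 and p :: "complex ^ 3"
    by (rule bounded_linear_imp_has_derivative[OF bounded_linear_vec_nth])
  show ?thesis
    unfolding defining_fun_def
    by (rule has_derivative_diff[OF bounded_linear.has_derivative[OF bounded_linear_Im nth] P_curve[OF nth nth]])
qed

lemma Re_tangent_iff:
  "Re_tangent_near_0 P X \<longleftrightarrow> (\<forall>\<^sub>F p in nhds 0. p \<in> hypersurface P \<longrightarrow>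
     Im (X p $ 3) = dP (p $ 1) (p $ 2) (X p $ 1) (X p $ 2))"
  unfolding Re_tangent_near_0_def vf_apply_eq[OF defining_fun_has_derivative] by simp

lemma tangentI:
  assumes "\<And>p. Im (X p $ 3) = dP (p $ 1) (p $ 2) (X p $ 1) (X p $ 2)"
    and "\<And>p. Re (X p $ 3) = dP (p $ 1) (p $ 2) (\<i> * X p $ 1) (\<i> * X p $ 2)"
  shows "tangent_near_0 P X"
  unfolding tangent_near_0_def vf_apply_eq[OF defining_fun_has_derivative]
  using assms by simp

end

definition cvec3 :: "complex \<Rightarrow> complex \<Rightarrow> complex \<Rightarrow> complex ^ 3" where
  "cvec3 a b c = (\<chi> i. if i = 1 then a else if i = 2 then b else c)"

lemma cvec3_nth [simp]: "cvec3 a b c $ 1 = a" "cvec3 a b c $ 2 = b" "cvec3 a b c $ 3 = c"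
  by (simp_all add: cvec3_def)

lemma mono_deriv_scale:
  assumes "a + b \<ge> 1"
  shows "mono_deriv a b (t * z1) (t * z2) (s * v1) (s * v2) = t ^ (a + b - 1) * s * mono_deriv a b z1 z2 v1 v2"
  using assms unfolding mono_deriv_def
  by (cases a; cases b) (simp_all add: power_mult_distrib power_add algebra_simps)

lemma mono_deriv_0 [simp]: "mono_deriv 0 0 z1 z2 v1 v2 = 0"
  by (simp add: mono_deriv_def)

context homogeneous_polynomial
begin

text \<open>The dilation \<open>(z, w) \<mapsto> (t z, t ^ d w)\<close> with \<open>t > 0\<close>
  preserves the hypersurface and multiplies both sides of the tangency equation by
  \<open>t ^ (2 * d - 1)\<close>. An equation valid near 0 therefore holds at every point of the
  hypersurface.\<close>

lemma global_tangency:
  assumes tang: "Re_tangent_near_0 P X" and d: "d \<ge> 1"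
    and X: "\<And>p. X p $ 1 = \<gamma>1 * p $ 3 + q1 (p $ 1) (p $ 2)" "\<And>p. X p $ 2 = \<gamma>2 * p $ 3 + q2 (p $ 1) (p $ 2)"
      "\<And>p. X p $ 3 = p $ 3 * G (p $ 1) (p $ 2) + h (p $ 1) (p $ 2)"
    and hom: "hom2 d q1" "hom2 d q2" "hom2 (d - 1) G" "hom2 (2 * d - 1) h"
    and w: "Im w = P z1 z2"
  shows "Im (w * G z1 z2 + h z1 z2) = dP z1 z2 (\<gamma>1 * w + q1 z1 z2) (\<gamma>2 * w + q2 z1 z2)"
proof -
  define \<pi> where "\<pi> t = cvec3 (of_real t * z1) (of_real t * z2) (of_real (t ^ d) * w)" for t :: real
  have "(\<pi> \<longlongrightarrow> 0) (at_right 0)"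
  proof (rule vec_tendstoI)
    have 0: "((\<lambda>t. of_real t :: complex) \<longlongrightarrow> 0) (at_right 0)"
      using tendsto_of_real[OF tendsto_ident_at[of 0 "{0<..}"]] by simp
    then have 1: "((\<lambda>t. of_real (t ^ d) :: complex) \<longlongrightarrow> 0) (at_right 0)"
      using tendsto_power[OF 0, of d] d by (simp add: power_0_left)
    fix i :: 3
    show "((\<lambda>t. \<pi> t $ i) \<longlongrightarrow> 0 $ i) (at_right 0)"
      using exhaust_3[of i] tendsto_mult_right[OF 0, of z1] tendsto_mult_right[OF 0, of z2] tendsto_mult_right[OF 1, of w]
      by (auto simp: \<pi>_def)
  qed
  then have "\<forall>\<^sub>F t in at_right 0. \<pi> t \<in> hypersurface P \<longrightarrow>
     Im (X (\<pi> t) $ 3) = dP (\<pi> t $ 1) (\<pi> t $ 2) (X (\<pi> t) $ 1) (X (\<pi> t) $ 2)"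
    using tang unfolding Re_tangent_iff filterlim_iff by blast
  moreover have "\<forall>\<^sub>F t::real in at_right 0. t > 0"
    by (rule eventually_at_right_less)
  ultimately have "\<forall>\<^sub>F t::real in at_right 0. t > 0 \<and> (\<pi> t \<in> hypersurface P \<longrightarrow>
     Im (X (\<pi> t) $ 3) = dP (\<pi> t $ 1) (\<pi> t $ 2) (X (\<pi> t) $ 1) (X (\<pi> t) $ 2))"
    by eventually_elim simp
  then obtain t :: real where t: "t > 0" and eq: "\<pi> t \<in> hypersurface P \<longrightarrow>
     Im (X (\<pi> t) $ 3) = dP (\<pi> t $ 1) (\<pi> t $ 2) (X (\<pi> t) $ 1) (X (\<pi> t) $ 2)"
    using eventually_happens'[OF trivial_limit_at_right_real] by blast
  define T where "T = complex_of_real t"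
  have Td: "T ^ (2 * d - 1) = T ^ d * T ^ (d - 1)" using d by (simp flip: power_add add: mult_2)
  have "\<pi> t \<in> hypersurface P"
    using w by (simp add: hypersurface_def \<pi>_def P_scale)
  with eq have "Im (T ^ d * w * G (T * z1) (T * z2) + h (T * z1) (T * z2))
     = dP (T * z1) (T * z2) (\<gamma>1 * (T ^ d * w) + q1 (T * z1) (T * z2)) (\<gamma>2 * (T ^ d * w) + q2 (T * z1) (T * z2))"
    by (simp add: X \<pi>_def T_def)
  also have "T ^ d * w * G (T * z1) (T * z2) + h (T * z1) (T * z2) = of_real (t ^ (2 * d - 1)) * (w * G z1 z2 + h z1 z2)"
    unfolding hom2_scale[OF hom(3)] hom2_scale[OF hom(4)] of_real_power T_def[symmetric] Td
    by (simp add: algebra_simps)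
  also have "\<gamma>1 * (T ^ d * w) + q1 (T * z1) (T * z2) = T ^ d * (\<gamma>1 * w + q1 z1 z2) + 0 * 0"
    unfolding hom2_scale[OF hom(1)] by (simp add: algebra_simps)
  also have "\<gamma>2 * (T ^ d * w) + q2 (T * z1) (T * z2) = T ^ d * (\<gamma>2 * w + q2 z1 z2) + 0 * 0"
    unfolding hom2_scale[OF hom(2)] by (simp add: algebra_simps)
  finally have "t ^ (2 * d - 1) * Im (w * G z1 z2 + h z1 z2)
     = t ^ d * dP (T * z1) (T * z2) (\<gamma>1 * w + q1 z1 z2) (\<gamma>2 * w + q2 z1 z2)"
    unfolding dP_def dP10_linear Im_of_real_mult
    by (simp add: Re_of_real_mult T_def flip: of_real_power)
  then have K: "t * (t ^ (2 * d - 1) * Im (w * G z1 z2 + h z1 z2))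
     = t ^ d * (t * dP (T * z1) (T * z2) (\<gamma>1 * w + q1 z1 z2) (\<gamma>2 * w + q2 z1 z2))" by simp
  have M: "t * (t ^ (2 * d - 1) * x) = t ^ d * (t ^ d * x)" for x
  proof -
    have "t ^ d * t ^ d = t * t ^ (2 * d - 1)" using d by (simp flip: power_add power_Suc add: mult_2)
    then show ?thesis by (metis mult.assoc)
  qed
  show ?thesis using K unfolding M T_def dP_scale using t by simp
qed

text \<open>Over fixed \<open>z\<close> the points of the hypersurface are
  \<open>w = u + \<i> * P\<close> with \<open>u\<close> real and arbitrary. The equation is affine
  in \<open>u\<close>, so its two coefficients can be compared separately.\<close>

lemma tangency_components:
  assumes tang: "\<And>w. Im w = P z1 z2 \<Longrightarrow> Im (w * g + h) = dP z1 z2 (\<gamma>1 * w + q1) (\<gamma>2 * w + q2)"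
  shows "Im g = dP z1 z2 \<gamma>1 \<gamma>2"
    and "P z1 z2 * Re g + Im h = P z1 z2 * dP z1 z2 (\<i> * \<gamma>1) (\<i> * \<gamma>2) + dP z1 z2 q1 q2"
proof -
  let ?p = "P z1 z2"
  have lin: "dP z1 z2 (x * v1 + y * w1 + r1) (x * v2 + y * w2 + r2)
      = Re (x * dP10 z1 z2 v1 v2 + y * dP10 z1 z2 w1 w2 + dP10 z1 z2 r1 r2)" for x y v1 w1 v2 w2 r1 r2
    using dP10_linear[of z1 z2 1 "x * v1 + y * w1" 1 r1 "x * v2 + y * w2" r2]
    by (simp add: dP_def dP10_linear)
  have u: "u * Im g + ?p * Re g + Im h
     = u * dP z1 z2 \<gamma>1 \<gamma>2 + ?p * dP z1 z2 (\<i> * \<gamma>1) (\<i> * \<gamma>2) + dP z1 z2 q1 q2" for u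
  proof -
    define w where "w = of_real u + \<i> * of_real ?p"
    have g: "\<gamma> * w + q = of_real u * \<gamma> + of_real ?p * (\<i> * \<gamma>) + q" for \<gamma> q by (simp add: w_def algebra_simps)
    have "Im (w * g + h) = dP z1 z2 (\<gamma>1 * w + q1) (\<gamma>2 * w + q2)"
      by (rule tang) (simp add: w_def)
    then show ?thesis unfolding g lin by (simp add: w_def dP_def)
  qed
  show "Im g = dP z1 z2 \<gamma>1 \<gamma>2" using u[of 0] u[of 1] by simp
  show "?p * Re g + Im h = ?p * dP z1 z2 (\<i> * \<gamma>1) (\<i> * \<gamma>2) + dP z1 z2 q1 q2" using u[of 0] by simp
qed

text \<open>Replacing \<open>z\<close> by \<open>t z\<close> with \<open>|t| = 1\<close> separates the bidegrees: all terms of \<open>q\<close> applied to \<open>P\<close>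
  have positive frequency below \<open>2d - 1\<close>, and \<open>h\<close> has frequency \<open>2d - 1\<close>.\<close>

lemma rigid_tangency_trivial:
  assumes d: "d \<ge> 1" and np: "no_pluriharmonic_terms d c"
    and eq: "\<And>z1 z2. dP z1 z2 (q1 z1 z2) (q2 z1 z2) = Im (h z1 z2)"
    and hom: "hom2 d q1" "hom2 d q2" "hom2 (2 * d - 1) h"
  shows "dP10 z1 z2 (q1 z1 z2) (q2 z1 z2) = 0" and "h z1 z2 = 0"
proof -
  define A where "A = (\<lambda>(a1, a2, b1, b2). c a1 a2 b1 b2 * mono_deriv a1 a2 z1 z2 (q1 z1 z2) (q2 z1 z2) * (cnj z1 ^ b1 * cnj z2 ^ b2))"
  define B where "B = (\<lambda>(a1, a2, b1, b2). cnj (c a1 a2 b1 b2) * mono_deriv b1 b2 z1 z2 (q1 z1 z2) (q2 z1 z2) * (cnj z1 ^ a1 * cnj z2 ^ a2))"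
  \<comment> \<open>Differentiating a monomial with \<open>a\<close> holomorphic and
    \<open>b\<close> conjugate factors gives frequency \<open>a - 1 - b\<close>, and
    \<open>q\<close> adds \<open>d = a + b\<close>, in total \<open>2 * a - 1\<close>. For
    \<open>a = 0\<close> the truncated value is 0, but then the coefficient \<open>A\<close> is
    zero.\<close>
  define k where "k = (\<lambda>(a1 :: nat, a2 :: nat, b1 :: nat, b2 :: nat). 2 * (a1 + a2) - 1)"
  define k' where "k' = (\<lambda>(a1 :: nat, a2 :: nat, b1 :: nat, b2 :: nat). 2 * (b1 + b2) - 1)"
  define H where "H = (\<Sum>i\<in>multi_indices d. monom (A i) (k i) + monom (B i) (k' i))"
  define p where "p = H + monom (\<i> * h z1 z2) (2 * d - 1)"
  have t: "dP10 (t * z1) (t * z2) (t ^ d * q1 z1 z2) (t ^ d * q2 z1 z2) = poly H t" if t: "norm t = 1" for t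
  proof -
    have tt: "t * cnj t = 1" using t by (simp add: complex_norm_square[symmetric])
    have P: "t ^ (x + y) * cnj t ^ y = t ^ x" for x y
    proof -
      have "t ^ (x + y) * cnj t ^ y = t ^ x * (t * cnj t) ^ y"
        by (simp only: power_add power_mult_distrib mult.assoc)
      then show ?thesis unfolding tt by simp
    qed
    have M: "mono_deriv a1 a2 (t * z1) (t * z2) (t ^ d * v1) (t ^ d * v2) * (cnj (t * z1) ^ b1 * cnj (t * z2) ^ b2)
       = mono_deriv a1 a2 z1 z2 v1 v2 * (cnj z1 ^ b1 * cnj z2 ^ b2) * t ^ (2 * (a1 + a2) - 1)"
      if "a1 + a2 + b1 + b2 = d" for a1 a2 b1 b2 v1 v2
    proof (cases "a1 + a2 = 0")
      case False
      then have "a1 + a2 \<ge> 1" by linarith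
      have "t ^ (a1 + a2 - 1) * t ^ d * (cnj t ^ b1 * cnj t ^ b2) = t ^ ((2 * (a1 + a2) - 1) + (b1 + b2)) * cnj t ^ (b1 + b2)"
        unfolding power_add[symmetric] using False that by (intro arg_cong2[of _ _ _ _ "(*)"] arg_cong[of _ _ "\<lambda>n. t ^ n"]) auto
      also have "\<dots> = t ^ (2 * (a1 + a2) - 1)" by (rule P)
      finally show ?thesis
        unfolding mono_deriv_scale[OF \<open>a1 + a2 \<ge> 1\<close>] by (simp add: power_mult_distrib mult_ac)
    qed simp
    show ?thesis
      unfolding dP10_def H_def poly_sum
    proof (rule sum.cong[OF refl])
      fix i assume i: "i \<in> multi_indices d"
      obtain a1 a2 b1 b2 where i': "i = (a1, a2, b1, b2)" by (cases i)
      have s: "a1 + a2 + b1 + b2 = d" "b1 + b2 + a1 + a2 = d" using i by (simp_all add: i' multi_indices_def)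
      show "(case i of (a1, a2, b1, b2) \<Rightarrow>
          c a1 a2 b1 b2 * mono_deriv a1 a2 (t * z1) (t * z2) (t ^ d * q1 z1 z2) (t ^ d * q2 z1 z2) * (cnj (t * z1) ^ b1 * cnj (t * z2) ^ b2)
          + cnj (c a1 a2 b1 b2) * mono_deriv b1 b2 (t * z1) (t * z2) (t ^ d * q1 z1 z2) (t ^ d * q2 z1 z2) * (cnj (t * z1) ^ a1 * cnj (t * z2) ^ a2))
        = poly (monom (A i) (k i) + monom (B i) (k' i)) t"
        unfolding i' prod.case A_def B_def k_def k'_def poly_add poly_monom mult.assoc[of "c a1 a2 b1 b2"] mult.assoc[of "cnj (c a1 a2 b1 b2)"]
          M[OF s(1)] M[OF s(2)] by (simp add: mult_ac)
    qed
  qed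
  have "p = 0"
  proof (rule poly_eq_0_if_Re_zero_on_circle)
    fix t :: complex assume n: "norm t = 1"
    have "Re (poly H t) = Im (t ^ (2 * d - 1) * h z1 z2)"
      using eq[of "t * z1" "t * z2"]
      unfolding hom2_scale[OF hom(1)] hom2_scale[OF hom(2)] hom2_scale[OF hom(3)] dP_def t[OF n] .
    then show "Re (poly p t) = 0"
      by (simp add: p_def poly_monom mult_ac)
  next
    have "coeff H 0 = 0"
      unfolding H_def coeff_sum
    proof (rule sum.neutral, rule ballI)
      fix i assume "i \<in> multi_indices d"
      obtain a1 a2 b1 b2 where i': "i = (a1, a2, b1, b2)" by (cases i)
      have "A i = 0" if "2 * (a1 + a2) - 1 = 0"
      proof -
        have "a1 = 0" "a2 = 0" using that by presburger+
        then show ?thesis by (simp add: A_def i')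
      qed
      moreover have "B i = 0" if "2 * (b1 + b2) - 1 = 0"
      proof -
        have "b1 = 0" "b2 = 0" using that by presburger+
        then show ?thesis by (simp add: B_def i')
      qed
      ultimately show "coeff (monom (A i) (k i) + monom (B i) (k' i)) 0 = 0"
        by (simp add: k_def k'_def i')
    qed
    then show "coeff p 0 = 0" using d by (simp add: p_def)
  qed
  have "coeff H (2 * d - 1) = 0"
    unfolding H_def coeff_sum
  proof (rule sum.neutral, rule ballI)
    fix i assume i: "i \<in> multi_indices d"
    obtain a1 a2 b1 b2 where i': "i = (a1, a2, b1, b2)" by (cases i)
    have s: "a1 + a2 + b1 + b2 = d" using i by (simp_all add: i' multi_indices_def)
    \<comment> \<open>Only a monomial of full degree \<open>d\<close> in \<open>z\<close> reaches
      this frequency, and such monomials are pluriharmonic. So nothing can compensate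
      \<open>h\<close>.\<close>
    have "A i = 0" if "2 * (a1 + a2) - 1 = 2 * d - 1"
    proof -
      have "a1 + a2 = d" "b1 = 0" "b2 = 0" using that s d by auto
      then show ?thesis using np by (simp add: A_def i' no_pluriharmonic_terms_def)
    qed
    moreover have "B i = 0" if "2 * (b1 + b2) - 1 = 2 * d - 1"
    proof -
      have "b1 + b2 = d" "a1 = 0" "a2 = 0" using that s d by auto
      then show ?thesis using np by (simp add: B_def i' no_pluriharmonic_terms_def)
    qed
    ultimately show "coeff (monom (A i) (k i) + monom (B i) (k' i)) (2 * d - 1) = 0"
      by (simp add: k_def k'_def i')
  qed
  then show "h z1 z2 = 0" using \<open>p = 0\<close> by (metis add_0 coeff_add coeff_monom coeff_0 complex_i_not_zero mult_eq_0_iff p_def)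
  then have "H = 0" using \<open>p = 0\<close> by (simp add: p_def)
  then show "dP10 z1 z2 (q1 z1 z2) (q2 z1 z2) = 0" using t[of 1] by simp
qed

end

section \<open>Normal form\<close>

lemma hom2_monomial: "i \<le> n \<Longrightarrow> hom2 n (\<lambda>x z. a * x ^ i * z ^ (n - i))"
  by (rule hom2I[of _ "\<lambda>j. if j = i then a else 0"]) (simp add: if_distrib[of "\<lambda>x. x * _"] cong: if_cong)

text \<open>\<open>F\<close> integrates \<open>g\<close> in \<open>x\<close> from 0, and
  \<open>H\<close> is its derivative in \<open>z\<close>. The imaginary part of \<open>F\<close>
  serves to absorb the variation of \<open>P\<close> under real translations along
  \<open>a\<close>.\<close>

lemma hom2_antiderivative:
  assumes "hom2 n g"
  obtains F H where "hom2 (Suc n) F" "hom2 n H"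
    "\<And>x z. ((\<lambda>p. F (fst p) (snd p)) has_derivative (\<lambda>v. g x z * fst v + H x z * snd v)) (at (x, z))"
proof -
  obtain \<alpha> where \<alpha>: "\<And>x z. g x z = (\<Sum>j\<le>n. \<alpha> j * x ^ j * z ^ (n - j))"
    using assms by (rule hom2E) blast
  define F where "F x z = (\<Sum>j\<le>n. \<alpha> j / of_nat (Suc j) * x ^ Suc j * z ^ (n - j))" for x z
  define H where "H x z = (\<Sum>j\<le>n. \<alpha> j / of_nat (Suc j) * of_nat (n - j) * x ^ Suc j * z ^ (n - Suc j))" for x z
  show thesis
  proof
    have "hom2 (Suc n) (\<lambda>x z. \<alpha> j / of_nat (Suc j) * x ^ Suc j * z ^ (n - j))" if "j \<le> n" for j
      using hom2_monomial[of "Suc j" "Suc n" "\<alpha> j / of_nat (Suc j)"] that by simp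
    then show "hom2 (Suc n) F" unfolding F_def by (intro hom2_sum) auto
    have "hom2 n (\<lambda>x z. \<alpha> j / of_nat (Suc j) * of_nat (n - j) * x ^ Suc j * z ^ (n - Suc j))" if "j \<le> n" for j
      using hom2_monomial[of "Suc j" n "\<alpha> j / of_nat (Suc j) * of_nat (n - j)"] hom2_0 that
      by (cases "j = n") auto
    then show "hom2 n H" unfolding H_def by (intro hom2_sum) auto
    fix x z :: complex
    have "((\<lambda>p. \<alpha> j / of_nat (Suc j) * (fst p ^ Suc j * snd p ^ (n - j))) has_derivative
      (\<lambda>v. (\<alpha> j * x ^ j * z ^ (n - j)) * fst v
         + (\<alpha> j / of_nat (Suc j) * of_nat (n - j) * x ^ Suc j * z ^ (n - Suc j)) * snd v)) (at (x, z))" for j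
      by (rule has_derivative_eq_rhs[OF has_derivative_mult_right[OF has_derivative_mono]])
         (simp add: fun_eq_iff mono_deriv_def field_simps del: of_nat_Suc)
    then have "((\<lambda>p. \<Sum>j\<le>n. \<alpha> j / of_nat (Suc j) * (fst p ^ Suc j * snd p ^ (n - j))) has_derivative
      (\<lambda>v. \<Sum>j\<le>n. (\<alpha> j * x ^ j * z ^ (n - j)) * fst v
         + (\<alpha> j / of_nat (Suc j) * of_nat (n - j) * x ^ Suc j * z ^ (n - Suc j)) * snd v)) (at (x, z))"
      by (intro has_derivative_sum)
    then show "((\<lambda>p. F (fst p) (snd p)) has_derivative (\<lambda>v. g x z * fst v + H x z * snd v)) (at (x, z))"
      unfolding F_def H_def \<alpha> by (simp only: sum.distrib sum_distrib_right mult.assoc)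
  qed
qed

text \<open>For a real form the derivative in \<open>cnj z\<close> is the conjugate of the one in
  \<open>z\<close>, so the differential is twice a real part.\<close>

lemma zform_has_derivative:
  assumes sym: "\<And>j. j \<le> n \<Longrightarrow> a (n - j) = cnj (a j)"
  shows "((\<lambda>z. Re (zform a n z)) has_derivative (\<lambda>v. 2 * Re (v * zform_deriv a n z))) (at z)"
proof -
  define U where "U = (\<Sum>j\<le>n. a j * z ^ j * (of_nat (n - j) * cnj z ^ (n - j - 1)))"
  have U: "U = cnj (zform_deriv a n z)"
  proof -
    have "cnj (zform_deriv a n z) = (\<Sum>j\<le>n. of_nat j * cnj (a j) * cnj z ^ (j - 1) * z ^ (n - j))"
      by (simp add: zform_deriv_def)
    also have "\<dots> = (\<Sum>j\<le>n. of_nat (n - j) * cnj (a (n - j)) * cnj z ^ (n - j - 1) * z ^ j)"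
      by (rule sum.reindex_bij_witness[of _ "\<lambda>j. n - j" "\<lambda>j. n - j"]) auto
    also have "\<dots> = U"
      unfolding U_def using sym by (intro sum.cong refl) (simp add: mult_ac)
    finally show ?thesis by simp
  qed
  have "((\<lambda>z. a j * z ^ j * cnj z ^ (n - j)) has_derivative
     (\<lambda>v. v * (of_nat j * a j * z ^ (j - 1) * cnj z ^ (n - j))
        + cnj v * (a j * z ^ j * (of_nat (n - j) * cnj z ^ (n - j - 1))))) (at z)" for j
  proof -
    have "((\<lambda>z. z ^ j) has_derivative (\<lambda>v. v * (of_nat j * z ^ (j - 1)))) (at z)"
      by (auto intro!: derivative_eq_intros simp: mult_ac)
    moreover have "((\<lambda>z. cnj z ^ (n - j)) has_derivative (\<lambda>v. cnj v * (of_nat (n - j) * cnj z ^ (n - j - 1)))) (at z)"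
      by (auto intro!: derivative_eq_intros bounded_linear_imp_has_derivative bounded_linear_cnj simp: mult_ac)
    ultimately have "((\<lambda>z. a j * (z ^ j * cnj z ^ (n - j))) has_derivative
      (\<lambda>v. a j * (z ^ j * (cnj v * (of_nat (n - j) * cnj z ^ (n - j - 1))) + v * (of_nat j * z ^ (j - 1)) * cnj z ^ (n - j)))) (at z)"
      by (intro has_derivative_mult_right has_derivative_mult)
    then show ?thesis by (simp add: algebra_simps)
  qed
  then have "(zform a n has_derivative (\<lambda>v. \<Sum>j\<le>n. v * (of_nat j * a j * z ^ (j - 1) * cnj z ^ (n - j))
        + cnj v * (a j * z ^ j * (of_nat (n - j) * cnj z ^ (n - j - 1))))) (at z)"
    unfolding zform_def by (intro has_derivative_sum)
  moreover have "(\<Sum>j\<le>n. v * (of_nat j * a j * z ^ (j - 1) * cnj z ^ (n - j))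
        + cnj v * (a j * z ^ j * (of_nat (n - j) * cnj z ^ (n - j - 1)))) = v * zform_deriv a n z + cnj v * U" for v
    unfolding zform_deriv_def U_def by (simp only: sum.distrib sum_distrib_left)
  ultimately have "(zform a n has_derivative (\<lambda>v. v * zform_deriv a n z + cnj v * U)) (at z)"
    by simp
  from bounded_linear.has_derivative[OF bounded_linear_Re this] show ?thesis
    unfolding U by (simp add: algebra_simps)
qed

lemma tube_function_has_derivative:
  assumes sym: "\<And>k j. k + j \<le> d \<Longrightarrow> c k (d - k - j) = cnj (c k j)"
    and supp: "\<And>k j. k + j > d \<Longrightarrow> c k j = 0"
  shows "((\<lambda>p. \<Sum>k\<le>d. Im (fst p) ^ k * Re (zform (c k) (d - k) (snd p))) has_derivative
    (\<lambda>v. Im (fst v) * (\<Sum>k\<le>d. real (Suc k) * Im x ^ k * Re (zform (c (Suc k)) (d - Suc k) z))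
      + 2 * Re (snd v * (\<Sum>k\<le>d. of_real (Im x ^ k) * zform_deriv (c k) (d - k) z)))) (at (x, z))"
proof -
  let ?y = "Im x"
  have 1: "((\<lambda>p. Im (fst p) ^ k * Re (zform (c k) (d - k) (snd p))) has_derivative
     (\<lambda>v. ?y ^ k * (2 * Re (snd v * zform_deriv (c k) (d - k) z))
        + Im (fst v) * (real k * ?y ^ (k - 1)) * Re (zform (c k) (d - k) z))) (at (x, z))" if "k \<le> d" for k
  proof -
    have "((\<lambda>p::complex \<times> complex. Im (fst p) ^ k) has_derivative (\<lambda>v. Im (fst v) * (real k * ?y ^ (k - 1)))) (at (x, z))"
      by (auto intro!: derivative_eq_intros simp: mult_ac)
    moreover have "((\<lambda>p::complex \<times> complex. Re (zform (c k) (d - k) (snd p))) has_derivative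
       (\<lambda>v. 2 * Re (snd v * zform_deriv (c k) (d - k) z))) (at (x, z))"
    proof (rule has_derivative_compose[of snd snd "(x, z)" UNIV "\<lambda>z. Re (zform (c k) (d - k) z)", simplified])
      show "(snd has_derivative snd) (at (x, z))"
        by (intro bounded_linear_imp_has_derivative bounded_linear_snd)
      show "((\<lambda>z. Re (zform (c k) (d - k) z)) has_derivative (\<lambda>v. 2 * Re (v * zform_deriv (c k) (d - k) z))) (at z)"
        by (rule zform_has_derivative) (use sym that in auto)
    qed
    ultimately show ?thesis
      using has_derivative_mult by fastforce
  qed
  have 2: "(\<Sum>k\<le>d. real k * ?y ^ (k - 1) * Re (zform (c k) (d - k) z))
      = (\<Sum>k\<le>d. real (Suc k) * ?y ^ k * Re (zform (c (Suc k)) (d - Suc k) z))"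
  proof -
    \<comment> \<open>The summand \<open>k = Suc d\<close> added here vanishes by
      \<open>supp\<close>, and the one for \<open>k = 0\<close> by its factor, so the index can be
      shifted.\<close>
    have "(\<Sum>k\<le>d. real k * ?y ^ (k - 1) * Re (zform (c k) (d - k) z))
      = (\<Sum>k\<le>Suc d. real k * ?y ^ (k - 1) * Re (zform (c k) (d - k) z))"
      using supp by (simp add: zform_def)
    also have "\<dots> = (\<Sum>k\<le>d. real (Suc k) * ?y ^ k * Re (zform (c (Suc k)) (d - Suc k) z))"
      by (subst sum.atMost_Suc_shift) simp
    finally show ?thesis .
  qed
  have "((\<lambda>p. \<Sum>k\<le>d. Im (fst p) ^ k * Re (zform (c k) (d - k) (snd p))) has_derivative
     (\<lambda>v. \<Sum>k\<le>d. ?y ^ k * (2 * Re (snd v * zform_deriv (c k) (d - k) z))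
        + Im (fst v) * (real k * ?y ^ (k - 1)) * Re (zform (c k) (d - k) z))) (at (x, z))"
    by (rule has_derivative_sum) (use 1 in auto)
  moreover have "(\<Sum>k\<le>d. ?y ^ k * (2 * Re (snd v * zform_deriv (c k) (d - k) z))
        + Im (fst v) * (real k * ?y ^ (k - 1)) * Re (zform (c k) (d - k) z))
     = Im (fst v) * (\<Sum>k\<le>d. real (Suc k) * ?y ^ k * Re (zform (c (Suc k)) (d - Suc k) z))
      + 2 * Re (snd v * (\<Sum>k\<le>d. of_real (?y ^ k) * zform_deriv (c k) (d - k) z))" for v :: "complex \<times> complex"
  proof -
    have "?y ^ k * (2 * Re (snd v * zform_deriv (c k) (d - k) z)) = 2 * Re (snd v * (of_real (?y ^ k) * zform_deriv (c k) (d - k) z))" for k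
      by (metis Re_of_real_mult mult.left_commute)
    then show ?thesis
      unfolding 2[symmetric] sum.distrib sum_distrib_left Re_sum by (simp only: add.commute mult.assoc)
  qed
  ultimately show ?thesis by simp
qed

section \<open>Holomorphic maps and coordinates adapted to a direction\<close>

definition hol_at :: "(complex ^ 'n \<Rightarrow> complex) \<Rightarrow> complex ^ 'n \<Rightarrow> bool" where
  "hol_at f p \<longleftrightarrow> (\<exists>D. (f has_derivative D) (at p) \<and> (\<forall>c v. D (c *s v) = c * D v))"

lemma hol_at_const: "hol_at (\<lambda>_. a) p"
  unfolding hol_at_def by (intro exI[of _ "\<lambda>_. 0"]) auto

lemma hol_at_nth: "hol_at (\<lambda>p. p $ i) p"
  unfolding hol_at_def
  by (intro exI[of _ "\<lambda>v. v $ i"]) (auto intro: bounded_linear_imp_has_derivative bounded_linear_vec_nth)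

lemma hol_at_add:
  assumes "hol_at f p" "hol_at g p"
  shows "hol_at (\<lambda>p. f p + g p) p"
proof -
  obtain D E where "(f has_derivative D) (at p)" "\<And>c v. D (c *s v) = c * D v"
    "(g has_derivative E) (at p)" "\<And>c v. E (c *s v) = c * E v"
    using assms unfolding hol_at_def by blast
  then show ?thesis
    unfolding hol_at_def by (intro exI[of _ "\<lambda>v. D v + E v"]) (auto intro: has_derivative_add simp: distrib_left)
qed

lemma hol_at_mult:
  assumes "hol_at f p" "hol_at g p"
  shows "hol_at (\<lambda>p. f p * g p) p"
proof -
  obtain D E where "(f has_derivative D) (at p)" "\<And>c v. D (c *s v) = c * D v"
    "(g has_derivative E) (at p)" "\<And>c v. E (c *s v) = c * E v"
    using assms unfolding hol_at_def by blast
  note D = this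
  have "((\<lambda>p. f p * g p) has_derivative (\<lambda>v. f p * E v + D v * g p)) (at p)"
    by (rule has_derivative_mult[OF D(1,3)])
  moreover have "f p * E (c *s v) + D (c *s v) * g p = c * (f p * E v + D v * g p)" for c v
    by (simp add: D(2,4) algebra_simps)
  ultimately show ?thesis
    unfolding hol_at_def by blast
qed

lemma hol_at_diff: "hol_at f p \<Longrightarrow> hol_at g p \<Longrightarrow> hol_at (\<lambda>p. f p - g p) p"
  using hol_at_add[OF _ hol_at_mult[OF hol_at_const[of "- 1"]], of f p g] by simp

lemma hol_at_divide_const: "hol_at f p \<Longrightarrow> hol_at (\<lambda>p. f p / a) p"
  using hol_at_mult[OF _ hol_at_const[of "1 / a"], of f p] by simp

lemma hol_at_power: "hol_at f p \<Longrightarrow> hol_at (\<lambda>p. f p ^ n) p"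
  by (induction n) (auto intro: hol_at_const hol_at_mult)

lemma hol_at_sum: "finite A \<Longrightarrow> (\<And>i. i \<in> A \<Longrightarrow> hol_at (f i) p) \<Longrightarrow> hol_at (\<lambda>p. \<Sum>i\<in>A. f i p) p"
  by (induction A rule: finite_induct) (auto intro: hol_at_const hol_at_add)

lemma hol_at_hom2:
  assumes "hom2 n F" "hol_at f p" "hol_at g p"
  shows "hol_at (\<lambda>p. F (f p) (g p)) p"
proof -
  obtain \<alpha> where \<alpha>: "\<And>x z. F x z = (\<Sum>j\<le>n. \<alpha> j * x ^ j * z ^ (n - j))"
    using assms(1) by (rule hom2E) blast
  show ?thesis
    unfolding \<alpha> by (intro hol_at_sum hol_at_mult hol_at_const hol_at_power assms) auto
qed

lemma holomorphic_map_on_cvec3: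
  assumes "\<And>p. p \<in> S \<Longrightarrow> hol_at f p" "\<And>p. p \<in> S \<Longrightarrow> hol_at g p" "\<And>p. p \<in> S \<Longrightarrow> hol_at h p"
  shows "holomorphic_map_on (\<lambda>p. cvec3 (f p) (g p) (h p)) S"
  unfolding holomorphic_map_on_def
proof
  fix p assume p: "p \<in> S"
  obtain D E K where D: "(f has_derivative D) (at p)" "\<And>c v. D (c *s v) = c * D v"
    and E: "(g has_derivative E) (at p)" "\<And>c v. E (c *s v) = c * E v"
    and K: "(h has_derivative K) (at p)" "\<And>c v. K (c *s v) = c * K v"
    using assms[OF p] unfolding hol_at_def by blast
  have ax: "bounded_linear (axis i :: complex \<Rightarrow> complex ^ 3)" for i
    unfolding linear_conv_bounded_linear[symmetric] by (rule linearI) (simp_all add: vec_eq_iff axis_def)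
  have cv: "cvec3 a b c = axis 1 a + axis 2 b + axis 3 c" for a b c
    by (simp add: vec_eq_iff forall_3 axis_def)
  have "((\<lambda>p. cvec3 (f p) (g p) (h p)) has_derivative (\<lambda>v. cvec3 (D v) (E v) (K v))) (at p)"
    unfolding cv
    by (intro has_derivative_add bounded_linear.has_derivative[OF ax] D E K)
  moreover have "cvec3 (D (c *s v)) (E (c *s v)) (K (c *s v)) = c *s cvec3 (D v) (E v) (K v)" for c v
    by (simp add: vec_eq_iff forall_3 D E K)
  ultimately show "\<exists>D. ((\<lambda>p. cvec3 (f p) (g p) (h p)) has_derivative D) (at p) \<and> (\<forall>c v. D (c *s v) = c *s D v)"
    by blast
qed

lemma holomorphic_map_on_imp_continuous_on: "holomorphic_map_on f S \<Longrightarrow> continuous_on S f"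
  unfolding holomorphic_map_on_def
  by (meson continuous_at_imp_continuous_on has_derivative_continuous)

lemma germ_of_eq_0_iff: "germ_of X = 0 \<longleftrightarrow> (\<forall>\<^sub>F p in nhds 0. X p = 0)"
  unfolding zero_germ.abs_eq germ.abs_eq_iff germ_rel_def ..

text \<open>The matrix with columns \<open>(a1, a2)\<close> and \<open>(- cnj a2, cnj a1)\<close>
  has determinant \<open>n\<close>, the squared norm of \<open>a\<close>. Completing
  \<open>a\<close> by an orthogonal vector gives an explicit inverse whichever of the two entries is
  nonzero.\<close>

lemma skew_coordinates:
  fixes a1 a2 :: complex
  assumes "a1 \<noteq> 0 \<or> a2 \<noteq> 0"
  defines "n \<equiv> a1 * cnj a1 + a2 * cnj a2"
  shows "a1 * (cnj a1 / n * p1 + cnj a2 / n * p2) + - cnj a2 * (- a2 / n * p1 + a1 / n * p2) = p1"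
    and "a2 * (cnj a1 / n * p1 + cnj a2 / n * p2) + cnj a1 * (- a2 / n * p1 + a1 / n * p2) = p2"
    and "cnj a1 / n * (a1 * x + - cnj a2 * z) + cnj a2 / n * (a2 * x + cnj a1 * z) = x"
    and "- a2 / n * (a1 * x + - cnj a2 * z) + a1 / n * (a2 * x + cnj a1 * z) = z"
proof -
  have "n = of_real ((norm a1)\<^sup>2 + (norm a2)\<^sup>2)" by (simp add: n_def complex_norm_square del: of_real_power)
  moreover have "(norm a1)\<^sup>2 + (norm a2)\<^sup>2 \<noteq> 0" using assms(1) by (simp add: sum_power2_eq_zero_iff)
  ultimately have n0: "n \<noteq> 0" by (metis of_real_eq_0_iff)
  have "a1 * (cnj a1 / n * p1 + cnj a2 / n * p2) + - cnj a2 * (- a2 / n * p1 + a1 / n * p2) = n * p1 / n"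
    "a2 * (cnj a1 / n * p1 + cnj a2 / n * p2) + cnj a1 * (- a2 / n * p1 + a1 / n * p2) = n * p2 / n"
    "cnj a1 / n * (a1 * x + - cnj a2 * z) + cnj a2 / n * (a2 * x + cnj a1 * z) = n * x / n"
    "- a2 / n * (a1 * x + - cnj a2 * z) + a1 / n * (a2 * x + cnj a1 * z) = n * z / n"
    using n0 by (simp_all add: divide_simps) (simp_all add: n_def algebra_simps)
  with n0 show "a1 * (cnj a1 / n * p1 + cnj a2 / n * p2) + - cnj a2 * (- a2 / n * p1 + a1 / n * p2) = p1"
    "a2 * (cnj a1 / n * p1 + cnj a2 / n * p2) + cnj a1 * (- a2 / n * p1 + a1 / n * p2) = p2"
    "cnj a1 / n * (a1 * x + - cnj a2 * z) + cnj a2 / n * (a2 * x + cnj a1 * z) = x"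
    "- a2 / n * (a1 * x + - cnj a2 * z) + a1 / n * (a2 * x + cnj a1 * z) = z" by simp_all
qed

context homogeneous_polynomial
begin

lemma hom3_P: "hom3 d (\<lambda>y z. of_real (P (u1 * of_real y + v1 * z) (u2 * of_real y + v2 * z)))"
proof -
  have "hom3 d (\<lambda>y z. case i of (a1, a2, b1, b2) \<Rightarrow> c a1 a2 b1 b2 * (u1 * of_real y + v1 * z) ^ a1 * (u2 * of_real y + v2 * z) ^ a2
      * cnj (u1 * of_real y + v1 * z) ^ b1 * cnj (u2 * of_real y + v2 * z) ^ b2)"
    if "i \<in> multi_indices d" for i
  proof -
    obtain a1 a2 b1 b2 where i: "i = (a1, a2, b1, b2)" by (cases i)
    then have d: "a1 + (a2 + (b1 + (b2 + 0))) = d" using that by (simp add: multi_indices_def)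
    show ?thesis
      using hom3_mult_lin_power[OF hom3_mult_lin_power[OF hom3_mult_lin_power[OF hom3_mult_lin_power[OF hom3_const,
        of b2 "cnj u2" 0 "cnj v2" "c a1 a2 b1 b2"], of b1 "cnj u1" 0 "cnj v1"], of a2 u2 v2 0], of a1 u1 v1 0]
      unfolding d by (simp add: i mult_ac)
  qed
  then show ?thesis
    unfolding P_eq by (intro hom3_sum finite_multi_indices) auto
qed

lemma dP_cmult_linear: "dP z1 z2 (of_real s * v1) (of_real s * v2) = s * dP z1 z2 v1 v2"
  using dP10_linear[of z1 z2 "of_real s" v1 0 0 v2 0] by (simp add: dP_def)

lemma normal_form:
  assumes d: "d \<ge> 3" and nondeg: "holomorphically_nondegenerate P"
    and a0: "a1 \<noteq> 0 \<or> a2 \<noteq> 0"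
    and hom: "hom2 d q1" "hom2 d q2" "hom2 (d - 1) G" "hom2 (2 * d - 1) h"
    and eq1: "\<And>z1 z2. Im (G z1 z2) = dP z1 z2 a1 a2"
    and eq2: "\<And>z1 z2. P z1 z2 * Re (G z1 z2) + Im (h z1 z2)
       = P z1 z2 * dP z1 z2 (\<i> * a1) (\<i> * a2) + dP z1 z2 (q1 z1 z2) (q2 z1 z2)"
  obtains F \<mu> \<nu> where "hom2 d F" "\<mu> \<noteq> 0"
    "\<And>x z. P (a1 * x + - cnj a2 * z) (a2 * x + cnj a1 * z) = Im (F x z) + Re ((\<mu> * x + \<nu> * z) * cnj z ^ (d - 1))"
proof -
  define L1 L2 where "L1 x z = a1 * x + - cnj a2 * z" and "L2 x z = a2 * x + cnj a1 * z" for x z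
  define n where "n = a1 * cnj a1 + a2 * cnj a2"
  define g where "g x z = G (L1 x z) (L2 x z)" for x z
  have g: "hom2 (d - 1) g" unfolding g_def L1_def L2_def by (rule hom2_subst[OF hom(3)])
  have Sd: "Suc (d - 1) = d" using d by simp
  obtain K H where KH: "hom2 d K" "hom2 (d - 1) H"
    "\<And>x z. ((\<lambda>p. K (fst p) (snd p)) has_derivative (\<lambda>v. g x z * fst v + H x z * snd v)) (at (x, z))"
    using hom2_antiderivative[OF g] unfolding Sd by blast
  define R where "R x z = P (L1 x z) (L2 x z)" for x z
  have R: "((\<lambda>p. R (fst p) (snd p)) has_derivative
      (\<lambda>v. dP (L1 x z) (L2 x z) (L1 (fst v) (snd v)) (L2 (fst v) (snd v)))) (at (x, z))" for x z
    unfolding R_def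
    by (rule has_derivative_eq_rhs[OF P_curve]) (auto intro!: derivative_eq_intros simp: L1_def L2_def)
  \<comment> \<open>Sampling at \<open>Re x = 0\<close> loses nothing: by \<open>eq1\<close> the
    difference \<open>R - Im K\<close> has derivative zero along real translations of
    \<open>x\<close>.\<close>
  define Q where "Q y z = R (\<i> * of_real y) z - Im (K (\<i> * of_real y) z)" for y :: real and z
  have RK: "((\<lambda>p. R (fst p) (snd p) - Im (K (fst p) (snd p))) has_derivative
      (\<lambda>v. dP (L1 x z) (L2 x z) (L1 (fst v) (snd v)) (L2 (fst v) (snd v)) - Im (g x z * fst v + H x z * snd v))) (at (x, z))" for x z
    by (intro has_derivative_diff R bounded_linear.has_derivative[OF bounded_linear_Im KH(3)])
  have RQ: "R x z = Im (K x z) + Q (Im x) z" for x z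
  proof -
    define \<kappa> where "\<kappa> s = R (of_real s + \<i> * of_real (Im x)) z - Im (K (of_real s + \<i> * of_real (Im x)) z)" for s :: real
    have "(\<kappa> has_field_derivative 0) (at s)" for s
    proof -
      let ?x = "of_real s + \<i> * of_real (Im x)"
      have "((\<lambda>s. (of_real s + \<i> * of_real (Im x), z)) has_derivative (\<lambda>v. (of_real v, 0))) (at s)"
        by (auto intro!: derivative_eq_intros)
      from has_derivative_compose[OF this RK]
      have "(\<kappa> has_derivative (\<lambda>v. dP (L1 ?x z) (L2 ?x z) (of_real v * a1) (of_real v * a2) - Im (of_real v * g ?x z))) (at s)"
        by (simp add: \<kappa>_def[abs_def] L1_def L2_def mult_ac)
      moreover have "dP (L1 ?x z) (L2 ?x z) (of_real v * a1) (of_real v * a2) - Im (of_real v * g ?x z) = 0" for v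
        unfolding dP_cmult_linear Im_of_real_mult g_def eq1 by simp
      ultimately have "(\<kappa> has_derivative (\<lambda>v. 0)) (at s)" by simp
      then show ?thesis unfolding has_field_derivative_def lambda_zero .
    qed
    then have "\<kappa> (Re x) = \<kappa> 0" by (intro DERIV_isconst_all) auto
    moreover have "of_real (Re x) + \<i> * of_real (Im x) = x" by (simp add: complex_eq_iff)
    ultimately show ?thesis by (simp add: \<kappa>_def Q_def)
  qed
  have "hom3 d (\<lambda>y z. of_real (Q y z))"
  proof -
    have "hom3 d (\<lambda>y z. of_real (R (\<i> * of_real y) z))"
      using hom3_P[of "a1 * \<i>" "- cnj a2" "a2 * \<i>" "cnj a1"] by (simp add: R_def L1_def L2_def mult.assoc)
    moreover have "hom3 d (\<lambda>y z. - 1 / (2 * \<i>) * K (\<i> * of_real y) z)" "hom3 d (\<lambda>y z. 1 / (2 * \<i>) * cnj (K (\<i> * of_real y) z))"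
      by (intro hom3_cmult hom3_hom2[OF KH(1)])+
    ultimately have "hom3 d (\<lambda>y z. of_real (R (\<i> * of_real y) z)
        + (- 1 / (2 * \<i>) * K (\<i> * of_real y) z + 1 / (2 * \<i>) * cnj (K (\<i> * of_real y) z)))"
      by (intro hom3_add)
    moreover have "- 1 / (2 * \<i>) * w + 1 / (2 * \<i>) * cnj w = - of_real (Im w)" for w
      by (simp add: complex_eq_iff)
    ultimately show ?thesis by (simp add: Q_def)
  qed
  then obtain e where e: "\<And>k j. k + j > d \<Longrightarrow> e k j = 0" "\<And>k j. k + j \<le> d \<Longrightarrow> e k (d - k - j) = cnj (e k j)"
    "\<And>y z. complex_of_real (Q y z) = (\<Sum>k\<le>d. \<Sum>j\<le>d - k. e k j * of_real y ^ k * z ^ j * cnj z ^ (d - k - j))"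
    by (rule hom3_real_coeffs) blast
  have Qe: "Q y z = (\<Sum>k\<le>d. y ^ k * Re (zform (e k) (d - k) z))" for y z
  proof -
    have "complex_of_real (Q y z) = (\<Sum>k\<le>d. of_real (y ^ k) * zform (e k) (d - k) z)"
      unfolding e(3) zform_def sum_distrib_left by (simp add: mult_ac)
    from arg_cong[OF this, of Re] show ?thesis by (simp only: Re_complex_of_real Re_sum Re_of_real_mult)
  qed
  define Qy where "Qy y z = (\<Sum>k\<le>d. real (Suc k) * y ^ k * Re (zform (e (Suc k)) (d - Suc k) z))" for y z
  define Qz where "Qz y z = (\<Sum>k\<le>d. of_real (y ^ k) * zform_deriv (e k) (d - k) z)" for y z
  have dR: "dP (L1 x z) (L2 x z) (L1 v w) (L2 v w) = Im (g x z * v + H x z * w) + Im v * Qy (Im x) z + 2 * Re (w * Qz (Im x) z)"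
    for x z v w
  proof -
    have "((\<lambda>p. \<Sum>k\<le>d. Im (fst p) ^ k * Re (zform (e k) (d - k) (snd p))) has_derivative
      (\<lambda>v. Im (fst v) * Qy (Im x) z + 2 * Re (snd v * Qz (Im x) z))) (at (x, z))"
      unfolding Qy_def Qz_def by (rule tube_function_has_derivative) (use e in auto)
    moreover have "R (fst p) (snd p) - Im (K (fst p) (snd p)) = (\<Sum>k\<le>d. Im (fst p) ^ k * Re (zform (e k) (d - k) (snd p)))" for p
      unfolding RQ Qe by simp
    ultimately have "(\<lambda>v. dP (L1 x z) (L2 x z) (L1 (fst v) (snd v)) (L2 (fst v) (snd v)) - Im (g x z * fst v + H x z * snd v))
      = (\<lambda>v. Im (fst v) * Qy (Im x) z + 2 * Re (snd v * Qz (Im x) z))"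
      using RK[of x z] by (intro has_derivative_unique) auto
    from fun_cong[OF this, of "(v, w)"] show ?thesis by simp
  qed
  \<comment> \<open>\<open>r1\<close> and \<open>r2\<close> are the components of
    \<open>(q1, q2)\<close> in the new coordinates.\<close>
  define r1 where "r1 x z = cnj a1 / n * q1 (L1 x z) (L2 x z) + cnj a2 / n * q2 (L1 x z) (L2 x z)" for x z
  define r2 where "r2 x z = - a2 / n * q1 (L1 x z) (L2 x z) + a1 / n * q2 (L1 x z) (L2 x z)" for x z
  have r: "hom2 d r1" "hom2 d r2"
    unfolding r1_def r2_def L1_def L2_def by (intro hom2_add hom2_cmult hom2_subst hom)+
  have inv: "L1 (cnj a1 / n * p1 + cnj a2 / n * p2) (- a2 / n * p1 + a1 / n * p2) = p1"
    "L2 (cnj a1 / n * p1 + cnj a2 / n * p2) (- a2 / n * p1 + a1 / n * p2) = p2" for p1 p2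
    unfolding L1_def L2_def n_def by (rule skew_coordinates(1,2)[OF a0])+
  \<comment> \<open>The differential of \<open>Im K\<close> contributes
    \<open>Im (g * r1 + H * r2)\<close>, again the imaginary part of a holomorphic form, and so can
    be moved to the side of \<open>h\<close>.\<close>
  define h' where "h' x z = h (L1 x z) (L2 x z) - g x z * r1 x z - H x z * r2 x z" for x z
  have "hom2 (2 * d - 1) h'"
  proof -
    have "d - 1 + d = 2 * d - 1" using d by simp
    then have gh: "hom2 (2 * d - 1) (\<lambda>x z. g x z * r1 x z)" "hom2 (2 * d - 1) (\<lambda>x z. H x z * r2 x z)"
      using hom2_mult[OF g r(1)] hom2_mult[OF KH(2) r(2)] by auto
    have "hom2 (2 * d - 1) (\<lambda>x z. h (L1 x z) (L2 x z))"
      unfolding L1_def L2_def by (rule hom2_subst[OF hom(4)])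
    then show ?thesis unfolding h'_def by (intro hom2_diff gh)
  qed
  then obtain \<eta> where \<eta>: "\<And>j. j > 2 * d - 1 \<Longrightarrow> \<eta> j = 0" "\<And>x z. h' x z = (\<Sum>j\<le>2 * d - 1. \<eta> j * x ^ j * z ^ (2 * d - 1 - j))"
    by (rule hom2E) blast
  \<comment> \<open>In the product of \<open>R\<close> with the derivative in \<open>y\<close>, the
    summand \<open>Im K\<close> of \<open>R\<close> acts like a further contribution to the
    \<open>x\<close>-component, so \<open>r1 + K\<close> takes the role of
    \<open>q\<^sub>1\<close>.\<close>
  have "hom2 d (\<lambda>x z. r1 x z + K x z)" by (intro hom2_add r KH)
  then obtain \<alpha> where \<alpha>: "\<And>j. j > d \<Longrightarrow> \<alpha> j = 0" "\<And>x z. r1 x z + K x z = (\<Sum>j\<le>d. \<alpha> j * x ^ j * z ^ (d - j))"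
    by (rule hom2E) blast
  obtain \<beta> where \<beta>: "\<And>j. j > d \<Longrightarrow> \<beta> j = 0" "\<And>x z. r2 x z = (\<Sum>j\<le>d. \<beta> j * x ^ j * z ^ (d - j))"
    using r(2) by (rule hom2E) blast
  have main: "Q (Im x) z * Qy (Im x) z + Im (r1 x z + K x z) * Qy (Im x) z + 2 * Re (r2 x z * Qz (Im x) z) = Im (h' x z)" for x z
  proof -
    have "L1 (r1 x z) (r2 x z) = q1 (L1 x z) (L2 x z)" "L2 (r1 x z) (r2 x z) = q2 (L1 x z) (L2 x z)"
      unfolding r1_def r2_def by (rule inv)+
    moreover have "\<i> * a1 = L1 \<i> 0" "\<i> * a2 = L2 \<i> 0" by (simp_all add: L1_def L2_def)
    ultimately have "R x z * Re (g x z) + Im (h (L1 x z) (L2 x z))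
       = R x z * dP (L1 x z) (L2 x z) (L1 \<i> 0) (L2 \<i> 0) + dP (L1 x z) (L2 x z) (L1 (r1 x z) (r2 x z)) (L2 (r1 x z) (r2 x z))"
      using eq2[of "L1 x z" "L2 x z"] by (simp add: R_def g_def)
    also have "dP (L1 x z) (L2 x z) (L1 \<i> 0) (L2 \<i> 0) = Re (g x z) + Qy (Im x) z"
      unfolding dR by simp
    finally have "Im (h (L1 x z) (L2 x z)) = (Im (K x z) + Q (Im x) z) * Qy (Im x) z
       + (Im (g x z * r1 x z + H x z * r2 x z) + Im (r1 x z) * Qy (Im x) z + 2 * Re (r2 x z * Qz (Im x) z))"
      unfolding dR RQ by (simp only: algebra_simps)
    moreover have "Im (h' x z) = Im (h (L1 x z) (L2 x z)) - Im (g x z * r1 x z + H x z * r2 x z)"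
      by (simp add: h'_def)
    moreover have "Im (r1 x z + K x z) = Im (r1 x z) + Im (K x z)" by simp
    ultimately show ?thesis by (simp only: algebra_simps)
  qed
  interpret tube_symmetry d e \<alpha> \<beta> \<eta>
  proof
    show "(\<Sum>k\<le>d. Im x ^ k * Re (zform (e k) (d - k) z))
        * (\<Sum>k\<le>d. real (Suc k) * Im x ^ k * Re (zform (e (Suc k)) (d - Suc k) z))
      + Im (\<Sum>j\<le>d. \<alpha> j * x ^ j * z ^ (d - j))
        * (\<Sum>k\<le>d. real (Suc k) * Im x ^ k * Re (zform (e (Suc k)) (d - Suc k) z))
      + 2 * Re ((\<Sum>j\<le>d. \<beta> j * x ^ j * z ^ (d - j))
        * (\<Sum>k\<le>d. of_real (Im x ^ k) * zform_deriv (e k) (d - k) z))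
      = Im (\<Sum>j\<le>2 * d - 1. \<eta> j * x ^ j * z ^ (2 * d - 1 - j))" for x z
      using main[of x z] unfolding \<alpha>(2) \<beta>(2) \<eta>(2) Qe Qy_def Qz_def .
  qed (use d e \<alpha>(1) \<beta>(1) \<eta>(1) in auto)
  \<comment> \<open>If \<open>Q\<close> did not depend on \<open>y\<close>, the derivatives of
    \<open>P\<close> along \<open>a\<close> and \<open>\<i> * a\<close> would be \<open>Im G\<close>
    and \<open>Re G\<close>. Then the nonzero field with components \<open>a1\<close>,
    \<open>a2\<close>, \<open>G\<close> would be tangent as a complex field, against
    nondegeneracy.\<close>
  have "\<exists>k j. k \<ge> 1 \<and> e k j \<noteq> 0"
  proof (rule ccontr)
    assume no: "\<not> (\<exists>k j. k \<ge> 1 \<and> e k j \<noteq> 0)"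
    have Qy0: "Qy y z = 0" for y z
      unfolding Qy_def using no by (intro sum.neutral) (auto simp: zform_def)
    have da: "dP p1 p2 (\<i> * a1) (\<i> * a2) = Re (G p1 p2)" for p1 p2
    proof -
      have "dP (L1 x z) (L2 x z) (L1 \<i> 0) (L2 \<i> 0) = Re (G (L1 x z) (L2 x z))" for x z
        unfolding dR Qy0 by (simp add: g_def)
      from this[of "cnj a1 / n * p1 + cnj a2 / n * p2" "- a2 / n * p1 + a1 / n * p2"] show ?thesis
        unfolding inv by (simp add: L1_def L2_def mult.commute)
    qed
    define X where "X p = cvec3 a1 a2 (G (p $ 1) (p $ 2))" for p :: "complex ^ 3"
    have "tangent_near_0 P X"
      by (rule tangentI) (simp_all add: X_def eq1 da)
    moreover have "holomorphic_near_0 X"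
      unfolding holomorphic_near_0_def X_def
      by (intro exI[of _ UNIV] conjI holomorphic_map_on_cvec3 hol_at_const hol_at_hom2[OF hom(3)] hol_at_nth) auto
    moreover have "germ_of X \<noteq> 0"
    proof
      assume "germ_of X = 0"
      then have "\<forall>\<^sub>F p in nhds 0. X p = 0" by (simp add: germ_of_eq_0_iff)
      then have "X 0 = 0" by (rule eventually_nhds_x_imp_x)
      then have "X 0 $ 1 = 0" "X 0 $ 2 = 0" by simp_all
      then show False using a0 by (simp add: X_def)
    qed
    ultimately show False using nondeg unfolding holomorphically_nondegenerate_def by blast
  qed
  then obtain k j where kj: "k \<ge> 1" "e k j \<noteq> 0" by blast
  note cl = classification[OF kj]
  define l where "l = d - 1"
  have l: "l \<ge> 2" "d - 1 = l" "d = Suc l" using d by (auto simp: l_def)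
  define m where "m = e 1 l"
  have Qf: "Q y z = y * (2 * Re (m * z ^ l)) + (2 * Re (e 0 1 * z * cnj z ^ l) + 2 * Re (e 0 d * z ^ d))" for y z
  proof -
    have "Q y z = Re (zform (e 0) d z) + y * Re (zform (e 1) l z)"
    proof -
      have "Q y z = (\<Sum>k\<in>{0, 1}. y ^ k * Re (zform (e k) (d - k) z))"
        unfolding Qe using cl(1) d by (intro sum.mono_neutral_right) (auto simp: zform_def)
      then show ?thesis using l(2) by simp
    qed
    moreover have "zform (e 1) l z = e 1 0 * cnj z ^ l + e 1 l * z ^ l"
    proof -
      have "zform (e 1) l z = (\<Sum>j\<in>{0, l}. e 1 j * z ^ j * cnj z ^ (l - j))"
        unfolding zform_def using cl(2) l by (intro sum.mono_neutral_right) auto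
      then show ?thesis using l by simp
    qed
    moreover have "zform (e 0) d z = e 0 0 * cnj z ^ d + e 0 1 * z * cnj z ^ l + e 0 l * z ^ l * cnj z + e 0 d * z ^ d"
    proof -
      have "zform (e 0) d z = (\<Sum>j\<in>{0, 1, l, d}. e 0 j * z ^ j * cnj z ^ (d - j))"
        unfolding zform_def
      proof (rule sum.mono_neutral_right)
        show "\<forall>i\<in>{..d} - {0, 1, l, d}. e 0 i * z ^ i * cnj z ^ (d - i) = 0"
        proof
          fix i assume i: "i \<in> {..d} - {0, 1, l, d}"
          then have "2 \<le> i" "i \<le> d - 2" using l by auto
          then show "e 0 i * z ^ i * cnj z ^ (d - i) = 0" using cl(4)[of i] by simp
        qed
      qed (use l in auto)
      then show ?thesis using l by (simp add: add.assoc)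
    qed
    moreover have "e 1 0 = cnj m" using e(2)[of 1 l] l by (simp add: m_def)
    moreover have "e 0 0 = cnj (e 0 d)" using e(2)[of 0 d] by simp
    moreover have "e 0 l = cnj (e 0 1)" using e(2)[of 0 1] l by simp
    moreover have "Re (cnj a * cnj b) = Re (a * b)" for a b by simp
    moreover have "Re (cnj (e 0 1) * z ^ l * cnj z) = Re (e 0 1 * z * cnj z ^ l)"
    proof -
      have "cnj (e 0 1) * z ^ l * cnj z = cnj (e 0 1 * z * cnj z ^ l)" by simp
      then show ?thesis by (metis cnj.sel(1))
    qed
    ultimately show ?thesis by (simp add: m_def flip: complex_cnj_power)
  qed
  \<comment> \<open>With \<open>w = m * z ^ l\<close>, the identity
    \<open>Im x * (2 * Re w) = Im (x * w) + Re (- \<i> * x * cnj w)\<close> splits the term linear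
    in \<open>y\<close>: the first summand enters \<open>F\<close>, the second gives
    \<open>\<mu> = - \<i> * cnj m\<close>. The mixed term of \<open>Q\<close> at
    \<open>y = 0\<close> supplies \<open>\<nu> = 2 * e 0 1\<close>.\<close>
  define F where "F x z = K x z + (m * x * z ^ l + 2 * \<i> * e 0 d * z ^ d)" for x z
  show thesis
  proof (rule that)
    have "hom2 d (\<lambda>x z. m * x ^ 1 * z ^ (d - 1))" "hom2 d (\<lambda>x z. 2 * \<i> * e 0 d * x ^ 0 * z ^ (d - 0))"
      using d by (intro hom2_monomial; simp)+
    then show "hom2 d F" unfolding F_def using l by (intro hom2_add KH) auto
    show "- \<i> * cnj m \<noteq> 0" using cl(3) unfolding m_def l(2) by simp
    fix x z
    have "Im x * (2 * Re w) = Im (x * w) + Re (- \<i> * x * cnj w)" for w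
      by (simp add: algebra_simps)
    from this[of "m * z ^ l"] have 1: "Im x * (2 * Re (m * z ^ l)) = Im (m * x * z ^ l) + Re (- \<i> * cnj m * x * cnj z ^ l)"
      by (simp only: complex_cnj_mult complex_cnj_power mult_ac)
    have 2: "2 * Re w = Im (2 * \<i> * w)" for w by simp
    have 3: "2 * Re w = Re (2 * w)" for w by simp
    have "P (a1 * x + - cnj a2 * z) (a2 * x + cnj a1 * z) = R x z" by (simp add: R_def L1_def L2_def)
    also have "\<dots> = Im (K x z) + (Im (m * x * z ^ l) + Re (- \<i> * cnj m * x * cnj z ^ l)
        + (Re (2 * (e 0 1 * z * cnj z ^ l)) + Im (2 * \<i> * (e 0 d * z ^ d))))"
      unfolding RQ Qf 1 3[of "e 0 1 * z * cnj z ^ l"] 2[of "e 0 d * z ^ d"] ..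
    also have "\<dots> = Im (F x z) + Re ((- \<i> * cnj m * x + 2 * e 0 1 * z) * cnj z ^ l)"
      unfolding F_def plus_complex.sel distrib_right by (simp only: mult.assoc add_ac)
    finally show "P (a1 * x + - cnj a2 * z) (a2 * x + cnj a1 * z)
        = Im (F x z) + Re ((- \<i> * cnj m * x + 2 * e 0 1 * z) * cnj z ^ (d - 1))"
      unfolding l(2) .
  qed
qed


text \<open>The equivalence is a polynomial automorphism of the whole space. Its linear part in
  \<open>z\<close> is invertible because \<open>\<mu> \<noteq> 0\<close>, and the shear
  \<open>w - F\<close> removes the pluriharmonic part. Positive degree of \<open>F\<close> keeps the
  origin fixed.\<close>

lemma biholomorphic_to_model:
  assumes a0: "a1 \<noteq> 0 \<or> a2 \<noteq> 0" and F: "hom2 d F" and d: "d > 0" and \<mu>: "\<mu> \<noteq> 0"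
    and eq: "\<And>x z. P (a1 * x + - cnj a2 * z) (a2 * x + cnj a1 * z) = Im (F x z) + Re ((\<mu> * x + \<nu> * z) * cnj z ^ l)"
  shows "biholomorphically_equivalent_at_0 (hypersurface P) (hypersurface (\<lambda>z1 z2. Re (z1 * cnj z2 ^ l)))"
proof -
  define n where "n = a1 * cnj a1 + a2 * cnj a2"
  define X Z where "X p = cnj a1 / n * p $ 1 + cnj a2 / n * p $ 2" and "Z p = - a2 / n * p $ 1 + a1 / n * p $ 2" for p :: "complex ^ 3"
  define \<Phi> where "\<Phi> p = cvec3 (\<mu> * X p + \<nu> * Z p) (Z p) (p $ 3 - F (X p) (Z p))" for p
  define W where "W p = (p $ 1 - \<nu> * p $ 2) / \<mu>" for p :: "complex ^ 3"
  define \<Psi> where "\<Psi> p = cvec3 (a1 * W p + - cnj a2 * p $ 2) (a2 * W p + cnj a1 * p $ 2) (p $ 3 + F (W p) (p $ 2))" for p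
  note sk = skew_coordinates[OF a0, folded n_def]
  have XZ: "a1 * X p + - cnj a2 * Z p = p $ 1" "a2 * X p + cnj a1 * Z p = p $ 2" for p
    unfolding X_def Z_def by (rule sk(1,2))+
  have W\<Phi>: "W (\<Phi> p) = X p" for p using \<mu> by (simp add: W_def \<Phi>_def)
  have 1: "\<Psi> (\<Phi> p) = p" for p
    unfolding vec_eq_iff forall_3 \<Psi>_def W\<Phi> using XZ[of p] by (simp add: \<Phi>_def)
  have X\<Psi>: "X (\<Psi> p) = W p" "Z (\<Psi> p) = p $ 2" for p
    unfolding X_def Z_def \<Psi>_def cvec3_nth by (rule sk(3,4))+
  have 2: "\<Phi> (\<Psi> p) = p" for p
    unfolding vec_eq_iff forall_3 \<Phi>_def X\<Psi> using \<mu> by (simp add: \<Psi>_def W_def)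
  have hX: "hol_at X p" "hol_at Z p" "hol_at W p" for p
    unfolding X_def Z_def W_def
    by (intro hol_at_add hol_at_diff hol_at_mult hol_at_divide_const hol_at_const hol_at_nth)+
  have h\<Phi>: "holomorphic_map_on \<Phi> UNIV"
    unfolding \<Phi>_def
    by (intro holomorphic_map_on_cvec3 hol_at_add hol_at_diff hol_at_mult hol_at_const hol_at_hom2[OF F] hX hol_at_nth)
  have h\<Psi>: "holomorphic_map_on \<Psi> UNIV"
    unfolding \<Psi>_def
    by (intro holomorphic_map_on_cvec3 hol_at_add hol_at_diff hol_at_mult hol_at_const hol_at_hom2[OF F] hX hol_at_nth)
  have iff: "\<Phi> p \<in> hypersurface (\<lambda>z1 z2. Re (z1 * cnj z2 ^ l)) \<longleftrightarrow> p \<in> hypersurface P" for p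
    using eq[of "X p" "Z p"] unfolding XZ by (auto simp: hypersurface_def \<Phi>_def)
  have "F 0 0 = 0" using hom2_scale[OF F, of 0 0 0] d by (simp add: power_0_left)
  then have "\<Phi> 0 = 0" by (simp add: vec_eq_iff forall_3 \<Phi>_def X_def Z_def)
  moreover have "homeomorphism UNIV UNIV \<Phi> \<Psi>"
    using h\<Phi> h\<Psi> by (intro homeomorphismI holomorphic_map_on_imp_continuous_on) (auto simp: 1 2)
  moreover have "\<Phi> ` (hypersurface P \<inter> UNIV) = hypersurface (\<lambda>z1 z2. Re (z1 * cnj z2 ^ l)) \<inter> UNIV"
  proof (intro set_eqI iffI)
    fix q assume "q \<in> hypersurface (\<lambda>z1 z2. Re (z1 * cnj z2 ^ l)) \<inter> UNIV"
    then have "\<Psi> q \<in> hypersurface P" using iff[of "\<Psi> q"] by (simp add: 2)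
    then show "q \<in> \<Phi> ` (hypersurface P \<inter> UNIV)" using 2[of q] by (metis IntI UNIV_I imageI)
  next
    fix q assume "q \<in> \<Phi> ` (hypersurface P \<inter> UNIV)"
    then obtain p where "q = \<Phi> p" "p \<in> hypersurface P" by blast
    then show "q \<in> hypersurface (\<lambda>z1 z2. Re (z1 * cnj z2 ^ l)) \<inter> UNIV" using iff[of p] by blast
  qed
  ultimately show ?thesis
    unfolding biholomorphically_equivalent_at_0_def using h\<Phi> h\<Psi>
    by (intro exI[of _ UNIV] exI[of _ \<Phi>] exI[of _ \<Psi>]) auto
qed

end

section \<open>Nonzero symmetries of weight 1 - 1/d\<close>

lemma dim_pos_imp_nonzero:
  fixes S :: "'a::real_vector set"
  assumes "dim S > 0"
  obtains x where "x \<in> S" "x \<noteq> 0"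
proof (rule ccontr)
  assume "\<not> thesis"
  then have "S \<subseteq> {0}" using that by blast
  then have "span S = span {}" by (metis empty_iff insert_iff span_empty span_insert_0 subset_singletonD)
  then have "dim S = dim ({} :: 'a set)" by (metis dim_span)
  also have "\<dots> = 0" using dim_eq_card_independent[OF independent_empty] by simp
  finally show False using assms by simp
qed

theorem theorem1p1:
  fixes d :: nat
    and P :: "complex \<Rightarrow> complex \<Rightarrow> real"
    and c :: "nat \<Rightarrow> nat \<Rightarrow> nat \<Rightarrow> nat \<Rightarrow> complex"
  assumes "d > 2"
    and "homogeneous_poly_with_coeffs d c P"
    and "no_pluriharmonic_terms d c"
    and "holomorphically_nondegenerate P"
    and "dim (aut_component P d (1 - 1 / real d)) > 0"
  shows "\<exists>l::nat. l > 0 \<and>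
    biholomorphically_equivalent_at_0 (hypersurface P)
      (hypersurface (\<lambda>z1 z2. Re (z1 * cnj z2 ^ l)))"
proof -
  interpret homogeneous_polynomial d P c by standard (rule assms)
  obtain \<xi> where \<xi>: "\<xi> \<in> aut_component P d (1 - 1 / real d)" "\<xi> \<noteq> 0"
    using assms(5) by (rule dim_pos_imp_nonzero)
  then obtain Y X where Y: "\<xi> = germ_of Y" "Re_tangent_near_0 P Y"
    and X: "\<xi> = germ_of X" "vf_weighted_homogeneous d (1 - 1 / real d) X"
    unfolding aut_component_def aut_germs_def by blast
  \<comment> \<open>The germ has one representative known to be tangent and another known to be
    weighted homogeneous. Tangency at a point involves only the value of the field there, so it
    passes from \<open>Y\<close> to \<open>X\<close>.\<close>
  have "\<forall>\<^sub>F p in nhds 0. Y p = X p"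
    using Y(1) X(1) by (metis germ.abs_eq_iff germ_rel_def)
  with Y(2) have tang: "Re_tangent_near_0 P X"
    unfolding Re_tangent_near_0_def vf_apply_def by eventually_elim simp
  have w: "1 - 1 / real d + 1 / real d = 1" "1 - 1 / real d + 1 = 2 - 1 / real d" by simp_all
  have wh: "weighted_homogeneous d 1 (\<lambda>p. X p $ 1)" "weighted_homogeneous d 1 (\<lambda>p. X p $ 2)"
    "weighted_homogeneous d (2 - 1 / real d) (\<lambda>p. X p $ 3)"
    using X(2) unfolding vf_weighted_homogeneous_def w by auto
  have d: "d > 0" "d > 1" using assms(1) by auto
  obtain a1 q1 where q1: "hom2 d q1" "\<And>p. X p $ 1 = a1 * p $ 3 + q1 (p $ 1) (p $ 2)"
    by (rule weighted_homogeneous_1[OF d(1) wh(1)]) blast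
  obtain a2 q2 where q2: "hom2 d q2" "\<And>p. X p $ 2 = a2 * p $ 3 + q2 (p $ 1) (p $ 2)"
    by (rule weighted_homogeneous_1[OF d(1) wh(2)]) blast
  obtain G h where Gh: "hom2 (d - 1) G" "hom2 (2 * d - 1) h" "\<And>p. X p $ 3 = p $ 3 * G (p $ 1) (p $ 2) + h (p $ 1) (p $ 2)"
    by (rule weighted_homogeneous_2[OF d(2) wh(3)]) blast
  have glob: "Im (w * G z1 z2 + h z1 z2) = dP z1 z2 (a1 * w + q1 z1 z2) (a2 * w + q2 z1 z2)" if "Im w = P z1 z2" for w z1 z2
    by (rule global_tangency[OF tang _ q1(2) q2(2) Gh(3) q1(1) q2(1) Gh(1,2) that]) (use assms(1) in simp)
  have eqs: "Im (G z1 z2) = dP z1 z2 a1 a2"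
    "P z1 z2 * Re (G z1 z2) + Im (h z1 z2) = P z1 z2 * dP z1 z2 (\<i> * a1) (\<i> * a2) + dP z1 z2 (q1 z1 z2) (q2 z1 z2)" for z1 z2
    by (rule tangency_components, rule glob, assumption)+
  have a0: "a1 \<noteq> 0 \<or> a2 \<noteq> 0"
  proof (rule ccontr)
    assume "\<not> (a1 \<noteq> 0 \<or> a2 \<noteq> 0)"
    then have a: "a1 = 0" "a2 = 0" by auto
    have dP0: "dP z1 z2 0 0 = 0" for z1 z2
      using dP_cmult_linear[of z1 z2 0 0 0] by simp
    have im: "Im (G z1 z2) = 0" for z1 z2
      using eqs(1)[of z1 z2] by (simp add: a dP0)
    \<comment> \<open>Rotating \<open>z\<close> by \<open>t\<close> on the circle multiplies
      \<open>G\<close> by \<open>t ^ (d - 1)\<close>, and since \<open>d - 1 > 0\<close> a real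
      value for all \<open>t\<close> forces it to vanish.\<close>
    have G0: "G z1 z2 = 0" for z1 z2
    proof -
      have "monom (- \<i> * G z1 z2) (d - 1) = 0"
      proof (rule poly_eq_0_if_Re_zero_on_circle)
        fix t :: complex
        have "Im (t ^ (d - 1) * G z1 z2) = 0"
          using im[of "t * z1" "t * z2"] unfolding hom2_scale[OF Gh(1)] .
        then show "Re (poly (monom (- \<i> * G z1 z2) (d - 1)) t) = 0"
          by (simp add: poly_monom mult_ac)
      qed (use assms(1) in auto)
      then show ?thesis by simp
    qed
    have eq: "dP z1 z2 (q1 z1 z2) (q2 z1 z2) = Im (h z1 z2)" for z1 z2
      using eqs(2)[of z1 z2] by (simp add: a dP0 G0)
    have triv: "dP10 z1 z2 (q1 z1 z2) (q2 z1 z2) = 0" "h z1 z2 = 0" for z1 z2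
      using rigid_tangency_trivial[OF _ assms(3) eq q1(1) q2(1) Gh(2)] assms(1) by auto
    have "X p = cvec3 (q1 (p $ 1) (p $ 2)) (q2 (p $ 1) (p $ 2)) 0" for p
      by (simp add: vec_eq_iff forall_3 q1(2) q2(2) Gh(3) a G0 triv)
    then have Xeq: "X = (\<lambda>p. cvec3 (q1 (p $ 1) (p $ 2)) (q2 (p $ 1) (p $ 2)) 0)" by (rule ext)
    have "tangent_near_0 P X"
    proof (rule tangentI)
      fix p
      show "Im (X p $ 3) = dP (p $ 1) (p $ 2) (X p $ 1) (X p $ 2)"
        by (simp add: Xeq dP_def triv)
      show "Re (X p $ 3) = dP (p $ 1) (p $ 2) (\<i> * X p $ 1) (\<i> * X p $ 2)"
        using dP10_linear[of "p $ 1" "p $ 2" \<i> "X p $ 1" 0 0 "X p $ 2" 0] by (simp add: Xeq dP_def triv)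
    qed
    moreover have "holomorphic_near_0 X"
      unfolding holomorphic_near_0_def Xeq
      by (intro exI[of _ UNIV] conjI holomorphic_map_on_cvec3 hol_at_const hol_at_hom2[OF q1(1)] hol_at_hom2[OF q2(1)] hol_at_nth) auto
    ultimately show False using assms(4) \<xi>(2) X(1) unfolding holomorphically_nondegenerate_def by blast
  qed
  have d3: "d \<ge> 3" using assms(1) by simp
  obtain F \<mu> \<nu> where "hom2 d F" "\<mu> \<noteq> 0"
    "\<And>x z. P (a1 * x + - cnj a2 * z) (a2 * x + cnj a1 * z) = Im (F x z) + Re ((\<mu> * x + \<nu> * z) * cnj z ^ (d - 1))"
    by (rule normal_form[OF d3 assms(4) a0 q1(1) q2(1) Gh(1,2) eqs]) (rule that)
  then have "biholomorphically_equivalent_at_0 (hypersurface P) (hypersurface (\<lambda>z1 z2. Re (z1 * cnj z2 ^ (d - 1))))"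
    by (intro biholomorphic_to_model[OF a0]) (use assms(1) in auto)
  then show ?thesis using assms(1) by (intro exI[of _ "d - 1"]) simp
qed

end
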